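(* Let $n$ and $k$ be positive integers with $2k<n$, and let $(S^n,g_0)$ be the round unit sphere $S^n\subset\mathbb{R}^{n+1}$ of constant sectional curvature one. Let \[ \mathcal{V}_{2k} := \Bigl\{ u\in C^\infty(S^n) : \int_{S^n} |u|^{\frac{2n}{n-2k}}\,d\mathrm{vol}_{g_0} = \omega_n \Bigr\}, \qquad \mathcal{E}_{2k}(u) := \int_{S^n} u\,L_{2k}u\,d\mathrm{vol}_{g_0}. \] Suppose $u\in\mathcal{V}_{2k}$ is positive and is a local minimizer of $\mathcal{E}_{2k}\colon\mathcal{V}_{2k}\to\mathbb{R}$. Then there is a point $\xi\in B^{n+1}$ (the open unit ball of $\mathbb{R}^{n+1}$) such that \[ u(\zeta) = \left(\frac{1+\xi\cdot\zeta}{(1-|\xi|^2)^{1/2}}\right)^{-\frac{n-2k}{2}} \quad\text{for all } \zeta\in S^n. \]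
   Context: $\omega_n$ denotes the volume of the round unit sphere $S^n$. $\Delta$ is the (nonpositive) Laplace–Beltrami operator of $g_0$. The GJMS operator of order $2k$ on $(S^n,g_0)$ is $L_{2k} := \prod_{j=1}^k\bigl(-\Delta + \tfrac{(n-2j)(n+2j-2)}{4}\bigr)$. "Local minimizer" means that $\mathcal{E}_{2k}(v)\ge\mathcal{E}_{2k}(u)$ for all $v\in\mathcal{V}_{2k}$ in a neighborhood of $u$ (in the $C^\infty$ topology); in particular the first variation vanishes and the second variation is nonnegative along every smooth curve in $\mathcal{V}_{2k}$ through $u$. *)

theory Defs
  imports "HOL-Analysis.Analysis"
begin

text \<open>The unit sphere S^n is realised as sphere 0 1 in a Euclidean space 'a with
DIM('a) = n + 1. A function on S^n is represented by any u :: 'a => real; only its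
values on the sphere matter for every notion below.\<close>

definition sph_ext :: "('a::euclidean_space \<Rightarrow> real) \<Rightarrow> 'a \<Rightarrow> real" where
  "sph_ext u x = u (x /\<^sub>R norm x)"

definition pdiff :: "'a::euclidean_space \<Rightarrow> ('a \<Rightarrow> real) \<Rightarrow> 'a \<Rightarrow> real" where
  "pdiff i f x = deriv (\<lambda>t. f (x + t *\<^sub>R i)) 0"

fun pdiffs :: "'a::euclidean_space list \<Rightarrow> ('a \<Rightarrow> real) \<Rightarrow> 'a \<Rightarrow> real" where
  "pdiffs [] f = f"
| "pdiffs (i # is) f = pdiff i (pdiffs is f)"

definition sph_smooth :: "('a::euclidean_space \<Rightarrow> real) \<Rightarrow> bool" where
  "sph_smooth u \<longleftrightarrow>
     (\<forall>is. set is \<subseteq> Basis \<longrightarrow>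
        continuous_on (- {0}) (pdiffs is (sph_ext u)) \<and>
        (\<forall>x \<in> - {0}. \<forall>i \<in> Basis.
            (\<lambda>t. pdiffs is (sph_ext u) (x + t *\<^sub>R i)) differentiable (at 0)))"

text \<open>Integral over S^n with respect to the round volume measure, via the cone
construction: int_{S^n} f dvol = (n+1) * int_{B^{n+1}} f(x/|x|) dx.\<close>
definition sph_integral :: "('a::euclidean_space \<Rightarrow> real) \<Rightarrow> real" where
  "sph_integral f = real DIM('a) * (LINT x : ball 0 1 | lborel. f (x /\<^sub>R norm x))"

definition sph_vol :: "'a::euclidean_space itself \<Rightarrow> real" where
  "sph_vol _ = sph_integral (\<lambda>x::'a. 1)"

text \<open>Laplace--Beltrami operator of the round sphere: Euclidean Laplacian of the
zero-homogeneous extension, evaluated on the sphere.\<close>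
definition sph_lap :: "('a::euclidean_space \<Rightarrow> real) \<Rightarrow> 'a \<Rightarrow> real" where
  "sph_lap u x = (\<Sum>i\<in>Basis. pdiff i (pdiff i (sph_ext u)) x)"

definition gjms :: "nat \<Rightarrow> nat \<Rightarrow> ('a::euclidean_space \<Rightarrow> real) \<Rightarrow> 'a \<Rightarrow> real" where
  "gjms n k u = foldr (\<lambda>j v x. - sph_lap v x
        + ((real n - 2 * real j) * (real n + 2 * real j - 2) / 4) * v x) [1..<Suc k] u"

definition Vset :: "nat \<Rightarrow> nat \<Rightarrow> ('a::euclidean_space \<Rightarrow> real) set" where
  "Vset n k = {u. sph_smooth u \<and>
     sph_integral (\<lambda>x. \<bar>u x\<bar> powr (2 * real n / (real n - 2 * real k))) = sph_vol TYPE('a)}"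

definition energy :: "nat \<Rightarrow> nat \<Rightarrow> ('a::euclidean_space \<Rightarrow> real) \<Rightarrow> real" where
  "energy n k u = sph_integral (\<lambda>x. u x * gjms n k u x)"

text \<open>Local minimizer of E_{2k} on V_{2k} in the C^infinity topology: some basic
C^infinity-neighbourhood {v : |D^alpha v - D^alpha u| < eps on S^n for |alpha| <= m}
on which E_{2k}(v) >= E_{2k}(u).\<close>
definition local_minimizer :: "nat \<Rightarrow> nat \<Rightarrow> ('a::euclidean_space \<Rightarrow> real) \<Rightarrow> bool" where
  "local_minimizer n k u \<longleftrightarrow> u \<in> Vset n k \<and>
     (\<exists>m::nat. \<exists>\<epsilon>>0. \<forall>v \<in> Vset n k.
        (\<forall>\<zeta> \<in> sphere 0 1. \<forall>is. set is \<subseteq> Basis \<and> length is \<le> m \<longrightarrow>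
           \<bar>pdiffs is (sph_ext v) \<zeta> - pdiffs is (sph_ext u) \<zeta>\<bar> < \<epsilon>)
        \<longrightarrow> energy n k u \<le> energy n k v)"

end

theory Submission
  imports Defs
begin

text \<open>The rearrangement-free argument of Frank and Lieb in the form given by Case. Minimizing
\<open>\<integral> (ln (1 + \<xi> \<bullet> x) - 1/2 ln (1 - |\<xi>|\<^sup>2)) u\<^sup>p\<close> over the unit ball yields an affine function
\<open>\<tau> = a + b \<bullet> x\<close>, \<open>a\<^sup>2 - |b|\<^sup>2 = 1\<close>, and affine functions \<open>y\<^sub>i\<close> completing it to a Lorentz frame such that
\<open>\<integral> (y\<^sub>i / \<tau>) u\<^sup>p = 0\<close>. The second variation in the directions \<open>y\<^sub>i w\<close>, \<open>w = u / \<tau>\<close>, is summed over i.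
As the frame is Lorentzian, \<open>\<Sum> y\<^sub>i L (y\<^sub>i w) - \<tau> L (\<tau> w) = \<Sum> x\<^sub>i L (x\<^sub>i w) - L w\<close>, and for \<open>L = L\<^sub>2\<^sub>k\<close> the right-hand
side is \<open>k (n + 2k - 2) L\<^sub>2\<^sub>k\<^sub>-\<^sub>2 w\<close>. With \<open>f = \<tau>\<close> to the power \<open>n/2 - k\<close> times u and \<open>\<Delta>'\<close> the (positive)
Laplacian of \<open>\<tau>\<^sup>-\<^sup>2 g\<close>, the resulting inequality says that the \<open>\<tau>\<^sup>-\<^sup>n\<close>-weighted integral of
\<open>f \<Delta>' \<Prod>\<^sub>j (\<Delta>' + c\<^sub>j) f\<close>, \<open>j < k\<close>, \<open>c\<^sub>j > 0\<close>, is not positive. Hence f is constant, and the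
constant is 1 because \<open>\<tau>\<^sup>-\<^sup>2 g\<close> has the same volume as g.\<close>


text \<open>The constants fit because \<open>p = 2n / (n - 2k)\<close> gives
  \<open>p - 2 = 4k / (n - 2k)\<close>: dividing the factor \<open>k (n + 2k - 2)\<close> of the
  frame identity by \<open>p - 2\<close> yields exactly
  \<open>c = (n - 2k) (n + 2k - 2) / 4\<close>, the zero-order term of the factor of
  \<open>L_2k\<close> that is applied to u first. The summed second variation thus bounds the energy
  of u by c times the \<open>L_(2k-2)\<close> energy of w. Conjugation by a power of \<tau> turns
  the energy of u into the same multiple of the same quantity plus a term containing one more
  conformal Laplacian, and only that term survives. Functions live on punctured Euclidean space as
  extensions constant on rays. There the spherical Laplacian and gradient are \<open>|x|^2\<close>
  times the flat ones, partial derivatives commute, and Euler's identity for homogeneous functions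
  removes every radial term. Conformal covariance of \<open>L_2k\<close> is obtained from algebra:
  multiplication by an affine function carries \<open>L_(2k+2)\<close> to \<open>L_2k\<close>
  composed with a second-order operator, so induction on k only ever compares second-order
  expressions.\<close>

section \<open>Smooth functions on punctured Euclidean space\<close>

text \<open>These are the clauses of \<open>sph_smooth\<close> for an arbitrary function in place of
  an extension constant on rays. Partial derivatives of extensions have other degrees of homogeneity
  and must stay inside the class.\<close>

definition smooth0 :: "('a::euclidean_space \<Rightarrow> real) \<Rightarrow> bool" where
  "smooth0 f \<longleftrightarrow> (\<forall>is. set is \<subseteq> Basis \<longrightarrow>
        continuous_on (- {0}) (pdiffs is f) \<and>
        (\<forall>x \<in> - {0}. \<forall>i \<in> Basis. (\<lambda>t. pdiffs is f (x + t *\<^sub>R i)) differentiable (at 0)))"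

lemma sph_smooth_iff: "sph_smooth u \<longleftrightarrow> smooth0 (sph_ext u)"
  by (simp add: sph_smooth_def smooth0_def)

lemma pdiff_eqI:
  assumes "((\<lambda>t. f (x + t *\<^sub>R i)) has_real_derivative d) (at 0)"
  shows "pdiff i f x = d"
  using assms by (simp add: pdiff_def DERIV_imp_deriv)

lemma eventually_line_nonzero:
  assumes "x \<noteq> (0::'a::real_normed_vector)"
  shows "\<forall>\<^sub>F t in nhds (0::real). x + t *\<^sub>R i \<noteq> 0"
proof -
  have "((\<lambda>t::real. x + t *\<^sub>R i) \<longlongrightarrow> x + 0 *\<^sub>R i) (nhds 0)"
    by (intro tendsto_intros filterlim_ident)
  then have "((\<lambda>t::real. x + t *\<^sub>R i) \<longlongrightarrow> x) (nhds 0)" by simp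
  then show ?thesis
    using topological_tendstoD[of _ x "nhds 0" "- {0}"] assms by (auto simp: open_Compl)
qed

text \<open>A line through a nonzero point misses the origin for small \<open>t\<close>, so whatever
  value a representative takes at the origin never enters a derivative.\<close>

lemma pdiff_cong0:
  assumes "\<And>y. y \<noteq> 0 \<Longrightarrow> f y = g y" "x \<noteq> (0::'a::euclidean_space)"
  shows "pdiff i f x = pdiff i g x"
  unfolding pdiff_def
proof (rule deriv_cong_ev)
  show "\<forall>\<^sub>F t in nhds 0. f (x + t *\<^sub>R i) = g (x + t *\<^sub>R i)"
    using eventually_line_nonzero[OF assms(2)] by eventually_elim (use assms(1) in auto)
qed simp

lemma pdiffs_cong0:
  assumes "\<And>y. y \<noteq> 0 \<Longrightarrow> f y = g y" "x \<noteq> (0::'a::euclidean_space)"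
  shows "pdiffs is f x = pdiffs is g x"
  using assms(2)
proof (induction "is" arbitrary: x)
  case (Cons i "is")
  then show ?case by (auto intro!: pdiff_cong0)
qed (use assms(1) in auto)

lemma differentiable_line_cong0:
  assumes "\<And>y. y \<noteq> 0 \<Longrightarrow> f y = g y" "x \<noteq> (0::'a::euclidean_space)"
    and "(\<lambda>t::real. f (x + t *\<^sub>R i)) differentiable (at 0)"
  shows "(\<lambda>t::real. g (x + t *\<^sub>R i) :: real) differentiable (at 0)"
proof -
  obtain d where "((\<lambda>t::real. f (x + t *\<^sub>R i)) has_real_derivative d) (at 0)"
    using assms(3) real_differentiable_def by blast
  moreover have "\<forall>\<^sub>F t in nhds (0::real). f (x + t *\<^sub>R i) = g (x + t *\<^sub>R i)"
    using eventually_line_nonzero[OF assms(2)] by eventually_elim (use assms(1) in auto)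
  ultimately have "((\<lambda>t::real. g (x + t *\<^sub>R i)) has_real_derivative d) (at 0)"
    by (subst DERIV_cong_ev[symmetric]) auto
  then show ?thesis using real_differentiable_def by blast
qed

lemma pdiffs_append: "pdiffs (is @ js) f = pdiffs is (pdiffs js f)"
  by (induction "is") auto

text \<open>A class of continuous functions closed under first partial derivatives, up to values at
  the origin, contains all iterated derivatives of its members. Closure properties of
  \<open>smooth0\<close> thereby reduce to first-order rules.\<close>

lemma smooth0_coinduct:
  fixes f :: "'a::euclidean_space \<Rightarrow> real"
  assumes "P f"
    and step: "\<And>g. P g \<Longrightarrow> continuous_on (- {0}) g \<and>
      (\<forall>i\<in>Basis. \<exists>h. P h \<and> (\<forall>x. x \<noteq> 0 \<longrightarrow> ((\<lambda>t. g (x + t *\<^sub>R i)) has_real_derivative h x) (at 0)))"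
  shows "smooth0 f"
proof -
  have *: "\<exists>g. P g \<and> (\<forall>x. x \<noteq> 0 \<longrightarrow> pdiffs is f x = g x)" if "set is \<subseteq> Basis" for "is"
    using that
  proof (induction "is")
    case (Cons i "is")
    then obtain g where g: "P g" "\<And>x. x \<noteq> 0 \<Longrightarrow> pdiffs is f x = g x" by auto
    with step[OF g(1)] Cons.prems obtain h where h: "P h"
      "\<And>x. x \<noteq> 0 \<Longrightarrow> ((\<lambda>t. g (x + t *\<^sub>R i)) has_real_derivative h x) (at 0)" by auto
    have "pdiffs (i # is) f x = h x" if "x \<noteq> 0" for x
    proof -
      have "pdiff i (pdiffs is f) x = pdiff i g x"
        using g(2) that by (rule pdiff_cong0)
      then show ?thesis using pdiff_eqI[OF h(2)[OF that]] by simp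
    qed
    with h(1) show ?case by blast
  qed (use assms(1) in auto)
  show ?thesis
    unfolding smooth0_def
  proof (intro allI impI conjI ballI)
    fix "is" :: "'a list" assume "set is \<subseteq> Basis"
    from *[OF this] obtain g where g: "P g" "\<And>x. x \<noteq> 0 \<Longrightarrow> pdiffs is f x = g x" by auto
    show "continuous_on (- {0}) (pdiffs is f)"
      using step[OF g(1)] g(2) by (subst continuous_on_cong[OF refl, of _ _ g]) auto
    fix x i :: 'a assume x: "x \<in> - {0}" and i: "i \<in> Basis"
    have "(\<lambda>t. g (x + t *\<^sub>R i)) differentiable (at 0)"
      using step[OF g(1)] x i real_differentiable_def by blast
    then show "(\<lambda>t. pdiffs is f (x + t *\<^sub>R i)) differentiable (at 0)"
      by (rule differentiable_line_cong0[rotated 2]) (use g(2) x in auto)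
  qed
qed

lemma smooth0_pdiff: "smooth0 f \<Longrightarrow> i \<in> Basis \<Longrightarrow> smooth0 (pdiff i f)"
proof -
  assume f: "smooth0 f" and i: "i \<in> Basis"
  \<comment> \<open>\<open>pdiffs\<close> applies the last entry of the list first, so the
    derivative of \<open>f\<close> is absorbed at the end of the list.\<close>
  have "pdiffs is (pdiff i f) = pdiffs (is @ [i]) f" for "is" by (simp add: pdiffs_append)
  then show ?thesis using f i unfolding smooth0_def by (auto simp del: pdiffs.simps)
qed

lemma smooth0_continuous: "smooth0 f \<Longrightarrow> continuous_on (- {0}) f"
  unfolding smooth0_def by (metis empty_set empty_subsetI pdiffs.simps(1))

lemma smooth0_DERIV:
  assumes "smooth0 f" "i \<in> Basis" "x \<noteq> 0"
  shows "((\<lambda>t. f (x + t *\<^sub>R i)) has_real_derivative pdiff i f x) (at 0)"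
proof -
  have "(\<lambda>t. pdiffs [] f (x + t *\<^sub>R i)) differentiable (at 0)"
    using assms unfolding smooth0_def by (metis ComplI empty_set empty_subsetI singletonD)
  then show ?thesis
    using DERIV_deriv_iff_real_differentiable by (fastforce simp: pdiff_def)
qed

lemma smooth0_DERIV_at:
  assumes "smooth0 f" "i \<in> Basis" "x + s *\<^sub>R i \<noteq> 0"
  shows "((\<lambda>t. f (x + t *\<^sub>R i)) has_real_derivative pdiff i f (x + s *\<^sub>R i)) (at s)"
proof -
  have "((\<lambda>t. f ((x + s *\<^sub>R i) + t *\<^sub>R i)) has_real_derivative pdiff i f (x + s *\<^sub>R i)) (at 0)"
    by (rule smooth0_DERIV) (use assms in auto)
  then have "((\<lambda>t. f (x + (t + s) *\<^sub>R i)) has_real_derivative pdiff i f (x + s *\<^sub>R i)) (at 0)"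
    by (simp add: algebra_simps)
  then show ?thesis
    using DERIV_shift[of "\<lambda>t. f (x + t *\<^sub>R i)" _ 0 s] by simp
qed

lemma smooth0_cong:
  assumes f: "smooth0 f" and eq: "\<And>x. x \<noteq> 0 \<Longrightarrow> f x = g x"
  shows "smooth0 g"
  unfolding smooth0_def
proof (intro allI impI conjI ballI)
  fix "is" :: "'a list" assume "is": "set is \<subseteq> Basis"
  have e: "\<And>x. x \<noteq> 0 \<Longrightarrow> pdiffs is f x = pdiffs is g x" by (rule pdiffs_cong0[OF eq])
  show "continuous_on (- {0}) (pdiffs is g)"
    using f "is" e unfolding smooth0_def by (subst continuous_on_cong[OF refl, of _ _ "pdiffs is f"]) auto
  fix x i :: 'a assume "x \<in> - {0}" "i \<in> Basis"
  then show "(\<lambda>t. pdiffs is g (x + t *\<^sub>R i)) differentiable (at 0)"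
    using f "is" unfolding smooth0_def by (intro differentiable_line_cong0[OF e]) auto
qed

section \<open>Closure of smoothness under sums, products and real powers\<close>

text \<open>The invariant for \<open>smooth0_coinduct\<close>: the derivative of each constructor is
  again built from these constructors. Real powers are included because their derivatives are powers
  of the same base with a lower exponent.\<close>

inductive smooth_alg :: "('a::euclidean_space \<Rightarrow> real) \<Rightarrow> bool" where
  base: "smooth0 f \<Longrightarrow> smooth_alg f"
| const: "smooth_alg (\<lambda>x. c)"
| inner: "smooth_alg (\<lambda>x. x \<bullet> b)"
| add: "smooth_alg f \<Longrightarrow> smooth_alg g \<Longrightarrow> smooth_alg (\<lambda>x. f x + g x)"
| mult: "smooth_alg f \<Longrightarrow> smooth_alg g \<Longrightarrow> smooth_alg (\<lambda>x. f x * g x)"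
| powr: "smooth_alg f \<Longrightarrow> (\<forall>x. x \<noteq> 0 \<longrightarrow> f x > 0) \<Longrightarrow> smooth_alg (\<lambda>x. f x powr s)"

lemma smooth_alg_step:
  assumes "smooth_alg g"
  shows "continuous_on (- {0}) g \<and>
      (\<forall>i\<in>Basis. \<exists>h. smooth_alg h \<and> (\<forall>x. x \<noteq> 0 \<longrightarrow> ((\<lambda>t. g (x + t *\<^sub>R i)) has_real_derivative h x) (at 0)))"
  using assms
proof induction
  case (base f)
  then show ?case
    using smooth0_continuous smooth0_DERIV smooth0_pdiff smooth_alg.base by blast
next
  case (const c)
  then show ?case by (auto intro!: exI[of _ "\<lambda>x. 0"] smooth_alg.const)
next
  case (inner b)
  show ?case
  proof (intro conjI ballI)
    fix i :: 'a
    show "\<exists>h. smooth_alg h \<and> (\<forall>x. x \<noteq> 0 \<longrightarrow> ((\<lambda>t. (x + t *\<^sub>R i) \<bullet> b) has_real_derivative h x) (at 0))"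
      by (intro exI[of _ "\<lambda>x. i \<bullet> b"] conjI smooth_alg.const allI impI)
        (auto simp: inner_add_left intro!: derivative_eq_intros)
  qed (intro continuous_intros)
next
  case (add f g)
  show ?case
  proof (intro conjI ballI)
    fix i :: 'a assume "i \<in> Basis"
    with add.IH obtain f' g' where *: "smooth_alg f'" "smooth_alg g'"
      "\<And>x. x \<noteq> 0 \<Longrightarrow> ((\<lambda>t. f (x + t *\<^sub>R i)) has_real_derivative f' x) (at 0)"
      "\<And>x. x \<noteq> 0 \<Longrightarrow> ((\<lambda>t. g (x + t *\<^sub>R i)) has_real_derivative g' x) (at 0)" by metis
    show "\<exists>h. smooth_alg h \<and> (\<forall>x. x \<noteq> 0 \<longrightarrow> ((\<lambda>t. f (x + t *\<^sub>R i) + g (x + t *\<^sub>R i)) has_real_derivative h x) (at 0))"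
      by (intro exI[of _ "\<lambda>x. f' x + g' x"] conjI smooth_alg.add * allI impI derivative_intros)
  qed (use add.IH in \<open>auto intro!: continuous_intros\<close>)
next
  case (mult f g)
  show ?case
  proof (intro conjI ballI)
    fix i :: 'a assume "i \<in> Basis"
    with mult.IH obtain f' g' where *: "smooth_alg f'" "smooth_alg g'"
      "\<And>x. x \<noteq> 0 \<Longrightarrow> ((\<lambda>t. f (x + t *\<^sub>R i)) has_real_derivative f' x) (at 0)"
      "\<And>x. x \<noteq> 0 \<Longrightarrow> ((\<lambda>t. g (x + t *\<^sub>R i)) has_real_derivative g' x) (at 0)" by metis
    show "\<exists>h. smooth_alg h \<and> (\<forall>x. x \<noteq> 0 \<longrightarrow> ((\<lambda>t. f (x + t *\<^sub>R i) * g (x + t *\<^sub>R i)) has_real_derivative h x) (at 0))"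
      by (intro exI[of _ "\<lambda>x. f' x * g x + g' x * f x"] conjI smooth_alg.add smooth_alg.mult * mult.hyps)
        (auto intro!: derivative_eq_intros *)
  qed (use mult.IH in \<open>auto intro!: continuous_intros\<close>)
next
  case (powr f s)
  show ?case
  proof (intro conjI ballI)
    show "continuous_on (- {0}) (\<lambda>x. f x powr s)"
      using powr by (intro continuous_intros) (auto simp: less_imp_neq)
    fix i :: 'a assume "i \<in> Basis"
    with powr.IH obtain f' where *: "smooth_alg f'"
      "\<And>x. x \<noteq> 0 \<Longrightarrow> ((\<lambda>t. f (x + t *\<^sub>R i)) has_real_derivative f' x) (at 0)" by metis
    show "\<exists>h. smooth_alg h \<and> (\<forall>x. x \<noteq> 0 \<longrightarrow> ((\<lambda>t. f (x + t *\<^sub>R i) powr s) has_real_derivative h x) (at 0))"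
    proof (intro exI[of _ "\<lambda>x. s * (f x powr (s - 1)) * f' x"] conjI allI impI)
      show "smooth_alg (\<lambda>x. s * (f x powr (s - 1)) * f' x)"
        by (intro smooth_alg.mult smooth_alg.const smooth_alg.powr * powr)
      fix x :: 'a assume "x \<noteq> 0"
      then show "((\<lambda>t. f (x + t *\<^sub>R i) powr s) has_real_derivative s * (f x powr (s - 1)) * f' x) (at 0)"
        using DERIV_chain'[OF *(2) has_real_derivative_powr, of x s] powr(2) by (simp add: mult_ac)
    qed
  qed
qed

lemma smooth_alg_imp: "smooth_alg f \<Longrightarrow> smooth0 f"
  by (rule smooth0_coinduct[of smooth_alg]) (use smooth_alg_step in auto)

lemma smooth0_const [simp]: "smooth0 (\<lambda>x. c)"
  and smooth0_inner [simp]: "smooth0 (\<lambda>x. x \<bullet> b)"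
  and smooth0_add: "smooth0 f \<Longrightarrow> smooth0 g \<Longrightarrow> smooth0 (\<lambda>x. f x + g x)"
  and smooth0_mult: "smooth0 f \<Longrightarrow> smooth0 g \<Longrightarrow> smooth0 (\<lambda>x. f x * g x)"
  and smooth0_powr: "smooth0 f \<Longrightarrow> (\<And>x. x \<noteq> 0 \<Longrightarrow> f x > 0) \<Longrightarrow> smooth0 (\<lambda>x. f x powr s)"
  by (auto intro!: smooth_alg_imp intro: smooth_alg.intros)

lemma smooth0_sum: "(\<And>i. i \<in> A \<Longrightarrow> smooth0 (f i)) \<Longrightarrow> smooth0 (\<lambda>x. \<Sum>i\<in>A. f i x)"
  by (induction A rule: infinite_finite_induct) (auto intro: smooth0_add)

lemma smooth0_uminus: "smooth0 f \<Longrightarrow> smooth0 (\<lambda>x. - f x)"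
  using smooth0_mult[of "\<lambda>x. - 1" f] by simp

lemma smooth0_norm [simp]: "smooth0 (norm :: 'a::euclidean_space \<Rightarrow> real)"
proof -
  have "smooth0 (\<lambda>x::'a. (\<Sum>i\<in>Basis. (x \<bullet> i) * (x \<bullet> i)) powr (1/2))"
    by (intro smooth0_powr smooth0_sum smooth0_mult smooth0_inner)
      (simp add: euclidean_inner[symmetric])
  then show ?thesis
    by (rule smooth0_cong) (simp add: euclidean_inner[symmetric] powr_half_sqrt norm_eq_sqrt_inner)
qed

lemma smooth0_norm_powr [simp]: "smooth0 (\<lambda>x. norm x powr s)"
  by (rule smooth0_powr) auto

lemma pdiff_const [simp]: "pdiff i (\<lambda>x. c) = (\<lambda>x. 0)"
  by (rule ext, rule pdiff_eqI) auto

lemma pdiff_inner: "pdiff i (\<lambda>x. x \<bullet> b) x = i \<bullet> b"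
  by (rule pdiff_eqI) (auto simp: inner_add_left intro!: derivative_eq_intros)

lemma pdiff_add:
  assumes "smooth0 f" "smooth0 g" "i \<in> Basis" "x \<noteq> 0"
  shows "pdiff i (\<lambda>x. f x + g x) x = pdiff i f x + pdiff i g x"
  using assms by (intro pdiff_eqI derivative_intros smooth0_DERIV)

lemma pdiff_mult:
  assumes "smooth0 f" "smooth0 g" "i \<in> Basis" "x \<noteq> 0"
  shows "pdiff i (\<lambda>x. f x * g x) x = f x * pdiff i g x + g x * pdiff i f x"
  using assms by (intro pdiff_eqI) (auto intro!: derivative_eq_intros smooth0_DERIV)

lemma pdiff_cmult:
  assumes "smooth0 f" "i \<in> Basis" "x \<noteq> 0"
  shows "pdiff i (\<lambda>x. c * f x) x = c * pdiff i f x"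
  using assms by (subst pdiff_mult) auto

lemma pdiff_powr:
  assumes "smooth0 f" "f x > 0" "i \<in> Basis" "x \<noteq> 0"
  shows "pdiff i (\<lambda>x. f x powr s) x = s * f x powr (s - 1) * pdiff i f x"
  using assms DERIV_chain'[OF smooth0_DERIV[OF assms(1,3,4)] has_real_derivative_powr, of s]
  by (intro pdiff_eqI) (simp add: mult_ac)

lemma pdiff_sum:
  assumes "\<And>j. j \<in> A \<Longrightarrow> smooth0 (f j)" "i \<in> Basis" "x \<noteq> 0"
  shows "pdiff i (\<lambda>x. \<Sum>j\<in>A. f j x) x = (\<Sum>j\<in>A. pdiff i (f j) x)"
  using assms by (intro pdiff_eqI DERIV_sum smooth0_DERIV)

lemma pdiff_norm:
  assumes "x \<noteq> (0::'a::euclidean_space)" "i \<in> Basis"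
  shows "pdiff i norm x = (x \<bullet> i) / norm x"
proof -
  have "((\<lambda>t. norm (x + t *\<^sub>R i)) has_derivative (\<lambda>t. (t *\<^sub>R i) \<bullet> sgn x)) (at 0)"
  proof -
    have "((\<lambda>t::real. x + t *\<^sub>R i) has_derivative (\<lambda>t. t *\<^sub>R i)) (at 0)"
      by (auto intro!: derivative_eq_intros)
    from has_derivative_compose[OF this, of norm "\<lambda>h. h \<bullet> sgn x"] show ?thesis
      using has_derivative_norm[OF assms(1)] by simp
  qed
  then have "((\<lambda>t. norm (x + t *\<^sub>R i)) has_real_derivative i \<bullet> sgn x) (at 0)"
    by (simp add: has_field_derivative_def mult_commute_abs)
  then show ?thesis
    using pdiff_eqI[of norm] by (simp add: sgn_div_norm inner_commute divide_inverse mult.commute)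
qed

section \<open>Total differentiability and symmetry of second derivatives\<close>

text \<open>Coordinates are changed one at a time, each costing a mean value estimate in one
  variable. The base point \<open>y\<close> ranges over a neighbourhood of \<open>x\<close>, since
  the induction applies the one-variable estimate at already displaced points while the derivatives
  stay frozen at \<open>x\<close>.\<close>

lemma partial_sum_approx:
  fixes f :: "'a::euclidean_space \<Rightarrow> real"
  assumes f: "smooth0 f" and x: "x \<noteq> 0" and S: "S \<subseteq> Basis" and e: "e > 0"
  shows "\<exists>d>0. \<forall>y h. dist y x < d \<longrightarrow> norm h < d \<longrightarrow>
     \<bar>f (y + (\<Sum>i\<in>S. (h \<bullet> i) *\<^sub>R i)) - f y - (\<Sum>i\<in>S. (h \<bullet> i) * pdiff i f x)\<bar> \<le> e * norm h"
  using finite_subset[OF S finite_Basis] S e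
proof (induction S arbitrary: e rule: finite_induct)
  case empty
  then show ?case by (auto intro!: exI[of _ 1])
next
  case (insert j S)
  from insert.IH[of "e/2"] insert.prems obtain d1 where d1: "d1 > 0"
    "\<And>y h. dist y x < d1 \<Longrightarrow> norm h < d1 \<Longrightarrow> 
     \<bar>f (y + (\<Sum>i\<in>S. (h \<bullet> i) *\<^sub>R i)) - f y - (\<Sum>i\<in>S. (h \<bullet> i) * pdiff i f x)\<bar> \<le> e/2 * norm h"
    by auto
  have j: "j \<in> Basis" using insert by auto
  have "isCont (pdiff j f) x"
    using smooth0_continuous[OF smooth0_pdiff[OF f j]] x
    by (simp add: continuous_on_eq_continuous_at open_Compl)
  then obtain d2 where d2: "d2 > 0" "\<And>y. dist y x < d2 \<Longrightarrow> \<bar>pdiff j f y - pdiff j f x\<bar> < e/2"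
    using insert.prems(2) unfolding continuous_at_eps_delta dist_real_def
    by (metis half_gt_zero)
  define d3 where "d3 = min d2 (norm x)"
  have d3: "d3 > 0" using d2 x by (simp add: d3_def)
  \<comment> \<open>The displacement from \<open>x\<close> is at most \<open>d\<close> for
    \<open>y\<close>, \<open>DIM * d\<close> for the earlier coordinates and \<open>d\<close> for
    the new one; together this must stay below \<open>d3\<close>, which also keeps the segment off
    the origin.\<close>
  define d where "d = min d1 (d3 / (2 + real DIM('a)))"
  have d: "d > 0" using d1 d3 by (simp add: d_def)
  show ?case
  proof (intro exI[of _ d] conjI allI impI d)
    fix y h :: 'a assume y: "dist y x < d" and h: "norm h < d"
    let ?y = "y + (\<Sum>i\<in>S. (h \<bullet> i) *\<^sub>R i)"
    have near: "dist (?y + s *\<^sub>R j) x < d3" if s: "\<bar>s\<bar> \<le> \<bar>h \<bullet> j\<bar>" for s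
    proof -
      have "norm (\<Sum>i\<in>S. (h \<bullet> i) *\<^sub>R i) \<le> (\<Sum>i\<in>S. norm h)"
      proof (rule sum_norm_le)
        fix i assume "i \<in> S"
        then have "i \<in> Basis" using insert.prems by auto
        then show "norm ((h \<bullet> i) *\<^sub>R i) \<le> norm h" using Basis_le_norm by auto
      qed
      also have "\<dots> \<le> real DIM('a) * norm h"
        using insert.prems by (auto intro!: mult_right_mono card_mono)
      finally have *: "norm (\<Sum>i\<in>S. (h \<bullet> i) *\<^sub>R i) \<le> real DIM('a) * norm h" .
      have **: "norm (s *\<^sub>R j) \<le> norm h" using s j Basis_le_norm[OF j, of h] by simp
      have "dist (?y + s *\<^sub>R j) x \<le> dist y x + norm (\<Sum>i\<in>S. (h \<bullet> i) *\<^sub>R i) + norm (s *\<^sub>R j)"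
        using norm_triangle_ineq[of "y - x + (\<Sum>i\<in>S. (h \<bullet> i) *\<^sub>R i)" "s *\<^sub>R j"]
          norm_triangle_ineq[of "y - x" "\<Sum>i\<in>S. (h \<bullet> i) *\<^sub>R i"]
        by (simp add: dist_norm algebra_simps)
      also have "\<dots> < d + real DIM('a) * d + d"
        using * ** y h mult_left_mono[of "norm h" d "real DIM('a)"] by linarith
      also have "\<dots> = d * (2 + real DIM('a))" by (simp add: algebra_simps)
      also have "\<dots> \<le> d3"
      proof -
        have "d \<le> d3 / (2 + real DIM('a))" by (simp add: d_def)
        then show ?thesis by (simp add: pos_le_divide_eq)
      qed
      finally show ?thesis .
    qed
    have step: "\<bar>f (?y + (h \<bullet> j) *\<^sub>R j) - f ?y - (h \<bullet> j) * pdiff j f x\<bar> \<le> e/2 * norm h"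
    proof -
      define g where "g t = f (?y + t *\<^sub>R j) - t * pdiff j f x" for t
      have nz: "?y + s *\<^sub>R j \<noteq> 0" if "\<bar>s\<bar> \<le> \<bar>h \<bullet> j\<bar>" for s
        using near[OF that] by (auto simp: d3_def)
      have "norm (g (h \<bullet> j) - g 0) \<le> e/2 * norm (h \<bullet> j - 0)"
      proof (rule field_differentiable_bound[where S = "cball 0 \<bar>h \<bullet> j\<bar>"])
        fix s :: real assume s: "s \<in> cball 0 \<bar>h \<bullet> j\<bar>"
        then have s': "\<bar>s\<bar> \<le> \<bar>h \<bullet> j\<bar>" by (simp add: dist_norm)
        show "(g has_field_derivative (pdiff j f (?y + s *\<^sub>R j) - pdiff j f x)) (at s within cball 0 \<bar>h \<bullet> j\<bar>)"
          unfolding g_def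
          by (rule has_field_derivative_at_within)
            (auto intro!: derivative_eq_intros smooth0_DERIV_at f j nz s')
        show "norm (pdiff j f (?y + s *\<^sub>R j) - pdiff j f x) \<le> e/2"
          using d2(2)[of "?y + s *\<^sub>R j"] near[OF s'] by (simp add: d3_def)
      qed auto
      also have "\<dots> \<le> e/2 * norm h"
        using Basis_le_norm[OF j, of h] insert.prems by (intro mult_left_mono) auto
      finally show ?thesis by (simp add: g_def algebra_simps)
    qed
    have "\<bar>f ?y - f y - (\<Sum>i\<in>S. (h \<bullet> i) * pdiff i f x)\<bar> \<le> e/2 * norm h"
      using d1(2) y h by (simp add: d_def)
    note 1 = this
    have 2: "y + (\<Sum>i\<in>insert j S. (h \<bullet> i) *\<^sub>R i) = ?y + (h \<bullet> j) *\<^sub>R j"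
      using insert by (simp add: algebra_simps)
    have 3: "(\<Sum>i\<in>insert j S. (h \<bullet> i) * pdiff i f x) = (\<Sum>i\<in>S. (h \<bullet> i) * pdiff i f x) + (h \<bullet> j) * pdiff j f x"
      using insert by simp
    have 4: "e/2 * norm h + e/2 * norm h = e * norm h" by simp
    show "\<bar>f (y + (\<Sum>i\<in>insert j S. (h \<bullet> i) *\<^sub>R i)) - f y - (\<Sum>i\<in>insert j S. (h \<bullet> i) * pdiff i f x)\<bar> \<le> e * norm h"
      using step 1 4 unfolding 2 3 by linarith
  qed
qed

lemma smooth0_has_derivative:
  fixes f :: "'a::euclidean_space \<Rightarrow> real"
  assumes f: "smooth0 f" and x: "x \<noteq> 0"
  shows "(f has_derivative (\<lambda>h. \<Sum>i\<in>Basis. (h \<bullet> i) * pdiff i f x)) (at x)"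
  unfolding has_derivative_at_alt
proof (intro conjI allI impI)
  show "bounded_linear (\<lambda>h. \<Sum>i\<in>Basis. (h \<bullet> i) * pdiff i f x)"
    by (intro bounded_linear_sum bounded_linear_mult_const bounded_linear_inner_left)
  fix e :: real assume "e > 0"
  from partial_sum_approx[OF f x order_refl this] obtain d where d: "d > 0"
    "\<And>y h. dist y x < d \<Longrightarrow> norm h < d \<Longrightarrow>
     \<bar>f (y + (\<Sum>i\<in>Basis. (h \<bullet> i) *\<^sub>R i)) - f y - (\<Sum>i\<in>Basis. (h \<bullet> i) * pdiff i f x)\<bar> \<le> e * norm h"
    by auto
  show "\<exists>d>0. \<forall>y. norm (y - x) < d \<longrightarrow> norm (f y - f x - (\<Sum>i\<in>Basis. ((y - x) \<bullet> i) * pdiff i f x)) \<le> e * norm (y - x)"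
    using d(2)[of x "_ - x"] d(1) by (intro exI[of _ d]) (auto simp: euclidean_representation)
qed

text \<open>The mean value theorem is used twice: in direction \<open>i\<close> for the increment of
  \<open>f\<close> along \<open>j\<close>, then in direction \<open>j\<close> for
  \<open>pdiff i f\<close>.\<close>

lemma second_difference:
  fixes f :: "'a::euclidean_space \<Rightarrow> real"
  assumes f: "smooth0 f" and i: "i \<in> Basis" and j: "j \<in> Basis" and h: "h > 0"
    and nz: "\<And>s t. \<bar>s\<bar> \<le> h \<Longrightarrow> \<bar>t\<bar> \<le> h \<Longrightarrow> x + s *\<^sub>R i + t *\<^sub>R j \<noteq> 0"
  shows "\<exists>s t. \<bar>s\<bar> \<le> h \<and> \<bar>t\<bar> \<le> h \<and>
    f (x + h *\<^sub>R i + h *\<^sub>R j) - f (x + h *\<^sub>R i) - f (x + h *\<^sub>R j) + f x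
    = h * h * pdiff j (pdiff i f) (x + s *\<^sub>R i + t *\<^sub>R j)"
proof -
  define \<phi> where "\<phi> s = f ((x + h *\<^sub>R j) + s *\<^sub>R i) - f (x + s *\<^sub>R i)" for s
  have "\<exists>s>0. s < h \<and> \<phi> h - \<phi> 0 = (h - 0) * (pdiff i f ((x + h *\<^sub>R j) + s *\<^sub>R i) - pdiff i f (x + s *\<^sub>R i))"
  proof (rule MVT2[OF h])
    fix s assume s: "0 \<le> s" "s \<le> h"
    then show "(\<phi> has_real_derivative (pdiff i f ((x + h *\<^sub>R j) + s *\<^sub>R i) - pdiff i f (x + s *\<^sub>R i))) (at s)"
      unfolding \<phi>_def using nz[of s h] nz[of s 0] h
      by (intro derivative_intros smooth0_DERIV_at f i) (auto simp: algebra_simps)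
  qed
  then obtain s where s: "0 < s" "s < h"
    "\<phi> h - \<phi> 0 = h * (pdiff i f ((x + h *\<^sub>R j) + s *\<^sub>R i) - pdiff i f (x + s *\<^sub>R i))" by auto
  have "\<exists>t>0. t < h \<and> pdiff i f ((x + s *\<^sub>R i) + h *\<^sub>R j) - pdiff i f ((x + s *\<^sub>R i) + 0 *\<^sub>R j)
      = (h - 0) * pdiff j (pdiff i f) ((x + s *\<^sub>R i) + t *\<^sub>R j)"
  proof (rule MVT2[OF h, of "\<lambda>t. pdiff i f ((x + s *\<^sub>R i) + t *\<^sub>R j)"])
    fix t assume "0 \<le> t" "t \<le> h"
    then show "((\<lambda>t. pdiff i f ((x + s *\<^sub>R i) + t *\<^sub>R j)) has_real_derivative pdiff j (pdiff i f) ((x + s *\<^sub>R i) + t *\<^sub>R j)) (at t)"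
      using nz[of s t] s by (intro smooth0_DERIV_at smooth0_pdiff f i j) auto
  qed
  then obtain t where t: "0 < t" "t < h" "pdiff i f ((x + s *\<^sub>R i) + h *\<^sub>R j) - pdiff i f (x + s *\<^sub>R i)
      = h * pdiff j (pdiff i f) ((x + s *\<^sub>R i) + t *\<^sub>R j)" by auto
  have "(x + h *\<^sub>R j) + s *\<^sub>R i = (x + s *\<^sub>R i) + h *\<^sub>R j" by simp
  with s(3) t(3) have "\<phi> h - \<phi> 0 = h * h * pdiff j (pdiff i f) (x + s *\<^sub>R i + t *\<^sub>R j)" by simp
  moreover have "\<phi> h - \<phi> 0 = f (x + h *\<^sub>R i + h *\<^sub>R j) - f (x + h *\<^sub>R i) - f (x + h *\<^sub>R j) + f x"
    by (simp add: \<phi>_def algebra_simps)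
  ultimately show ?thesis using s t by (intro exI[of _ s] exI[of _ t]) auto
qed

text \<open>The second difference is symmetric in \<open>i\<close> and \<open>j\<close>, so both
  mixed derivatives share a value at points arbitrarily close to \<open>x\<close>; continuity of
  both excludes a gap between them.\<close>

lemma pdiff_commute:
  fixes f :: "'a::euclidean_space \<Rightarrow> real"
  assumes f: "smooth0 f" and i: "i \<in> Basis" and j: "j \<in> Basis" and x: "x \<noteq> 0"
  shows "pdiff i (pdiff j f) x = pdiff j (pdiff i f) x"
proof (rule ccontr)
  let ?a = "pdiff i (pdiff j f)" and ?b = "pdiff j (pdiff i f)"
  assume ne: "?a x \<noteq> ?b x"
  define e where "e = \<bar>?a x - ?b x\<bar> / 2"
  have e: "e > 0" using ne by (simp add: e_def)
  have c: "isCont ?a x" "isCont ?b x"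
    using smooth0_continuous[OF smooth0_pdiff[OF smooth0_pdiff[OF f j] i]]
      smooth0_continuous[OF smooth0_pdiff[OF smooth0_pdiff[OF f i] j]] x
    by (simp_all add: continuous_on_eq_continuous_at open_Compl)
  obtain d1 where d1: "d1 > 0" "\<And>y. dist y x < d1 \<Longrightarrow> \<bar>?a y - ?a x\<bar> < e"
    using c(1) e unfolding continuous_at_eps_delta dist_real_def by metis
  obtain d2 where d2: "d2 > 0" "\<And>y. dist y x < d2 \<Longrightarrow> \<bar>?b y - ?b x\<bar> < e"
    using c(2) e unfolding continuous_at_eps_delta dist_real_def by metis
  define h where "h = min (min d1 d2) (norm x) / 3"
  have h: "h > 0" using d1 d2 x by (simp add: h_def)
  have near: "dist (x + s *\<^sub>R k + t *\<^sub>R l) x < min (min d1 d2) (norm x)"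
    if "\<bar>s\<bar> \<le> h" "\<bar>t\<bar> \<le> h" "k \<in> Basis" "l \<in> Basis" for s t k l
  proof -
    have "dist (x + s *\<^sub>R k + t *\<^sub>R l) x = norm (s *\<^sub>R k + t *\<^sub>R l)" by (simp add: dist_norm)
    also have "\<dots> \<le> \<bar>s\<bar> + \<bar>t\<bar>" using norm_triangle_ineq[of "s *\<^sub>R k" "t *\<^sub>R l"] that by simp
    also have "\<dots> < 3 * h" using that h by linarith
    finally show ?thesis by (simp add: h_def)
  qed
  have nz: "x + s *\<^sub>R k + t *\<^sub>R l \<noteq> 0"
    if "\<bar>s\<bar> \<le> h" "\<bar>t\<bar> \<le> h" "k \<in> Basis" "l \<in> Basis" for s t k l
    using near[OF that] by auto
  obtain s t where st: "\<bar>s\<bar> \<le> h" "\<bar>t\<bar> \<le> h"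
    "f (x + h *\<^sub>R i + h *\<^sub>R j) - f (x + h *\<^sub>R i) - f (x + h *\<^sub>R j) + f x = h * h * ?b (x + s *\<^sub>R i + t *\<^sub>R j)"
    using second_difference[OF f i j h nz] i j by blast
  obtain s' t' where st': "\<bar>s'\<bar> \<le> h" "\<bar>t'\<bar> \<le> h"
    "f (x + h *\<^sub>R j + h *\<^sub>R i) - f (x + h *\<^sub>R j) - f (x + h *\<^sub>R i) + f x = h * h * ?a (x + s' *\<^sub>R j + t' *\<^sub>R i)"
    using second_difference[OF f j i h nz] i j by blast
  have "x + h *\<^sub>R j + h *\<^sub>R i = x + h *\<^sub>R i + h *\<^sub>R j" by simp
  from st(3) st'(3)[unfolded this] have "h * h * ?b (x + s *\<^sub>R i + t *\<^sub>R j) = h * h * ?a (x + s' *\<^sub>R j + t' *\<^sub>R i)" by linarith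
  then have eq: "?b (x + s *\<^sub>R i + t *\<^sub>R j) = ?a (x + s' *\<^sub>R j + t' *\<^sub>R i)" using h by simp
  have "\<bar>?b (x + s *\<^sub>R i + t *\<^sub>R j) - ?b x\<bar> < e" using d2(2) near[OF st(1,2) i j] by simp
  moreover have "\<bar>?a (x + s' *\<^sub>R j + t' *\<^sub>R i) - ?a x\<bar> < e" using d1(2) near[OF st'(1,2) j i] by simp
  ultimately have "\<bar>?a x - ?b x\<bar> < 2 * e" using eq by linarith
  then show False by (simp add: e_def)
qed


section \<open>Homogeneous functions and the Euclidean Laplacian\<close>

definition hom :: "real \<Rightarrow> ('a::euclidean_space \<Rightarrow> real) \<Rightarrow> bool" where
  "hom d f \<longleftrightarrow> (\<forall>x c. x \<noteq> 0 \<longrightarrow> 0 < c \<longrightarrow> f (c *\<^sub>R x) = c powr d * f x)"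

lemma hom_mult: "hom d f \<Longrightarrow> hom e g \<Longrightarrow> hom (d + e) (\<lambda>x. f x * g x)"
  by (simp add: hom_def powr_add)

lemma hom_sum: "(\<And>i. i \<in> A \<Longrightarrow> hom d (f i)) \<Longrightarrow> hom d (\<lambda>x. \<Sum>i\<in>A. f i x)"
  by (simp add: hom_def sum_distrib_left)

lemma hom_norm_powr: "hom d (\<lambda>x. norm x powr d)"
  by (simp add: hom_def powr_mult)

lemma hom_inner: "hom 1 (\<lambda>x. x \<bullet> b)"
  by (simp add: hom_def)

text \<open>Moving from \<open>c *\<^sub>R x\<close> by \<open>t\<close> is \<open>c\<close> times
  moving from \<open>x\<close> by \<open>t / c\<close>; the inner derivative \<open>1 / c\<close>
  lowers the degree by one.\<close>

lemma hom_pdiff: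
  fixes f :: "'a::euclidean_space \<Rightarrow> real"
  assumes f: "smooth0 f" "hom d f" and i: "i \<in> Basis"
  shows "hom (d - 1) (pdiff i f)"
  unfolding hom_def
proof (intro allI impI)
  fix x :: 'a and c :: real assume x: "x \<noteq> 0" and c: "0 < c"
  have "((\<lambda>t. t / c) has_real_derivative 1 / c) (at 0)"
    using c by (auto intro!: derivative_eq_intros)
  from DERIV_chain2[OF _ this, of "\<lambda>s. f (x + s *\<^sub>R i)" "pdiff i f x"]
  have "((\<lambda>t. f (x + (t / c) *\<^sub>R i)) has_real_derivative pdiff i f x * (1 / c)) (at 0)"
    using smooth0_DERIV[OF f(1) i x] by simp
  from DERIV_cmult[OF this, of "c powr d"]
  have *: "((\<lambda>t. c powr d * f (x + (t / c) *\<^sub>R i)) has_real_derivative c powr (d - 1) * pdiff i f x) (at 0)"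
    using c by (simp add: powr_diff mult_ac)
  have "\<forall>\<^sub>F t in nhds (0::real). t / c \<in> {t. x + t *\<^sub>R i \<noteq> 0}"
  proof -
    have "((\<lambda>t. t / c) \<longlongrightarrow> 0 / c) (nhds 0)" by (intro tendsto_intros filterlim_ident) (use c in auto)
    then show ?thesis
      using eventually_line_nonzero[OF x, of i] by (auto simp: filterlim_iff)
  qed
  then have "\<forall>\<^sub>F t in nhds (0::real). c powr d * f (x + (t / c) *\<^sub>R i) = f (c *\<^sub>R x + t *\<^sub>R i)"
  proof eventually_elim
    case (elim t)
    then have "f (c *\<^sub>R (x + (t / c) *\<^sub>R i)) = c powr d * f (x + (t / c) *\<^sub>R i)"
      using f(2) c unfolding hom_def by blast
    then show ?case using c by (simp add: scaleR_add_right)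
  qed
  then show "pdiff i f (c *\<^sub>R x) = c powr (d - 1) * pdiff i f x"
    using * by (intro pdiff_eqI) (subst DERIV_cong_ev[symmetric], auto)
qed

text \<open>Both sides are the derivative of \<open>f (c *\<^sub>R x)\<close> at
  \<open>c = 1\<close>, by the chain rule and by homogeneity.\<close>

lemma euler_hom:
  fixes f :: "'a::euclidean_space \<Rightarrow> real"
  assumes f: "smooth0 f" "hom d f" and x: "x \<noteq> 0"
  shows "(\<Sum>i\<in>Basis. (x \<bullet> i) * pdiff i f x) = d * f x"
proof -
  have "((\<lambda>c. c *\<^sub>R x) has_derivative (\<lambda>c. c *\<^sub>R x)) (at (1::real))"
    by (auto intro!: derivative_eq_intros)
  from has_derivative_compose[OF this, unfolded scaleR_one, OF smooth0_has_derivative[OF f(1) x]]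
  have "((\<lambda>c. f (c *\<^sub>R x)) has_derivative (\<lambda>c. \<Sum>i\<in>Basis. ((c *\<^sub>R x) \<bullet> i) * pdiff i f x)) (at (1::real))" .
  moreover have "(\<lambda>c. \<Sum>i\<in>Basis. ((c *\<^sub>R x) \<bullet> i) * pdiff i f x) = (*) (\<Sum>i\<in>Basis. (x \<bullet> i) * pdiff i f x)"
    by (auto simp: sum_distrib_left sum_distrib_right mult_ac)
  ultimately have 1: "((\<lambda>c. f (c *\<^sub>R x)) has_real_derivative (\<Sum>i\<in>Basis. (x \<bullet> i) * pdiff i f x)) (at 1)"
    by (simp add: has_field_derivative_def)
  have "((\<lambda>c. c powr d * f x) has_real_derivative d * f x) (at 1)"
    by (auto intro!: derivative_eq_intros)
  moreover have "\<forall>\<^sub>F c in nhds 1. c powr d * f x = f (c *\<^sub>R x)"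
  proof -
    have "\<forall>\<^sub>F c in nhds (1::real). c \<in> {0<..}" by (rule eventually_nhds_in_open) auto
    then show ?thesis by eventually_elim (use f(2) x in \<open>auto simp: hom_def\<close>)
  qed
  ultimately have 2: "((\<lambda>c. f (c *\<^sub>R x)) has_real_derivative d * f x) (at 1)"
    by (subst DERIV_cong_ev[symmetric]) auto
  show ?thesis using DERIV_unique[OF 1 2] .
qed

definition lap :: "('a::euclidean_space \<Rightarrow> real) \<Rightarrow> 'a \<Rightarrow> real" where
  "lap f x = (\<Sum>i\<in>Basis. pdiff i (pdiff i f) x)"

lemma smooth0_lap: "smooth0 f \<Longrightarrow> smooth0 (lap f)"
  unfolding lap_def [abs_def] by (intro smooth0_sum smooth0_pdiff)

lemma hom_lap: "smooth0 f \<Longrightarrow> hom d f \<Longrightarrow> hom (d - 2) (lap f)"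
proof -
  assume f: "smooth0 f" "hom d f"
  have "hom (d - 1 - 1) (lap f)"
    unfolding lap_def [abs_def] by (intro hom_sum hom_pdiff smooth0_pdiff f)
  then show ?thesis by simp
qed

lemma lap_cong0: "(\<And>y. y \<noteq> 0 \<Longrightarrow> f y = g y) \<Longrightarrow> x \<noteq> 0 \<Longrightarrow> lap f x = lap g x"
  unfolding lap_def by (intro sum.cong refl pdiff_cong0)

lemma lap_add:
  assumes "smooth0 f" "smooth0 g" "x \<noteq> 0"
  shows "lap (\<lambda>x. f x + g x) x = lap f x + lap g x"
proof -
  have "pdiff i (pdiff i (\<lambda>x. f x + g x)) x = pdiff i (pdiff i f) x + pdiff i (pdiff i g) x"
    if i: "i \<in> Basis" for i
  proof -
    have "pdiff i (pdiff i (\<lambda>x. f x + g x)) x = pdiff i (\<lambda>x. pdiff i f x + pdiff i g x) x"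
      by (rule pdiff_cong0[OF pdiff_add]) (use assms i in auto)
    also have "\<dots> = pdiff i (pdiff i f) x + pdiff i (pdiff i g) x"
      by (intro pdiff_add smooth0_pdiff assms i)
    finally show ?thesis .
  qed
  then show ?thesis by (simp add: lap_def sum.distrib)
qed

lemma lap_mult:
  assumes "smooth0 f" "smooth0 g" "x \<noteq> 0"
  shows "lap (\<lambda>x. f x * g x) x = f x * lap g x + g x * lap f x + 2 * (\<Sum>i\<in>Basis. pdiff i f x * pdiff i g x)"
proof -
  have "pdiff i (pdiff i (\<lambda>x. f x * g x)) x = f x * pdiff i (pdiff i g) x + g x * pdiff i (pdiff i f) x
      + 2 * (pdiff i f x * pdiff i g x)"
    if i: "i \<in> Basis" for i
  proof -
    have "pdiff i (pdiff i (\<lambda>x. f x * g x)) x = pdiff i (\<lambda>x. f x * pdiff i g x + g x * pdiff i f x) x"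
      by (rule pdiff_cong0[OF pdiff_mult]) (use assms i in auto)
    also have "\<dots> = pdiff i (\<lambda>x. f x * pdiff i g x) x + pdiff i (\<lambda>x. g x * pdiff i f x) x"
      by (intro pdiff_add smooth0_mult smooth0_pdiff assms i)
    also have "\<dots> = f x * pdiff i (pdiff i g) x + g x * pdiff i (pdiff i f) x
      + 2 * (pdiff i f x * pdiff i g x)"
      using assms i by (simp add: pdiff_mult smooth0_pdiff)
    finally show ?thesis .
  qed
  then show ?thesis by (simp add: lap_def sum.distrib sum_distrib_left)
qed

lemma pdiff_norm_powr:
  assumes "x \<noteq> 0" "i \<in> Basis"
  shows "pdiff i (\<lambda>x. norm x powr a) x = a * norm x powr (a - 2) * (x \<bullet> i)"
  using assms by (subst pdiff_powr) (auto simp: pdiff_norm powr_diff power2_eq_square)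

lemma sum_Basis_sq: "(\<Sum>i\<in>Basis. (x \<bullet> i) * (x \<bullet> i)) = norm x ^ 2"
  by (simp add: euclidean_inner[symmetric] power2_norm_eq_inner)

lemma lap_norm_powr:
  fixes x :: "'a::euclidean_space"
  assumes "x \<noteq> 0"
  shows "lap (\<lambda>x. norm x powr a) x = a * (a + real DIM('a) - 2) * norm x powr (a - 2)"
proof -
  have "pdiff i (pdiff i (\<lambda>x. norm x powr a)) x =
      a * norm x powr (a - 2) + a * (a - 2) * norm x powr (a - 4) * ((x \<bullet> i) * (x \<bullet> i))"
    if i: "i \<in> Basis" for i
  proof -
    have "pdiff i (pdiff i (\<lambda>x. norm x powr a)) x = pdiff i (\<lambda>x. a * (norm x powr (a - 2) * (x \<bullet> i))) x"
      by (rule pdiff_cong0) (use assms i in \<open>auto simp: pdiff_norm_powr\<close>)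
    also have "\<dots> = a * (norm x powr (a - 2) * 1 + (x \<bullet> i) * ((a - 2) * norm x powr (a - 4) * (x \<bullet> i)))"
      using assms i by (simp add: pdiff_cmult pdiff_mult smooth0_mult pdiff_inner pdiff_norm_powr inner_Basis)
    finally show ?thesis by (simp add: algebra_simps)
  qed
  then have "lap (\<lambda>x. norm x powr a) x = (\<Sum>i\<in>(Basis::'a set). a * norm x powr (a - 2) + a * (a - 2) * norm x powr (a - 4) * ((x \<bullet> i) * (x \<bullet> i)))"
    by (simp add: lap_def)
  also have "\<dots> = real DIM('a) * a * norm x powr (a - 2) + a * (a - 2) * norm x powr (a - 4) * norm x ^ 2"
    by (simp add: sum.distrib sum_distrib_left[symmetric] sum_Basis_sq)
  also have "norm x powr (a - 4) * norm x ^ 2 = norm x powr (a - 2)"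
    using assms powr_add[of "norm x" "a - 4" 2] by simp
  then have "a * (a - 2) * norm x powr (a - 4) * norm x ^ 2 = a * (a - 2) * norm x powr (a - 2)"
    by (simp add: mult.assoc)
  finally show ?thesis by (simp add: algebra_simps)
qed

text \<open>The gradient of a power of the norm is radial, so the cross term of the product rule is
  an Euler sum and becomes a multiple of \<open>h\<close> itself.\<close>

lemma lap_norm_powr_mult:
  fixes x :: "'a::euclidean_space"
  assumes h: "smooth0 h" "hom d h" and x: "x \<noteq> 0"
  shows "lap (\<lambda>x. norm x powr a * h x) x =
    norm x powr a * lap h x + (2 * a * d + a * (a + real DIM('a) - 2)) * norm x powr (a - 2) * h x"
proof -
  have "(\<Sum>i\<in>Basis. pdiff i (\<lambda>x. norm x powr a) x * pdiff i h x)
      = a * norm x powr (a - 2) * (\<Sum>i\<in>Basis. (x \<bullet> i) * pdiff i h x)"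
    using x by (simp add: pdiff_norm_powr sum_distrib_left mult.assoc)
  then show ?thesis
    using x by (simp add: lap_mult h lap_norm_powr euler_hom[OF h x] algebra_simps)
qed

section \<open>The ring of smooth functions on the sphere\<close>

text \<open>Smooth functions on the sphere are represented by their extensions that are constant
on rays; the value 0 at the origin makes the representation unique.\<close>

typedef (overloaded) 'a sphfun = "{f :: 'a::euclidean_space \<Rightarrow> real. smooth0 f \<and> hom 0 f \<and> f 0 = 0}"
  morphisms val Abs_sphfun
  by (rule exI[of _ "\<lambda>x. 0"]) (simp add: hom_def)

setup_lifting type_definition_sphfun

lemma smooth0_val [simp]: "smooth0 (val f)"
  and hom_val: "hom 0 (val f)"
  and val_0 [simp]: "val f 0 = 0"
  using val[of f] by auto

lemma val_scaleR: "c > 0 \<Longrightarrow> val f (c *\<^sub>R x) = val f x"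
  using hom_val[of f] by (cases "x = 0") (auto simp: hom_def)

lemma sphfun_eqI: "(\<And>x. x \<noteq> 0 \<Longrightarrow> val f x = val g x) \<Longrightarrow> f = g"
  by (metis val_inject ext val_0)

instantiation sphfun :: (euclidean_space) comm_ring_1
begin

lift_definition zero_sphfun :: "'a sphfun" is "\<lambda>x. 0"
  by (simp add: hom_def)

text \<open>The value at the origin is forced to be 0 by the normalisation of the type, so the unit
  is not the constant function 1.\<close>

lift_definition one_sphfun :: "'a sphfun" is "\<lambda>x. if x = 0 then 0 else 1"
  by (auto simp: hom_def intro: smooth0_cong[OF smooth0_const[of 1]])

lift_definition plus_sphfun :: "'a sphfun \<Rightarrow> 'a sphfun \<Rightarrow> 'a sphfun" is "\<lambda>f g x. f x + g x"
  by (simp add: hom_def smooth0_add)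

lift_definition times_sphfun :: "'a sphfun \<Rightarrow> 'a sphfun \<Rightarrow> 'a sphfun" is "\<lambda>f g x. f x * g x"
  by (simp add: hom_def smooth0_mult)

lift_definition uminus_sphfun :: "'a sphfun \<Rightarrow> 'a sphfun" is "\<lambda>f x. - f x"
  by (simp add: hom_def smooth0_uminus)

definition minus_sphfun :: "'a sphfun \<Rightarrow> 'a sphfun \<Rightarrow> 'a sphfun" where
  "minus_sphfun f g = f + - g"

instance
proof
  show "(0::'a sphfun) \<noteq> 1"
    by transfer (metis (full_types) nonzero_Basis SOME_Basis zero_neq_one)
  fix a b c :: "'a sphfun"
  show "1 * a = a" by transfer auto
  show "a - b = a + - b" by (simp add: minus_sphfun_def)
qed (transfer; simp add: algebra_simps)+

end

instantiation sphfun :: (euclidean_space) real_algebra_1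
begin

lift_definition scaleR_sphfun :: "real \<Rightarrow> 'a sphfun \<Rightarrow> 'a sphfun" is "\<lambda>c f x. c * f x"
  by (simp add: hom_def smooth0_mult)

instance
  by standard (transfer; simp add: algebra_simps)+

end

lemma val_simps [simp]:
  "val (f + g) x = val f x + val g x"
  "val (f - g) x = val f x - val g x"
  "val (- f) x = - val f x"
  "val (f * g) x = val f x * val g x"
  "val (c *\<^sub>R f) x = c * val f x"
  "val 0 x = 0"
  by (simp_all only: zero_sphfun.rep_eq plus_sphfun.rep_eq times_sphfun.rep_eq uminus_sphfun.rep_eq
      minus_sphfun_def scaleR_sphfun.rep_eq)

lemma val_1: "val 1 x = (if x = 0 then 0 else 1)"
  by (simp add: one_sphfun.rep_eq)

lemma val_sum [simp]: "val (\<Sum>i\<in>A. f i) x = (\<Sum>i\<in>A. val (f i) x)"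
  by (induction A rule: infinite_finite_induct) auto

text \<open>The sign makes this the nonnegative Laplacian. The flat Laplacian lowers the degree by
  two and the factor \<open>norm x * norm x\<close> restores degree 0 without changing values on the
  unit sphere.\<close>

lift_definition lapl :: "'a::euclidean_space sphfun \<Rightarrow> 'a sphfun" is "\<lambda>f x. - (norm x * norm x * lap f x)"
proof -
  fix f :: "'a \<Rightarrow> real" assume f: "smooth0 f \<and> hom 0 f \<and> f 0 = 0"
  have "hom (- 2) (lap f)" using hom_lap[of f 0] f by simp
  then show "smooth0 (\<lambda>x. - (norm x * norm x * lap f x)) \<and> hom 0 (\<lambda>x. - (norm x * norm x * lap f x)) \<and>
      - (norm (0::'a) * norm (0::'a) * lap f 0) = 0"
    using f by (auto intro!: smooth0_uminus smooth0_mult smooth0_lap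
        simp: hom_def powr_minus field_simps power2_eq_square)
qed

text \<open>The pointwise inner product of the spherical gradients: functions constant on rays have
  tangential gradients, so the flat gradients already are the spherical ones on the unit
  sphere.\<close>

lift_definition grad2 :: "'a::euclidean_space sphfun \<Rightarrow> 'a sphfun \<Rightarrow> 'a sphfun"
  is "\<lambda>f g x. norm x * norm x * (\<Sum>i\<in>Basis. pdiff i f x * pdiff i g x)"
proof -
  fix f g :: "'a \<Rightarrow> real"
  assume f: "smooth0 f \<and> hom 0 f \<and> f 0 = 0" and g: "smooth0 g \<and> hom 0 g \<and> g 0 = 0"
  have "hom (- 2) (\<lambda>x. \<Sum>i\<in>Basis. pdiff i f x * pdiff i g x)"
  proof (rule hom_sum)
    fix i :: 'a assume "i \<in> Basis"
    then show "hom (- 2) (\<lambda>x. pdiff i f x * pdiff i g x)"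
      using hom_mult[OF hom_pdiff[of f 0 i] hom_pdiff[of g 0 i]] f g by simp
  qed
  then show "smooth0 (\<lambda>x. norm x * norm x * (\<Sum>i\<in>Basis. pdiff i f x * pdiff i g x)) \<and>
      hom 0 (\<lambda>x. norm x * norm x * (\<Sum>i\<in>Basis. pdiff i f x * pdiff i g x)) \<and>
      norm (0::'a) * norm (0::'a) * (\<Sum>i\<in>Basis. pdiff i f 0 * pdiff i g 0) = 0"
    using f g by (auto intro!: smooth0_mult smooth0_sum smooth0_pdiff
        simp: hom_def powr_minus field_simps power2_eq_square)
qed

text \<open>The linear function \<open>x \<bullet> b\<close> restricted to the sphere and extended
  along rays.\<close>

lift_definition coord :: "'a::euclidean_space \<Rightarrow> 'a sphfun" is "\<lambda>b x. norm x powr (- 1) * (x \<bullet> b)"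
proof -
  fix b :: 'a
  have "smooth0 (\<lambda>x. norm x powr (- 1) * (x \<bullet> b))"
    by (intro smooth0_mult smooth0_norm_powr smooth0_inner)
  moreover have "hom (- 1 + 1) (\<lambda>x. norm x powr (- 1) * (x \<bullet> b))"
    by (intro hom_mult hom_norm_powr hom_inner)
  ultimately show "smooth0 (\<lambda>x. norm x powr (- 1) * (x \<bullet> b)) \<and> hom 0 (\<lambda>x. norm x powr (- 1) * (x \<bullet> b)) \<and>
      norm (0::'a) powr (- 1) * (0 \<bullet> b) = 0"
    by simp
qed

text \<open>Real powers are smooth only for a positive base; the default 0 otherwise keeps the
  operation inside the type. Every law for \<open>spow\<close> therefore assumes
  \<open>sphpos\<close>.\<close>

lift_definition spow :: "'a::euclidean_space sphfun \<Rightarrow> real \<Rightarrow> 'a sphfun" is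
  "\<lambda>f s. if \<forall>x. x \<noteq> 0 \<longrightarrow> f x > 0 then (\<lambda>x. f x powr s) else (\<lambda>x. 0)"
  by (auto simp: hom_def intro!: smooth0_powr)

definition sphpos :: "'a::euclidean_space sphfun \<Rightarrow> bool" where
  "sphpos f \<longleftrightarrow> (\<forall>x. x \<noteq> 0 \<longrightarrow> val f x > 0)"

lemma val_spow: "sphpos f \<Longrightarrow> val (spow f s) x = val f x powr s"
  by (simp add: sphpos_def spow.rep_eq)

lemma val_lapl: "val (lapl f) x = - (norm x * norm x * lap (val f) x)"
  by (simp add: lapl.rep_eq)

lemma val_grad2: "val (grad2 f g) x = norm x * norm x * (\<Sum>i\<in>Basis. pdiff i (val f) x * pdiff i (val g) x)"
  by (simp add: grad2.rep_eq)

lemma val_coord: "val (coord b) x = (x \<bullet> b) / norm x"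
  by (simp add: coord.rep_eq powr_minus divide_inverse mult.commute)

lemma val_fun_simps:
  "val (f + g) = (\<lambda>x. val f x + val g x)" "val (f * g) = (\<lambda>x. val f x * val g x)"
  "val (c *\<^sub>R f) = (\<lambda>x. c * val f x)"
  by (auto simp: fun_eq_iff)

section \<open>Leibniz rules for the Laplacian and the gradient on the sphere\<close>

lemma lapl_mult: "lapl (f * g) = f * lapl g + g * lapl f - 2 *\<^sub>R grad2 f g"
  by (rule sphfun_eqI)
    (simp add: val_lapl val_grad2 val_fun_simps lap_mult algebra_simps)

lemma lapl_add: "lapl (f + g) = lapl f + lapl g"
  by (rule sphfun_eqI) (simp add: val_lapl val_fun_simps lap_add algebra_simps)

lemma lapl_scaleR: "lapl (c *\<^sub>R f) = c *\<^sub>R lapl f"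
proof (rule sphfun_eqI)
  fix x :: 'a assume x: "x \<noteq> 0"
  have "lap (\<lambda>x. c * val f x) x = c * lap (val f) x"
    using x by (simp add: lap_mult) (simp add: lap_def)
  then show "val (lapl (c *\<^sub>R f)) x = val (c *\<^sub>R lapl f) x"
    by (simp add: val_lapl val_fun_simps)
qed

lemma grad2_commute: "grad2 f g = grad2 g f"
  by (rule sphfun_eqI) (simp add: val_grad2 mult.commute)

lemma grad2_mult: "grad2 f (g * h) = g * grad2 f h + h * grad2 f g"
  by (rule sphfun_eqI) (simp add: val_grad2 val_fun_simps pdiff_mult sum.distrib sum_distrib_left algebra_simps)

lemma grad2_add: "grad2 f (g + h) = grad2 f g + grad2 f h"
  by (rule sphfun_eqI) (simp add: val_grad2 val_fun_simps pdiff_add sum.distrib algebra_simps)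

lemma grad2_scaleR: "grad2 f (c *\<^sub>R g) = c *\<^sub>R grad2 f g"
  by (rule sphfun_eqI) (simp add: val_grad2 val_fun_simps pdiff_cmult sum_distrib_left algebra_simps)

lemma grad2_one: "grad2 f 1 = 0"
proof -
  have "grad2 f (1 * 1) = grad2 f 1 + grad2 f 1" by (subst grad2_mult) simp
  then show ?thesis by simp
qed

lemma lapl_one: "lapl 1 = 0"
proof -
  have "lapl (1 * 1) = lapl 1 + lapl 1" by (subst lapl_mult) (simp add: grad2_one)
  then show ?thesis by simp
qed

lemma grad2_spow:
  assumes "sphpos g"
  shows "grad2 f (spow g s) = s *\<^sub>R (spow g (s - 1) * grad2 f g)"
proof (rule sphfun_eqI)
  fix x :: 'a assume x: "x \<noteq> 0"
  have "val (spow g s) = (\<lambda>x. val g x powr s)" using assms by (auto simp: val_spow)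
  then show "val (grad2 f (spow g s)) x = val (s *\<^sub>R (spow g (s - 1) * grad2 f g)) x"
    using x assms by (simp add: val_grad2 pdiff_powr val_spow sphpos_def sum_distrib_left mult_ac)
qed

lemma spow_mult: "sphpos g \<Longrightarrow> spow g s * spow g t = spow g (s + t)"
  by (rule sphfun_eqI) (simp add: val_spow powr_add)

lemma spow_0: "sphpos g \<Longrightarrow> spow g 0 = 1"
  by (rule sphfun_eqI) (simp add: val_spow val_1 sphpos_def less_imp_neq[THEN not_sym])

lemma spow_1: "sphpos g \<Longrightarrow> spow g 1 = g"
  by (rule sphfun_eqI) (simp add: val_spow sphpos_def less_imp_le)

lemma lapl_spow:
  assumes g: "sphpos g"
  shows "lapl (spow g s) = s *\<^sub>R (spow g (s - 1) * lapl g) - (s * (s - 1)) *\<^sub>R (spow g (s - 2) * grad2 g g)"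
proof (rule sphfun_eqI)
  fix x :: 'a assume x: "x \<noteq> 0"
  have pos: "\<And>x. x \<noteq> 0 \<Longrightarrow> val g x > 0" using g by (simp add: sphpos_def)
  have eq: "val (spow g s) = (\<lambda>x. val g x powr s)" using g by (auto simp: val_spow)
  have "pdiff i (pdiff i (\<lambda>x. val g x powr s)) x = s * (val g x powr (s - 1) * pdiff i (pdiff i (val g)) x
     + (s - 1) * val g x powr (s - 2) * (pdiff i (val g) x * pdiff i (val g) x))" if i: "i \<in> Basis" for i
  proof -
    have "pdiff i (pdiff i (\<lambda>x. val g x powr s)) x = pdiff i (\<lambda>x. s * (val g x powr (s - 1) * pdiff i (val g) x)) x"
      by (rule pdiff_cong0) (use x i pos in \<open>auto simp: pdiff_powr\<close>)
    also have "\<dots> = s * (val g x powr (s - 1) * pdiff i (pdiff i (val g)) x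
     + pdiff i (val g) x * ((s - 1) * val g x powr (s - 1 - 1) * pdiff i (val g) x))"
      using x i pos by (simp add: pdiff_cmult smooth0_mult smooth0_powr smooth0_pdiff pdiff_mult pdiff_powr)
    finally show ?thesis by (simp add: algebra_simps)
  qed
  then have L: "lap (\<lambda>x. val g x powr s) x = s * val g x powr (s - 1) * lap (val g) x
     + s * (s - 1) * val g x powr (s - 2) * (\<Sum>i\<in>Basis. pdiff i (val g) x * pdiff i (val g) x)"
    by (simp add: lap_def sum.distrib sum_distrib_left mult.assoc distrib_left)
  show "val (lapl (spow g s)) x = val (s *\<^sub>R (spow g (s - 1) * lapl g) - (s * (s - 1)) *\<^sub>R (spow g (s - 2) * grad2 g g)) x"
    using g unfolding val_lapl eq L by (simp add: val_lapl val_grad2 val_spow algebra_simps)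
qed

section \<open>Coordinate functions and their commutation with the Laplacian\<close>

text \<open>The dimension n of the sphere, one less than that of the ambient space.\<close>

definition sdim :: "'a::euclidean_space itself \<Rightarrow> real" where
  "sdim _ = real DIM('a) - 1"

text \<open>Coordinates are spherical harmonics of degree one, with eigenvalue n. The linear
  function is harmonic in the ambient space, so only the factor \<open>1 / norm x\<close>
  contributes.\<close>

lemma lapl_coord:
  fixes b :: "'a::euclidean_space"
  shows "lapl (coord b) = sdim TYPE('a) *\<^sub>R coord b"
proof (rule sphfun_eqI)
  fix x :: 'a assume x: "x \<noteq> 0"
  have [simp]: "pdiff i (\<lambda>x. x \<bullet> b) = (\<lambda>x. i \<bullet> b)" for i :: 'a
    by (auto simp: pdiff_inner)
  have "lap (\<lambda>x. x \<bullet> b) x = 0" by (simp add: lap_def)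
  moreover have "val (coord b) = (\<lambda>x. norm x powr (- 1) * (x \<bullet> b))"
    by (simp add: coord.rep_eq)
  ultimately have L: "lap (val (coord b)) x = (- 2 - (real DIM('a) - 3)) * norm x powr (- 3) * (x \<bullet> b)"
    using x lap_norm_powr_mult[OF smooth0_inner hom_inner x, of "- 1" b] by (simp add: algebra_simps)
  have N: "norm x powr (- 1) = norm x powr (- 3) * (norm x * norm x)"
    using x powr_add[of "norm x" "- 3" 2] by (simp add: power2_eq_square)
  show "val (lapl (coord b)) x = val (sdim TYPE('a) *\<^sub>R coord b) x"
    unfolding val_lapl L unfolding val_simps coord.rep_eq N by (simp add: sdim_def algebra_simps)
qed

lemma pdiff_coord:
  assumes x: "x \<noteq> 0" and i: "i \<in> Basis"
  shows "pdiff i (val (coord b)) x = (i \<bullet> b) / norm x - (x \<bullet> b) * norm x powr (- 3) * (x \<bullet> i)"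
proof -
  have "pdiff i (\<lambda>x. norm x powr (- 1) * (x \<bullet> b)) x
      = norm x powr (- 1) * (i \<bullet> b) + (x \<bullet> b) * (- 1 * norm x powr (- 1 - 2) * (x \<bullet> i))"
    by (simp only: pdiff_mult[OF smooth0_norm_powr smooth0_inner i x] pdiff_norm_powr[OF x i] pdiff_inner)
  then show ?thesis by (simp add: coord.rep_eq powr_minus divide_inverse)
qed

text \<open>The gradient of \<open>coord b\<close> is the tangential part of \<open>b\<close>, and
  the radial part of \<open>b\<close> pairs to zero with \<open>f\<close> by Euler's identity in
  degree 0.\<close>

lemma val_grad2_coord:
  fixes b :: "'a::euclidean_space"
  assumes x: "x \<noteq> 0"
  shows "val (grad2 (coord b) f) x = norm x * (\<Sum>i\<in>Basis. (i \<bullet> b) * pdiff i (val f) x)"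
proof -
  have "(\<Sum>i\<in>Basis. pdiff i (val (coord b)) x * pdiff i (val f) x)
     = (\<Sum>i\<in>Basis. (1 / norm x) * ((i \<bullet> b) * pdiff i (val f) x) - ((x \<bullet> b) * norm x powr (- 3)) * ((x \<bullet> i) * pdiff i (val f) x))"
    by (intro sum.cong refl) (simp add: pdiff_coord[OF x] algebra_simps)
  also have "\<dots> = (1 / norm x) * (\<Sum>i\<in>Basis. (i \<bullet> b) * pdiff i (val f) x)"
    using euler_hom[OF smooth0_val hom_val x, of f] by (simp only: sum_subtractf sum_distrib_left[symmetric])
  finally show ?thesis using x by (simp add: val_grad2)
qed

text \<open>This is the inner product of the tangential parts of \<open>a\<close> and
  \<open>b\<close>.\<close>

lemma grad2_coord_coord: "grad2 (coord a) (coord b) = (a \<bullet> b) *\<^sub>R 1 - coord a * coord b"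
proof (rule sphfun_eqI)
  fix x :: 'a assume x: "x \<noteq> 0"
  have "(\<Sum>i\<in>Basis. (i \<bullet> a) * pdiff i (val (coord b)) x)
     = (\<Sum>i\<in>Basis. (1 / norm x) * ((a \<bullet> i) * (b \<bullet> i)) - ((x \<bullet> b) * norm x powr (- 3)) * ((x \<bullet> i) * (a \<bullet> i)))"
    by (intro sum.cong refl) (simp add: pdiff_coord[OF x] algebra_simps inner_commute)
  also have "\<dots> = (1 / norm x) * (a \<bullet> b) - (x \<bullet> b) * norm x powr (- 3) * (x \<bullet> a)"
    by (simp only: sum_subtractf sum_distrib_left[symmetric] euclidean_inner[symmetric])
  finally have F: "(\<Sum>i\<in>Basis. (i \<bullet> a) * pdiff i (val (coord b)) x)
     = (1 / norm x) * (a \<bullet> b) - (x \<bullet> b) * norm x powr (- 3) * (x \<bullet> a)" .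
  have "val (grad2 (coord a) (coord b)) x = (a \<bullet> b) - (x \<bullet> b) * (norm x * norm x powr (- 3)) * (x \<bullet> a)"
    unfolding val_grad2_coord[OF x] F using x by (simp add: right_diff_distrib)
  also have "norm x * norm x powr (- 3) = inverse (norm x * norm x)"
    using x powr_add[of "norm x" 1 "- 3"] by (simp add: powr_minus power2_eq_square)
  finally show "val (grad2 (coord a) (coord b)) x = val ((a \<bullet> b) *\<^sub>R 1 - coord a * coord b) x"
    using x by (simp add: val_coord val_1 divide_inverse mult_ac)
qed

lemma pdiff_lap_commute:
  assumes f: "smooth0 f" and i: "i \<in> Basis" and x: "x \<noteq> 0"
  shows "pdiff i (lap f) x = lap (pdiff i f) x"
proof -
  have "pdiff i (lap f) x = (\<Sum>j\<in>Basis. pdiff i (pdiff j (pdiff j f)) x)"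
    unfolding lap_def [abs_def] by (intro pdiff_sum smooth0_pdiff f i x)
  also have "\<dots> = (\<Sum>j\<in>Basis. pdiff j (pdiff j (pdiff i f)) x)"
  proof (rule sum.cong)
    fix j :: 'a assume j: "j \<in> Basis"
    have "pdiff i (pdiff j (pdiff j f)) x = pdiff j (pdiff i (pdiff j f)) x"
      by (intro pdiff_commute smooth0_pdiff f i j x)
    also have "\<dots> = pdiff j (pdiff j (pdiff i f)) x"
      by (rule pdiff_cong0[OF pdiff_commute]) (use f i j x in auto)
    finally show "pdiff i (pdiff j (pdiff j f)) x = pdiff j (pdiff j (pdiff i f)) x" .
  qed simp
  finally show ?thesis by (simp add: lap_def)
qed

lemma val_grad2_Basis:
  "x \<noteq> 0 \<Longrightarrow> i \<in> Basis \<Longrightarrow> val (grad2 (coord i) f) x = norm x powr 1 * pdiff i (val f) x"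
  by (simp add: val_grad2_coord inner_Basis if_distrib[of "\<lambda>t. t * _"] cong: if_cong)

text \<open>On punctured space \<open>grad2 (coord i) f\<close> is \<open>norm x\<close> times the
  \<open>i\<close>-th partial derivative, which commutes with the flat Laplacian. The corrections
  come from the weights alone: \<open>norm x\<close> on the left and \<open>norm x * norm x\<close>,
  differentiated once, on the right.\<close>

lemma lapl_grad2_Basis:
  fixes i :: "'a::euclidean_space"
  assumes i: "i \<in> Basis"
  shows "lapl (grad2 (coord i) f) = grad2 (coord i) (lapl f) - (sdim TYPE('a) - 2) *\<^sub>R grad2 (coord i) f
     - 2 *\<^sub>R (coord i * lapl f)"
proof (rule sphfun_eqI)
  fix x :: 'a assume x: "x \<noteq> 0"
  let ?h = "pdiff i (val f)"
  \<comment> \<open>In degree -1 with weight \<open>norm x powr 1\<close>, the coefficient of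
    \<open>lap_norm_powr_mult\<close> is \<open>-2 + (DIM - 1) = DIM - 3\<close>, that is, n -
    2.\<close>
  have h: "smooth0 ?h" "hom (- 1) ?h"
    using smooth0_pdiff[OF smooth0_val i] hom_pdiff[OF smooth0_val hom_val i, of f] by auto
  have "lap (val (grad2 (coord i) f)) x = lap (\<lambda>x. norm x powr 1 * ?h x) x"
    by (rule lap_cong0) (use x i in \<open>simp_all add: val_grad2_Basis\<close>)
  also have "\<dots> = norm x * lap ?h x + (real DIM('a) - 3) * (?h x / norm x)"
    using x lap_norm_powr_mult[OF h x, of 1] by (simp add: powr_minus divide_inverse mult_ac)
  finally have L': "lap (val (grad2 (coord i) f)) x = norm x * lap ?h x + (real DIM('a) - 3) * (?h x / norm x)" .
  have L: "val (lapl (grad2 (coord i) f)) x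
      = - (norm x * norm x * (norm x * lap ?h x)) - (real DIM('a) - 3) * norm x * ?h x"
    unfolding val_lapl L' using x by (simp add: field_simps)
  have "pdiff i (val (lapl f)) x = pdiff i (\<lambda>x. (- 1) * ((norm x * norm x) * lap (val f) x)) x"
    by (simp add: val_lapl[abs_def])
  also have "\<dots> = - ((norm x * norm x) * lap ?h x + lap (val f) x * (2 * (x \<bullet> i)))"
    by (simp only: pdiff_cmult[OF smooth0_mult[OF smooth0_mult] i x] pdiff_mult[OF smooth0_mult _ i x]
        pdiff_mult[OF _ _ i x] smooth0_norm smooth0_lap smooth0_val
        pdiff_norm[OF x i] pdiff_lap_commute[OF smooth0_val i x]) (use x in simp)
  finally have R': "pdiff i (val (lapl f)) x = - ((norm x * norm x) * lap ?h x + lap (val f) x * (2 * (x \<bullet> i)))" .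
  have R: "val (grad2 (coord i) (lapl f)) x
     = - (norm x * (norm x * norm x * lap ?h x)) - norm x * lap (val f) x * (2 * (x \<bullet> i))"
    unfolding val_grad2_Basis[OF x i] R' using x by (simp add: algebra_simps)
  have C: "val (coord i * lapl f) x = - (norm x * (x \<bullet> i) * lap (val f) x)"
    using x by (simp add: val_coord val_lapl)
  show "val (lapl (grad2 (coord i) f)) x = val (grad2 (coord i) (lapl f)
      - (sdim TYPE('a) - 2) *\<^sub>R grad2 (coord i) f - 2 *\<^sub>R (coord i * lapl f)) x"
    using x i C by (simp add: L R val_grad2_Basis sdim_def algebra_simps)
qed

lemma coord_eq_sum: "coord b = (\<Sum>i\<in>Basis. (b \<bullet> i) *\<^sub>R coord i)"
proof (rule sphfun_eqI)
  fix x :: 'a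
  have "(\<Sum>i\<in>Basis. (b \<bullet> i) * ((x \<bullet> i) / norm x)) = (\<Sum>i\<in>Basis. (x \<bullet> i) * (b \<bullet> i)) / norm x"
    by (simp add: sum_divide_distrib mult.commute)
  then show "val (coord b) x = val (\<Sum>i\<in>Basis. (b \<bullet> i) *\<^sub>R coord i) x"
    by (simp add: val_coord euclidean_inner[symmetric])
qed

lemma lapl_sum: "lapl (\<Sum>i\<in>A. f i) = (\<Sum>i\<in>A. lapl (f i))"
proof (induction A rule: infinite_finite_induct)
  case (insert x F)
  then show ?case by (simp add: lapl_add)
qed (use lapl_scaleR[of 0] in simp_all)

lemma grad2_sum: "grad2 g (\<Sum>i\<in>A. f i) = (\<Sum>i\<in>A. grad2 g (f i))"
proof (induction A rule: infinite_finite_induct)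
  case (insert x F)
  then show ?case by (simp add: grad2_add)
qed (use grad2_scaleR[of g 0] in simp_all)

lemma lapl_grad2_coord:
  fixes b :: "'a::euclidean_space"
  shows "lapl (grad2 (coord b) f) = grad2 (coord b) (lapl f) - (sdim TYPE('a) - 2) *\<^sub>R grad2 (coord b) f
     - 2 *\<^sub>R (coord b * lapl f)"
proof -
  have g: "grad2 (coord b) h = (\<Sum>i\<in>Basis. (b \<bullet> i) *\<^sub>R grad2 (coord i) h)" for h
    by (subst coord_eq_sum) (simp add: grad2_commute[of _ h] grad2_sum grad2_scaleR)
  have "lapl (grad2 (coord b) f) = (\<Sum>i\<in>Basis. (b \<bullet> i) *\<^sub>R lapl (grad2 (coord i) f))"
    by (simp add: g lapl_sum lapl_scaleR)
  also have "\<dots> = (\<Sum>i\<in>Basis. (b \<bullet> i) *\<^sub>R grad2 (coord i) (lapl f)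
      - (sdim TYPE('a) - 2) *\<^sub>R ((b \<bullet> i) *\<^sub>R grad2 (coord i) f) - 2 *\<^sub>R (((b \<bullet> i) *\<^sub>R coord i) * lapl f))"
    by (rule sum.cong) (auto simp: lapl_grad2_Basis scaleR_diff_right mult_ac)
  also have "\<dots> = grad2 (coord b) (lapl f) - (sdim TYPE('a) - 2) *\<^sub>R grad2 (coord b) f
     - 2 *\<^sub>R (coord b * lapl f)"
    by (simp only: sum_subtractf scaleR_sum_right[symmetric] sum_distrib_right[symmetric]
        coord_eq_sum[symmetric] g)
  finally show ?thesis .
qed

lemma sum_coord_sq: "(\<Sum>i\<in>Basis. coord i * coord i) = (1 :: 'a::euclidean_space sphfun)"
proof (rule sphfun_eqI)
  fix x :: 'a assume x: "x \<noteq> 0"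
  have "(\<Sum>i\<in>Basis. (x \<bullet> i) / norm x * ((x \<bullet> i) / norm x)) = (\<Sum>i\<in>Basis. (x \<bullet> i) * (x \<bullet> i)) / (norm x * norm x)"
    by (simp add: sum_divide_distrib)
  then show "val (\<Sum>i\<in>Basis. coord i * coord i) x = val 1 x"
    using x by (simp add: val_coord val_1 sum_Basis_sq power2_eq_square)
qed


section \<open>Algebra of the GJMS operators\<close>

definition gjms_const :: "'a::euclidean_space itself \<Rightarrow> nat \<Rightarrow> real" where
  "gjms_const t j = (sdim t - 2 * real j) * (sdim t + 2 * real j - 2) / 4"

lemma gjms_const_half: "gjms_const t j = (sdim t / 2 - real j) * (sdim t / 2 + real j - 1)"
  by (simp add: gjms_const_def field_simps)

text \<open>The factor with the largest index acts first, in agreement with the \<open>foldr\<close>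
  of \<open>gjms\<close>. Peeling it off at the argument is what the inductions below rely
  on.\<close>

primrec gj :: "nat \<Rightarrow> 'a::euclidean_space sphfun \<Rightarrow> 'a sphfun" where
  "gj 0 f = f"
| "gj (Suc k) f = gj k (lapl f + gjms_const TYPE('a) (Suc k) *\<^sub>R f)"

lemma lapl_diff: "lapl (f - g) = lapl f - lapl g"
  using lapl_add[of f "(-1) *\<^sub>R g"] by (simp only: lapl_scaleR) simp

lemma gj_add: "gj k (f + g) = gj k f + gj k g"
proof (induction k arbitrary: f g)
  case (Suc k)
  show ?case by (simp add: lapl_add scaleR_add_right Suc.IH[symmetric] algebra_simps)
qed simp

lemma gj_scaleR: "gj k (c *\<^sub>R f) = c *\<^sub>R gj k f"
proof (induction k arbitrary: f)
  case (Suc k)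
  show ?case by (simp add: lapl_scaleR Suc.IH[symmetric] algebra_simps)
qed simp

lemma gj_sum: "gj k (\<Sum>i\<in>A. f i) = (\<Sum>i\<in>A. gj k (f i))"
proof (induction A rule: infinite_finite_induct)
  case (insert x F)
  then show ?case by (simp add: gj_add)
qed (use gj_scaleR[of k 0] in simp_all)

lemma lapl_coord_mult:
  fixes b :: "'a::euclidean_space"
  shows "lapl (coord b * f) = coord b * lapl f + sdim TYPE('a) *\<^sub>R (coord b * f) - 2 *\<^sub>R grad2 (coord b) f"
  by (simp add: lapl_mult lapl_coord mult.commute grad2_commute[of f])

text \<open>Multiplication by a coordinate raises or lowers the degree of a spherical harmonic by one;
the eigenvalue of \<open>gj (Suc k)\<close> in degree l is divisible by the eigenvalues of
\<open>gj k\<close> in degrees l - 1 and l + 1, and the argument of \<open>gj k\<close> below is the quotient.\<close>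

lemma coord_gj:
  fixes b :: "'a::euclidean_space"
  shows "coord b * gj (Suc k) f = gj k (coord b * lapl f
    - real k *\<^sub>R (sdim TYPE('a) *\<^sub>R (coord b * f) - 2 *\<^sub>R grad2 (coord b) f)
    + (gjms_const TYPE('a) 1 + real k * (real k + 1)) *\<^sub>R (coord b * f))"
proof (induction k arbitrary: f)
  case 0
  show ?case by (simp add: algebra_simps)
next
  case (Suc k)
  define h where "h = sdim TYPE('a) / 2"
  have h: "sdim TYPE('a) = 2 * h" "sdim TYPE('a) / 2 = h" by (simp_all add: h_def)
  \<comment> \<open>\<open>N j\<close> is the second-order operator that remains when
    \<open>coord b\<close> is moved inside \<open>gj (Suc j)\<close>.\<close>
  define N where "N j g = coord b * lapl g
    - real j *\<^sub>R (sdim TYPE('a) *\<^sub>R (coord b * g) - 2 *\<^sub>R grad2 (coord b) g)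
    + (gjms_const TYPE('a) 1 + real j * (real j + 1)) *\<^sub>R (coord b * g)" for j g
  have "coord b * gj (Suc (Suc k)) f = coord b * gj (Suc k) (lapl f + gjms_const TYPE('a) (Suc (Suc k)) *\<^sub>R f)"
    by (subst gj.simps(2)) (rule refl)
  also have "\<dots> = gj k (N k (lapl f + gjms_const TYPE('a) (Suc (Suc k)) *\<^sub>R f))"
    unfolding N_def by (rule Suc.IH)
  \<comment> \<open>The heart of the induction: \<open>N k\<close> after the factor of index
    \<open>k + 2\<close> equals the factor of index \<open>k + 1\<close> after
    \<open>N (Suc k)\<close>. Fourth-order terms match, and \<open>lapl_grad2_coord\<close> rewrites
    the remaining commutator.\<close>
  also have "N k (lapl f + gjms_const TYPE('a) (Suc (Suc k)) *\<^sub>R f)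
      = lapl (N (Suc k) f) + gjms_const TYPE('a) (Suc k) *\<^sub>R N (Suc k) f"
    by (rule sphfun_eqI)
      (simp add: N_def lapl_add lapl_diff lapl_scaleR lapl_coord_mult lapl_grad2_coord grad2_add grad2_scaleR
        gjms_const_half h, simp add: algebra_simps)
  finally show ?case by (simp add: N_def)
qed

text \<open>Up to a factor 2 this is the gradient of the sum of squared coordinates, which is the
  constant 1.\<close>

lemma sum_coord_grad2: "(\<Sum>i\<in>Basis. coord i * grad2 (coord i) f) = (0 :: 'a::euclidean_space sphfun)"
proof -
  have "grad2 f (\<Sum>i\<in>Basis. coord i * coord i) = 2 *\<^sub>R (\<Sum>i\<in>Basis. coord i * grad2 (coord i) f)"
  proof -
    have "grad2 f (coord i * coord i) = 2 *\<^sub>R (coord i * grad2 (coord i) f)" for i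
      unfolding grad2_mult scaleR_2 grad2_commute[of f] ..
    then show ?thesis by (simp add: grad2_sum scaleR_sum_right)
  qed
  then show ?thesis by (simp add: sum_coord_sq grad2_one)
qed

text \<open>One coordinate is moved inside by \<open>coord_gj\<close>. The sum over the basis then
  meets only squares of coordinates, adding up to 1, and products
  \<open>coord i * grad2 (coord i) w\<close>, adding up to 0.\<close>

lemma sum_coord_gj_coord:
  fixes w :: "'a::euclidean_space sphfun"
  shows "(\<Sum>i\<in>Basis. coord i * gj (Suc k) (coord i * w))
    = gj (Suc k) w + (real (Suc k) * (sdim TYPE('a) + 2 * real k)) *\<^sub>R gj k w"
proof -
  define h where "h = sdim TYPE('a) / 2"
  have h: "sdim TYPE('a) = 2 * h" "sdim TYPE('a) / 2 = h" by (simp_all add: h_def)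
  let ?n = "sdim TYPE('a)" and ?c = "gjms_const TYPE('a) 1 + real k * (real k + 1)"
  \<comment> \<open>For \<open>g = coord i * w\<close> the expression
    \<open>?n *\<^sub>R (coord i * g) - 2 *\<^sub>R grad2 (coord i) g\<close> is the commutator
    \<open>lapl (coord i * g) - coord i * lapl g\<close>, which brings in the Laplacian of the
    squared coordinate times \<open>w\<close>.\<close>
  have *: "coord i * gj (Suc k) (coord i * w) = gj k (
       (1 + real k) *\<^sub>R ((coord i * coord i) * lapl w + ?n *\<^sub>R ((coord i * coord i) * w) - 2 *\<^sub>R (coord i * grad2 (coord i) w))
       - real k *\<^sub>R lapl ((coord i * coord i) * w) + ?c *\<^sub>R ((coord i * coord i) * w))" for i :: 'a
    unfolding coord_gj
    unfolding mult.assoc lapl_coord_mult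
    by (rule arg_cong[where f = "gj k"], rule sphfun_eqI) (simp, simp add: algebra_simps)
  have "(\<Sum>i\<in>Basis. coord i * gj (Suc k) (coord i * w)) = gj k (
       (1 + real k) *\<^sub>R (lapl w + ?n *\<^sub>R w) - real k *\<^sub>R lapl w + ?c *\<^sub>R w)"
    unfolding * gj_sum[symmetric]
    by (simp add: sum.distrib sum_subtractf scaleR_sum_right[symmetric] sum_distrib_right[symmetric]
        sum_coord_sq sum_coord_grad2 lapl_sum[symmetric])
  also have "\<dots> = gj k ((lapl w + gjms_const TYPE('a) (Suc k) *\<^sub>R w) + (real (Suc k) * (?n + 2 * real k)) *\<^sub>R w)"
    by (rule arg_cong[where f = "gj k"], rule sphfun_eqI)
      (simp add: gjms_const_half h, simp add: algebra_simps)
  finally show ?thesis by (simp add: gj_add gj_scaleR)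
qed

section \<open>Conjugation of the GJMS operators by affine functions\<close>

definition aff :: "real \<Rightarrow> 'a::euclidean_space \<Rightarrow> 'a sphfun" where
  "aff a b = a *\<^sub>R 1 + coord b"

lemma lapl_aff:
  fixes b :: "'a::euclidean_space"
  shows "lapl (aff a b) = sdim TYPE('a) *\<^sub>R (aff a b - a *\<^sub>R 1)"
  by (simp add: aff_def lapl_add lapl_scaleR lapl_one lapl_coord)

lemma grad2_aff: "grad2 (aff a b) f = grad2 (coord b) f"
  by (simp add: aff_def grad2_commute[of _ f] grad2_add grad2_scaleR grad2_one)

text \<open>Writing \<open>coord b\<close> as \<open>aff a b - a *\<^sub>R 1\<close> makes the
  squared gradient a polynomial in the affine function, so later identities can be checked pointwise
  in a single variable.\<close>

lemma grad2_aff_aff: "grad2 (aff a b) (aff a b) = (b \<bullet> b) *\<^sub>R 1 - (aff a b - a *\<^sub>R 1) * (aff a b - a *\<^sub>R 1)"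
  by (simp add: grad2_aff grad2_commute[of "coord b" "aff a b"] grad2_coord_coord) (simp add: aff_def)

text \<open>The Laplacian of the metric \<open>\<tau>\<^sup>-\<^sup>2 g\<close>, which is again round when \<open>\<tau>\<close> is an affine function
\<open>a + b \<bullet> x\<close> with \<open>a\<^sup>2 - |b|\<^sup>2 = 1\<close>.\<close>

definition conf_lapl :: "'a::euclidean_space sphfun \<Rightarrow> 'a sphfun \<Rightarrow> 'a sphfun" where
  "conf_lapl \<tau> f = \<tau> * \<tau> * lapl f + (sdim TYPE('a) - 2) *\<^sub>R (\<tau> * grad2 \<tau> f)"

text \<open>The GJMS product for the metric conformal to the round one, with the same zero-order
  constants and the same order of factors as \<open>gj\<close>.\<close>

primrec conf_gj :: "'a::euclidean_space sphfun \<Rightarrow> nat \<Rightarrow> 'a sphfun \<Rightarrow> 'a sphfun" where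
  "conf_gj \<tau> 0 f = f"
| "conf_gj \<tau> (Suc k) f = conf_gj \<tau> k (conf_lapl \<tau> f + gjms_const TYPE('a) (Suc k) *\<^sub>R f)"

text \<open>The coordinate part of \<tau> passes through \<open>gj (Suc k)\<close> by
  \<open>coord_gj\<close>, the constant part merely unfolds one factor, and both leave
  \<open>gj k\<close> outside. It remains to compare two second-order expressions in
  \<open>f\<close>; the relation \<open>a\<^sup>2 - b \<bullet> b = 1\<close> enters through the
  squared gradient of \<tau>.\<close>

lemma aff_gj_aff:
  fixes a :: real and b :: "'a::euclidean_space"
  defines "\<tau> \<equiv> aff a b"
  assumes ab: "a\<^sup>2 - b \<bullet> b = 1" and pos: "sphpos \<tau>"
  shows "\<tau> * gj (Suc k) (spow \<tau> (real k + 1 - sdim TYPE('a) / 2) * f)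
    = gj k (spow \<tau> (real k - sdim TYPE('a) / 2) * (conf_lapl \<tau> f + gjms_const TYPE('a) (Suc k) *\<^sub>R f))"
proof -
  define n where "n = sdim TYPE('a)"
  define h where "h = n / 2"
  have h: "n = 2 * h" "sdim TYPE('a) / 2 = h" "n / 2 = h" by (simp_all add: h_def n_def)
  \<comment> \<open>\<open>m\<close> is the conformal weight belonging to order 2(k + 1). Expressing
    k through \<open>m\<close> and \<open>h\<close> leaves a polynomial identity once powers of
    \<tau> are reduced to \<open>p\<close>.\<close>
  define m where "m = real k + 1 - n / 2"
  have k: "real k = m - 1 + h" by (simp add: m_def h)
  define g where "g = spow \<tau> m * f"
  have b: "coord b = \<tau> - a *\<^sub>R 1" by (simp add: \<tau>_def aff_def)
  have lt: "lapl \<tau> = n *\<^sub>R (\<tau> - a *\<^sub>R 1)" by (simp add: \<tau>_def lapl_aff n_def)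
  have gt: "grad2 \<tau> \<tau> = (a\<^sup>2 - 1) *\<^sub>R 1 - (\<tau> - a *\<^sub>R 1) * (\<tau> - a *\<^sub>R 1)"
    using ab by (simp add: \<tau>_def grad2_aff_aff algebra_simps)
  have gb: "grad2 (coord b) h = grad2 \<tau> h" for h by (simp add: \<tau>_def grad2_aff)
  have Dg: "lapl g = spow \<tau> m * lapl f
      + f * (m *\<^sub>R (spow \<tau> (m - 1) * lapl \<tau>) - (m * (m - 1)) *\<^sub>R (spow \<tau> (m - 2) * grad2 \<tau> \<tau>))
      - 2 *\<^sub>R (m *\<^sub>R (spow \<tau> (m - 1) * grad2 \<tau> f))"
    by (simp add: g_def lapl_mult lapl_spow[OF pos] grad2_commute[of "spow \<tau> m"] grad2_spow[OF pos]
        grad2_commute[of f])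
  have Gg: "grad2 \<tau> g = spow \<tau> m * grad2 \<tau> f + f * (m *\<^sub>R (spow \<tau> (m - 1) * grad2 \<tau> \<tau>))"
    by (simp add: g_def grad2_mult grad2_spow[OF pos])
  have "\<tau> * gj (Suc k) g = coord b * gj (Suc k) g + a *\<^sub>R gj k (lapl g + gjms_const TYPE('a) (Suc k) *\<^sub>R g)"
    by (simp add: b algebra_simps)
  also have "\<dots> = gj k ((coord b * lapl g
    - real k *\<^sub>R (n *\<^sub>R (coord b * g) - 2 *\<^sub>R grad2 (coord b) g)
    + (gjms_const TYPE('a) 1 + real k * (real k + 1)) *\<^sub>R (coord b * g))
    + a *\<^sub>R (lapl g + gjms_const TYPE('a) (Suc k) *\<^sub>R g))" (is "_ = gj k ?l")
    by (simp only: coord_gj gj_add gj_scaleR n_def)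
  also have "?l = spow \<tau> (m - 1) * (conf_lapl \<tau> f + gjms_const TYPE('a) (Suc k) *\<^sub>R f)" (is "_ = ?r")
  proof (rule sphfun_eqI)
    fix x :: 'a assume x: "x \<noteq> 0"
    define t where "t = val \<tau> x"
    have t: "t > 0" using pos x by (simp add: sphpos_def t_def)
    define p where "p = t powr (m - 2)"
    have p: "t powr (m - 1) = p * t" "t powr m = p * t\<^sup>2"
      using t powr_add[of t "m - 2" 1] powr_add[of t "m - 2" 2] by (simp_all add: p_def)
    show "val ?l x = val ?r x"
      unfolding gb Dg Gg unfolding lt gt conf_lapl_def b n_def[symmetric]
      using x by (simp add: g_def val_spow[OF pos] val_1 t_def[symmetric] p p_def[symmetric]
          gjms_const_half h k) (simp add: algebra_simps power2_eq_square)
  qed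
  finally show ?thesis by (simp add: g_def m_def n_def)
qed

text \<open>Conformal covariance of the GJMS operators for the factor \<tau>. Each induction step
  trades one factor \<tau> outside for one factor of the operator inside, through
  \<open>aff_gj_aff\<close>.\<close>

lemma gj_spow_aff:
  fixes a :: real and b :: "'a::euclidean_space"
  defines "\<tau> \<equiv> aff a b"
  assumes ab: "a\<^sup>2 - b \<bullet> b = 1" and pos: "sphpos \<tau>"
  shows "gj k (spow \<tau> (real k - sdim TYPE('a) / 2) * f) = spow \<tau> (- real k - sdim TYPE('a) / 2) * conf_gj \<tau> k f"
proof (induction k arbitrary: f)
  case (Suc k)
  let ?n = "sdim TYPE('a)"
  have "\<tau> * gj (Suc k) (spow \<tau> (real k + 1 - ?n / 2) * f) = spow \<tau> (- real k - ?n / 2) * conf_gj \<tau> (Suc k) f"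
    using aff_gj_aff[of a b k f] ab pos Suc.IH by (simp add: \<tau>_def)
  \<comment> \<open>Division by \<tau> is multiplication by \<open>spow \<tau> (- 1)\<close> in the
    ring.\<close>
  then have "spow \<tau> (- 1) * (spow \<tau> 1 * gj (Suc k) (spow \<tau> (real k + 1 - ?n / 2) * f))
      = spow \<tau> (- 1) * (spow \<tau> (- real k - ?n / 2) * conf_gj \<tau> (Suc k) f)"
    by (simp only: spow_1[OF pos])
  then show ?case
    unfolding mult.assoc[symmetric] spow_mult[OF pos]
    by (simp add: spow_0[OF pos] algebra_simps del: gj.simps conf_gj.simps)
qed (simp add: spow_0)

text \<open>The functions \<open>y i\<close> are the spatial components, and \<open>\<tau>\<close> the time component, of a Lorentz boost
applied to the point \<open>(1, x)\<close> of the light cone.\<close>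

lemma sum_boost:
  fixes \<xi> :: "'a::euclidean_space" and L :: "'a sphfun \<Rightarrow> 'a sphfun"
  assumes add: "\<And>f g. L (f + g) = L f + L g" and scale: "\<And>c f. L (c *\<^sub>R f) = c *\<^sub>R L f"
    and \<gamma>: "\<gamma> > 0" "\<gamma>\<^sup>2 * (1 - \<xi> \<bullet> \<xi>) = 1"
  defines "y \<equiv> \<lambda>i. coord i + (\<gamma>\<^sup>2 / (\<gamma> + 1) * (\<xi> \<bullet> i)) *\<^sub>R coord \<xi> + (\<gamma> * (\<xi> \<bullet> i)) *\<^sub>R 1"
  defines "\<tau> \<equiv> aff \<gamma> (\<gamma> *\<^sub>R \<xi>)"
  shows "(\<Sum>i\<in>Basis. y i * L (y i * w)) = \<tau> * L (\<tau> * w) + (\<Sum>i\<in>Basis. coord i * L (coord i * w)) - L w"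
proof -
  define \<kappa> where "\<kappa> = \<gamma>\<^sup>2 / (\<gamma> + 1)"
  \<comment> \<open>All components of the boost differ from the plain coordinates by multiples of
    the same function \<open>S\<close>, so the sum expands into terms in \<open>S\<close>,
    \<open>coord \<xi>\<close> and \<open>\<xi> \<bullet> \<xi>\<close>.\<close>
  define S where "S = \<kappa> *\<^sub>R coord \<xi> + \<gamma> *\<^sub>R 1"
  have y: "y i = coord i + (\<xi> \<bullet> i) *\<^sub>R S" for i
    by (simp add: y_def S_def \<kappa>_def algebra_simps)
  have \<tau>: "\<tau> = \<gamma> *\<^sub>R 1 + \<gamma> *\<^sub>R coord \<xi>"
    unfolding \<tau>_def aff_def by (rule sphfun_eqI) (simp add: val_coord)
  have Lsum: "L (\<Sum>i\<in>Basis. f i) = (\<Sum>i\<in>Basis. L (f i))" for f :: "'a \<Rightarrow> 'a sphfun"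
  proof -
    have L0: "L 0 = 0" using scale[of 0 0] by simp
    have "finite A \<Longrightarrow> L (\<Sum>i\<in>A. f i) = (\<Sum>i\<in>A. L (f i))" for A
      by (induction A rule: finite_induct) (auto simp: add L0)
    then show ?thesis by simp
  qed
  have LX: "(\<Sum>i\<in>Basis. (\<xi> \<bullet> i) *\<^sub>R L (coord i * w)) = L (coord \<xi> * w)"
    by (subst (2) coord_eq_sum) (simp add: sum_distrib_right Lsum scale)
  have "y i * L (y i * w) = coord i * L (coord i * w) + S * ((\<xi> \<bullet> i) *\<^sub>R L (coord i * w))
     + ((\<xi> \<bullet> i) *\<^sub>R coord i) * L (S * w) + ((\<xi> \<bullet> i) * (\<xi> \<bullet> i)) *\<^sub>R (S * L (S * w))" for i
    by (simp add: y distrib_right add scale algebra_simps)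
  then have "(\<Sum>i\<in>Basis. y i * L (y i * w)) = (\<Sum>i\<in>Basis. coord i * L (coord i * w))
     + S * L (coord \<xi> * w) + coord \<xi> * L (S * w) + (\<xi> \<bullet> \<xi>) *\<^sub>R (S * L (S * w))"
    by (simp only: sum.distrib sum_distrib_left[symmetric] sum_distrib_right[symmetric]
        scaleR_sum_left[symmetric] LX coord_eq_sum[symmetric] euclidean_inner[symmetric])
  also have "\<dots> = \<tau> * L (\<tau> * w) + (\<Sum>i\<in>Basis. coord i * L (coord i * w)) - L w"
  proof -
    have LS: "L (S * w) = \<kappa> *\<^sub>R L (coord \<xi> * w) + \<gamma> *\<^sub>R L w"
      by (simp add: S_def distrib_right add scale)
    have L\<tau>: "L (\<tau> * w) = \<gamma> *\<^sub>R L w + \<gamma> *\<^sub>R L (coord \<xi> * w)"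
      by (simp add: \<tau> distrib_right add scale)
    have r: "\<xi> \<bullet> \<xi> = (\<gamma>\<^sup>2 - 1) / \<gamma>\<^sup>2"
      using \<gamma> by (simp add: field_simps)
    have k: "\<kappa> * (\<gamma> + 1) = \<gamma>\<^sup>2" using \<gamma> by (simp add: \<kappa>_def)
    \<comment> \<open>The relations \<open>r1\<close>, \<open>r2\<close> and \<open>r3\<close>
      express that the boost matrix preserves the Lorentz form, in its time-time, time-space and
      space-space blocks.\<close>
    have r1: "(\<xi> \<bullet> \<xi>) * \<gamma>\<^sup>2 = \<gamma>\<^sup>2 - 1" using \<gamma> r by simp
    have r2: "\<gamma> + (\<xi> \<bullet> \<xi>) * \<kappa> * \<gamma> = \<gamma>\<^sup>2"
      using \<gamma>(1) unfolding r \<kappa>_def by (simp add: divide_simps) (simp add: algebra_simps power2_eq_square)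
    have r3: "2 * \<kappa> + (\<xi> \<bullet> \<xi>) * \<kappa>\<^sup>2 = \<gamma>\<^sup>2"
      using \<gamma>(1) unfolding r \<kappa>_def by (simp add: divide_simps) (simp add: algebra_simps power2_eq_square power4_eq_xxxx)
    show ?thesis
    proof (rule sphfun_eqI)
      fix x :: 'a assume x: "x \<noteq> 0"
      define X where "X = val (coord \<xi>) x"
      define A where "A = val (L (coord \<xi> * w)) x"
      define B where "B = val (L w) x"
      have "(\<kappa> * X + \<gamma>) * A + X * (\<kappa> * A + \<gamma> * B) + (\<xi> \<bullet> \<xi>) * ((\<kappa> * X + \<gamma>) * (\<kappa> * A + \<gamma> * B))
        = (2 * \<kappa> + (\<xi> \<bullet> \<xi>) * \<kappa>\<^sup>2) * (X * A) + (\<gamma> + (\<xi> \<bullet> \<xi>) * \<kappa> * \<gamma>) * (A + X * B) + ((\<xi> \<bullet> \<xi>) * \<gamma>\<^sup>2) * B"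
        by (simp add: algebra_simps power2_eq_square)
      also have "\<dots> = (\<gamma> + \<gamma> * X) * (\<gamma> * B + \<gamma> * A) - B"
        unfolding r1 r2 r3 by (simp add: algebra_simps power2_eq_square)
      finally show "val ((\<Sum>i\<in>Basis. coord i * L (coord i * w))
     + S * L (coord \<xi> * w) + coord \<xi> * L (S * w) + (\<xi> \<bullet> \<xi>) *\<^sub>R (S * L (S * w))) x
       = val (\<tau> * L (\<tau> * w) + (\<Sum>i\<in>Basis. coord i * L (coord i * w)) - L w) x"
        unfolding LS L\<tau> unfolding S_def \<tau> using x by (simp add: val_1 X_def A_def B_def)
    qed
  qed
  finally show ?thesis .
qed


section \<open>Integration over the sphere\<close>

text \<open>The ball carries the cone measure of \<open>sph_integral\<close>. As a finite measure it
  makes bounded Borel functions integrable and lets constants serve as dominating functions.\<close>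

definition bm :: "'a::euclidean_space measure" where
  "bm = restrict_space lborel (ball 0 1)"

lemma space_bm: "space bm = ball 0 1"
  by (simp add: bm_def space_restrict_space)

lemma finite_measure_bm: "finite_measure (bm :: 'a::euclidean_space measure)"
proof
  have "emeasure (bm :: 'a measure) (space bm) = emeasure lborel (ball (0::'a) 1)"
    by (simp add: space_bm) (simp add: bm_def emeasure_restrict_space)
  also have "\<dots> < \<infinity>" by (intro emeasure_bounded_finite) auto
  finally show "emeasure (bm :: 'a measure) (space bm) \<noteq> \<infinity>" by simp
qed

lemma measurable_bm [measurable (raw)]: "f \<in> borel_measurable borel \<Longrightarrow> f \<in> borel_measurable bm"
  by (simp add: bm_def measurable_restrict_space1)

lemma integrable_bm:
  assumes "f \<in> borel_measurable borel" "\<And>x. \<bar>f x\<bar> \<le> K"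
  shows "integrable bm (f :: 'a::euclidean_space \<Rightarrow> real)"
  using finite_measure.integrable_const_bound[OF finite_measure_bm, of f K] assms measurable_bm by auto

lemma set_integral_bm:
  fixes f :: "'a::euclidean_space \<Rightarrow> real"
  shows "(LINT x : ball 0 1 | lborel. f x) = integral\<^sup>L bm f"
  unfolding bm_def set_lebesgue_integral_def by (rule integral_restrict_space[symmetric]) simp

lemma tendsto_integral_bm:
  fixes s :: "nat \<Rightarrow> 'a::euclidean_space \<Rightarrow> real"
  assumes "\<And>i. s i \<in> borel_measurable borel" "f \<in> borel_measurable borel"
    and "\<And>x. norm x < 1 \<Longrightarrow> (\<lambda>i. s i x) \<longlonglongrightarrow> f x" "\<And>i x. norm x < 1 \<Longrightarrow> \<bar>s i x\<bar> \<le> K"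
  shows "(\<lambda>i. integral\<^sup>L bm (s i)) \<longlonglongrightarrow> integral\<^sup>L bm f"
proof (rule integral_dominated_convergence[where w = "\<lambda>x. K"])
  show "integrable bm (\<lambda>x::'a. K)" by (rule finite_measure.integrable_const[OF finite_measure_bm])
  show "AE x in bm. (\<lambda>i. s i x) \<longlonglongrightarrow> f x" using assms(3) by (auto simp: space_bm)
  show "AE x in bm. norm (s i x) \<le> K" for i using assms(4) by (auto simp: space_bm)
qed (use assms measurable_bm in auto)

text \<open>The uniform bound on the derivative bounds the difference quotients through the mean
  value inequality, so dominated convergence applies along every sequence tending to
  \<open>t0\<close>.\<close>

lemma DERIV_integral_bm:
  fixes f :: "real \<Rightarrow> 'a::euclidean_space \<Rightarrow> real"
  assumes e: "e > 0"
    and f: "\<And>t. t \<in> ball t0 e \<Longrightarrow> integrable bm (f t)" "\<And>t. t \<in> ball t0 e \<Longrightarrow> f t \<in> borel_measurable borel"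
    and f': "f' t0 \<in> borel_measurable borel"
    and D: "\<And>t x. t \<in> ball t0 e \<Longrightarrow> norm x < 1 \<Longrightarrow> ((\<lambda>t. f t x) has_real_derivative f' t x) (at t)"
    and K: "\<And>t x. t \<in> ball t0 e \<Longrightarrow> norm x < 1 \<Longrightarrow> \<bar>f' t x\<bar> \<le> K"
  shows "((\<lambda>t. integral\<^sup>L bm (f t)) has_real_derivative integral\<^sup>L bm (f' t0)) (at t0)"
proof -
  have t0: "t0 \<in> ball t0 e" using e by simp
  have "((\<lambda>t. (integral\<^sup>L bm (f t) - integral\<^sup>L bm (f t0)) / (t - t0)) \<longlongrightarrow> integral\<^sup>L bm (f' t0)) (at t0 within ball t0 e)"
    unfolding tendsto_at_iff_sequentially comp_def
  proof (intro allI impI)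
    fix X :: "nat \<Rightarrow> real"
    assume X: "\<forall>i. X i \<in> ball t0 e - {t0}" "X \<longlonglongrightarrow> t0"
    define s where "s i x = (f (X i) x - f t0 x) / (X i - t0)" for i x
    have "(\<lambda>i. integral\<^sup>L bm (s i)) \<longlonglongrightarrow> integral\<^sup>L bm (f' t0)"
    proof (rule tendsto_integral_bm)
      have "f (X i) \<in> borel_measurable borel" "f t0 \<in> borel_measurable borel" for i
        using f(2) X(1) t0 by auto
      then show "s i \<in> borel_measurable borel" for i
        unfolding s_def by measurable
      show "f' t0 \<in> borel_measurable borel" by (rule f')
      fix x :: 'a assume x: "norm x < 1"
      have "((\<lambda>t. (f t x - f t0 x) / (t - t0)) \<longlongrightarrow> f' t0 x) (at t0)"
        using D[OF t0 x] unfolding has_field_derivative_iff .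
      then show "(\<lambda>i. s i x) \<longlonglongrightarrow> f' t0 x"
        unfolding s_def tendsto_at_iff_sequentially comp_def using X by auto
      fix i
      have "norm (f (X i) x - f t0 x) \<le> K * norm (X i - t0)"
      proof (rule field_differentiable_bound[of "ball t0 e"])
        fix t assume t: "t \<in> ball t0 e"
        show "((\<lambda>t. f t x) has_field_derivative f' t x) (at t within ball t0 e)"
          using D[OF t x] by (rule has_field_derivative_at_within)
        show "norm (f' t x) \<le> K" using K[OF t x] by simp
      qed (use X(1) t0 in auto)
      then show "\<bar>s i x\<bar> \<le> K"
        using X(1) by (auto simp: s_def pos_divide_le_eq)
    qed
    moreover have "integral\<^sup>L bm (s i) = (integral\<^sup>L bm (f (X i)) - integral\<^sup>L bm (f t0)) / (X i - t0)" for i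
      unfolding s_def using f(1)[of "X i"] f(1)[OF t0] X(1) by simp
    ultimately show "(\<lambda>i. (integral\<^sup>L bm (f (X i)) - integral\<^sup>L bm (f t0)) / (X i - t0)) \<longlonglongrightarrow> integral\<^sup>L bm (f' t0)"
      by simp
  qed
  then show ?thesis
    using e by (simp add: has_field_derivative_iff at_within_open[of t0 "ball t0 e"])
qed

text \<open>Representatives may jump at the origin, and a single point does not affect Borel
  measurability.\<close>

lemma measurable_off_0:
  fixes f :: "'a::euclidean_space \<Rightarrow> real"
  assumes "continuous_on (- {0}) f"
  shows "f \<in> borel_measurable borel"
proof -
  have "(\<lambda>x. indicator (- {0}) x *\<^sub>R f x) \<in> borel_measurable borel"
    by (rule borel_measurable_continuous_on_indicator) (use assms in auto)
  then have "(\<lambda>x. indicator (- {0}) x *\<^sub>R f x + indicator {0} x *\<^sub>R f 0) \<in> borel_measurable borel"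
    by (rule borel_measurable_add) auto
  also have "(\<lambda>x. indicator (- {0}) x *\<^sub>R f x + indicator {0} x *\<^sub>R f 0) = f"
    by (auto simp: indicator_def)
  finally show ?thesis .
qed

lemma val_sgn: "val f (sgn x) = val f x"
  by (cases "x = 0") (auto simp: sgn_div_norm val_scaleR)

lemma continuous_on_compact_bounded:
  fixes f :: "'a::topological_space \<Rightarrow> real"
  assumes "compact S" "continuous_on S f"
  shows "\<exists>K>0. \<forall>x\<in>S. \<bar>f x\<bar> \<le> K"
  using compact_imp_bounded[OF compact_continuous_image[OF assms(2,1)]]
  unfolding bounded_pos real_norm_def by blast

lemma val_bounded: "\<exists>K>0. \<forall>x. \<bar>val f x\<bar> \<le> K"
proof -
  have "continuous_on (sphere 0 1) (val f)"
    by (rule continuous_on_subset[OF smooth0_continuous]) auto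
  then obtain K where K: "K > 0" "\<And>x. x \<in> sphere 0 1 \<Longrightarrow> \<bar>val f x\<bar> \<le> K"
    using continuous_on_compact_bounded[OF compact_sphere] by blast
  have "\<bar>val f x\<bar> \<le> K" for x
    using K(2)[of "sgn x"] K(1) by (cases "x = 0") (auto simp: norm_sgn val_sgn)
  with K(1) show ?thesis by blast
qed

lemma val_measurable [measurable]: "val f \<in> borel_measurable borel"
  by (rule measurable_off_0[OF smooth0_continuous]) simp

lemma val_integrable: "integrable bm (val f)"
  using val_bounded[of f] integrable_bm[OF val_measurable] by blast

text \<open>The factor \<open>DIM('a)\<close> is the one of \<open>sph_integral\<close>: a function
  constant on rays has ball integral equal to its sphere integral divided by n + 1.\<close>

definition intg :: "'a::euclidean_space sphfun \<Rightarrow> real" where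
  "intg f = real DIM('a) * integral\<^sup>L bm (val f)"

lemma sph_integral_eq:
  assumes "\<And>x. norm x = 1 \<Longrightarrow> g x = val f x"
  shows "sph_integral g = intg f"
proof -
  have "integral\<^sup>L bm (\<lambda>x. g (x /\<^sub>R norm x)) = integral\<^sup>L bm (val f)"
  proof (rule integral_cong_AE)
    have ev: "x \<noteq> 0 \<Longrightarrow> g (x /\<^sub>R norm x) = val f x" for x
      using assms[of "x /\<^sub>R norm x"] val_scaleR[of "inverse (norm x)" f x] by simp
    have "continuous_on (- {0}) (\<lambda>x. g (x /\<^sub>R norm x))"
      using smooth0_continuous[OF smooth0_val[of f]] ev by (subst continuous_on_cong[OF refl, of _ _ "val f"]) auto
    then show "(\<lambda>x. g (x /\<^sub>R norm x)) \<in> borel_measurable bm"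
      by (intro measurable_bm measurable_off_0)
    have "AE x in lborel. x \<noteq> (0::'a)" by (rule AE_lborel_singleton)
    then have "AE x in bm. x \<noteq> (0::'a)"
      unfolding bm_def by (subst AE_restrict_space_iff) auto
    then show "AE x in bm. g (x /\<^sub>R norm x) = val f x"
      by eventually_elim (rule ev)
  qed (use measurable_bm val_measurable in auto)
  then show ?thesis by (simp add: sph_integral_def set_integral_bm intg_def)
qed

lemma sph_vol_eq: "sph_vol TYPE('a::euclidean_space) = intg (1 :: 'a sphfun)"
  unfolding sph_vol_def by (rule sph_integral_eq) (auto simp: val_1)

lemma intg_add: "intg (f + g) = intg f + intg g"
  by (simp add: intg_def val_fun_simps(1) val_integrable algebra_simps)

lemma intg_scaleR: "intg (c *\<^sub>R f) = c * intg f"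
  by (simp add: intg_def val_fun_simps(3) val_integrable algebra_simps)

lemma intg_diff: "intg (f - g) = intg f - intg g"
  using intg_add[of f "(-1) *\<^sub>R g"] by (simp only: intg_scaleR) simp

lemma intg_sum: "intg (\<Sum>i\<in>A. f i) = (\<Sum>i\<in>A. intg (f i))"
proof (induction A rule: infinite_finite_induct)
  case (insert x F)
  then show ?case by (simp add: intg_add)
qed (use intg_scaleR[of 0 0] in simp_all)

lemma intg_nonneg: "(\<And>x. val f x \<ge> 0) \<Longrightarrow> intg f \<ge> 0"
  by (simp add: intg_def)

text \<open>A nonzero value persists on an open subset of the punctured ball, and nonempty open sets
  are not negligible.\<close>

lemma intg_eq_0D:
  assumes nn: "\<And>x. val f x \<ge> 0" and 0: "intg (f :: 'a::euclidean_space sphfun) = 0"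
  shows "f = 0"
proof (rule sphfun_eqI, rule ccontr)
  fix x0 :: 'a assume x0: "x0 \<noteq> 0" and ne: "val f x0 \<noteq> val 0 x0"
  define U where "U = {x \<in> ball 0 1 \<inter> - {0}. val f x \<in> - {0}}"
  have oU: "open U"
  proof -
    have "open ((ball 0 1 \<inter> - {0}) \<inter> val f -` (- {0}))"
      by (intro continuous_open_preimage continuous_on_subset[OF smooth0_continuous[OF smooth0_val[of f]]]
          open_Int open_ball open_Compl) auto
    also have "(ball 0 1 \<inter> - {0}) \<inter> val f -` (- {0}) = U" by (auto simp: U_def)
    finally show ?thesis .
  qed
  \<comment> \<open>The nonzero value at \<open>x0\<close> is transported along its ray to radius
    1/2, inside the open ball.\<close>
  have "(1/2) *\<^sub>R sgn x0 \<in> U"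
    using x0 ne val_scaleR[of "1/2" f "sgn x0"] by (auto simp: U_def val_sgn norm_sgn)
  then have nn: "\<not> negligible U" using open_not_negligible[OF oU] by auto
  have "integral\<^sup>L bm (val f) = 0" using 0 by (simp add: intg_def)
  then have "AE x in bm. val f x = 0"
    using integral_nonneg_eq_0_iff_AE[OF val_integrable[of f]] nn assms(1) by auto
  then have "AE x in lborel. x \<in> ball 0 1 \<longrightarrow> val f x = 0"
    unfolding bm_def by (subst (asm) AE_restrict_space_iff) auto
  then have "AE x in lborel. x \<notin> U"
    by eventually_elim (auto simp: U_def)
  then have "U \<in> null_sets lborel"
    using oU by (subst (asm) AE_iff_null_sets[symmetric]) auto
  then have "negligible U"
    by (simp add: negligible_iff_null_sets null_sets_completionI)
  with nn show False by simp
qed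

lemma intg_pos: "sphpos f \<Longrightarrow> intg (f :: 'a::euclidean_space sphfun) > 0"
proof -
  assume f: "sphpos f"
  have nn: "val f x \<ge> 0" for x using f by (cases "x = 0") (auto simp: sphpos_def less_imp_le)
  have "intg f \<noteq> 0"
  proof
    assume "intg f = 0"
    with nn have "f = 0" by (intro intg_eq_0D) auto
    moreover obtain b :: 'a where "b \<noteq> 0" using nonzero_Basis SOME_Basis by metis
    ultimately show False using f unfolding sphpos_def by force
  qed
  then show ?thesis using intg_nonneg[OF nn] by simp
qed

section \<open>Differentiation under the integral and integration by parts on the sphere\<close>

lemma integral_translate:
  fixes h :: "'a::euclidean_space \<Rightarrow> real"
  assumes "h \<in> borel_measurable borel"
  shows "(\<integral>x. h (c + x) \<partial>lborel) = (\<integral>x. h x \<partial>lborel)"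
  using integral_distr[of "(+) c" lborel borel h] assms lborel_distr_plus[of c] by simp

lemma powr_le_exp:
  fixes y a C :: real
  assumes C: "C > 0" and y: "1 / C \<le> y" "y \<le> C"
  shows "y powr a \<le> exp (\<bar>a\<bar> * ln C)"
proof -
  have y0: "y > 0" using C y(1) by (meson divide_pos_pos less_le_trans zero_less_one)
  have "ln y \<le> ln C" using y y0 by (intro ln_mono) auto
  moreover have "ln (1 / C) \<le> ln y" using y C y0 by (intro ln_mono) auto
  then have "- ln C \<le> ln y" using C by (simp add: ln_div)
  ultimately have "\<bar>a\<bar> * \<bar>ln y\<bar> \<le> \<bar>a\<bar> * ln C" by (intro mult_left_mono) auto
  then have "a * ln y \<le> \<bar>a\<bar> * ln C" using abs_ge_self[of "a * ln y"] by (simp add: abs_mult)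
  then show ?thesis using y0 by (simp add: powr_def)
qed

text \<open>The single constant \<open>C\<close> keeps the base away from 0 and from infinity and
  bounds its derivative, which bounds the derivative of the integrand uniformly for every real
  exponent.\<close>

lemma DERIV_intg_spow:
  fixes F F' :: "real \<Rightarrow> 'a::euclidean_space sphfun"
  assumes e: "e > 0" and C: "C > 0"
    and F: "\<And>t x. t \<in> ball t0 e \<Longrightarrow> x \<noteq> 0 \<Longrightarrow> 1 / C \<le> val (F t) x \<and> val (F t) x \<le> C"
    and F': "\<And>t x. t \<in> ball t0 e \<Longrightarrow> x \<noteq> 0 \<Longrightarrow> \<bar>val (F' t) x\<bar> \<le> C"
    and D: "\<And>t x. t \<in> ball t0 e \<Longrightarrow> x \<noteq> 0 \<Longrightarrow> ((\<lambda>t. val (F t) x) has_real_derivative val (F' t) x) (at t)"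
  shows "((\<lambda>t. intg (spow (F t) s * g)) has_real_derivative s * intg (spow (F t0) (s - 1) * (F' t0 * g))) (at t0)"
proof -
  obtain K where K: "K > 0" "\<And>x. \<bar>val g x\<bar> \<le> K" using val_bounded[of g] by blast
  have pos: "sphpos (F t)" if "t \<in> ball t0 e" for t
    unfolding sphpos_def using F[OF that] C by (meson divide_pos_pos less_le_trans zero_less_one)
  have "((\<lambda>t. integral\<^sup>L bm (val (spow (F t) s * g))) has_real_derivative
      integral\<^sup>L bm (val (s *\<^sub>R (spow (F t0) (s - 1) * (F' t0 * g))))) (at t0)"
  proof (rule DERIV_integral_bm[OF e, where K = "\<bar>s\<bar> * (exp (\<bar>s - 1\<bar> * ln C) * (C * K))"
        and f' = "\<lambda>t. val (s *\<^sub>R (spow (F t) (s - 1) * (F' t * g)))"])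
    fix t :: real and x :: 'a assume t: "t \<in> ball t0 e"
    show "((\<lambda>t. val (spow (F t) s * g) x) has_real_derivative val (s *\<^sub>R (spow (F t) (s - 1) * (F' t * g))) x) (at t)"
    proof (cases "x = 0")
      case False
      have "val (F t) x > 0" using pos[OF t] False by (simp add: sphpos_def)
      from DERIV_cmult_right[OF DERIV_chain2[OF has_real_derivative_powr[OF this] D[OF t False], of s], of "val g x"]
      have *: "((\<lambda>t. val (F t) x powr s * val g x) has_real_derivative val (s *\<^sub>R (spow (F t) (s - 1) * (F' t * g))) x) (at t)"
        by (simp add: val_spow[OF pos[OF t]] mult_ac)
      have "\<forall>\<^sub>F t in nhds t. t \<in> ball t0 e" by (rule eventually_nhds_in_open) (use t in auto)
      then have "\<forall>\<^sub>F t in nhds t. val (F t) x powr s * val g x = val (spow (F t) s * g) x"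
        by eventually_elim (simp add: val_spow[OF pos])
      with * show ?thesis by (subst DERIV_cong_ev[symmetric]) auto
    qed simp
    show "\<bar>val (s *\<^sub>R (spow (F t) (s - 1) * (F' t * g))) x\<bar> \<le> \<bar>s\<bar> * (exp (\<bar>s - 1\<bar> * ln C) * (C * K))"
    proof (cases "x = 0")
      case False
      have "val (F t) x powr (s - 1) * (\<bar>val (F' t) x\<bar> * \<bar>val g x\<bar>) \<le> exp (\<bar>s - 1\<bar> * ln C) * (C * K)"
        using F[OF t False] F'[OF t False] K C by (intro mult_mono powr_le_exp) auto
      then show ?thesis by (simp add: val_spow[OF pos[OF t]] abs_mult mult_left_mono)
    qed (use K C in simp)
  qed (use val_integrable val_measurable in auto)
  from DERIV_cmult[OF this, of "real DIM('a)"]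
  show ?thesis by (simp only: intg_def[symmetric] intg_scaleR)
qed

text \<open>The integral of a difference quotient vanishes by translation invariance.\<close>

lemma integral_partial_derivative_eq_0:
  fixes h g :: "'a::euclidean_space \<Rightarrow> real"
  assumes i: "i \<in> Basis" and R: "R > 0"
    and h: "h \<in> borel_measurable borel" and g: "g \<in> borel_measurable borel"
    and supp: "\<And>x. norm x > R \<Longrightarrow> h x = 0"
    and bh: "\<And>x. \<bar>h x\<bar> \<le> K" and bg: "\<And>x. \<bar>g x\<bar> \<le> K"
    and D: "\<And>x. ((\<lambda>t. h (x + t *\<^sub>R i)) has_real_derivative g x) (at 0)"
  shows "(\<integral>x. g x \<partial>lborel) = 0"
proof -
  define e where "e m = inverse (real (Suc m))" for m
  have e: "0 < e m" "e m \<le> 1" for m by (auto simp: e_def field_simps)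
  define s where "s m x = (h (e m *\<^sub>R i + x) - h x) / e m" for m x
  have Ds: "((\<lambda>t. h (x + t *\<^sub>R i)) has_real_derivative g (x + t *\<^sub>R i)) (at t)" for x t
    using D[of "x + t *\<^sub>R i"] DERIV_shift[of "\<lambda>t. h (x + t *\<^sub>R i)" _ 0 t] by (simp add: algebra_simps)
  have int_h: "integrable lborel h"
  proof -
    have "integrable lborel (\<lambda>x. indicator (cball 0 R) x *\<^sub>R h x)"
      using h bh emeasure_lborel_cball_finite[of 0 R]
      by (intro integrableI_bounded_set_indicator[where B = K]) auto
    also have "(\<lambda>x. indicator (cball 0 R) x *\<^sub>R h x) = h"
      using supp by (auto simp: indicator_def fun_eq_iff not_le)
    finally show ?thesis .
  qed
  have hm [measurable]: "h \<in> borel_measurable borel" by (rule h)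
  have int_h': "integrable lborel (\<lambda>x. h (c + x))" for c
    using integrable_distr[of "(+) c" lborel borel h] int_h lborel_distr_plus[of c] by simp
  have "integral\<^sup>L lborel (s m) = 0" for m
    unfolding s_def using int_h int_h' integral_translate[OF h] by simp
  moreover have "(\<lambda>m. integral\<^sup>L lborel (s m)) \<longlonglongrightarrow> integral\<^sup>L lborel g"
  proof (rule integral_dominated_convergence[where w = "\<lambda>x. indicator (cball 0 (R + 1)) x *\<^sub>R K"])
    show "g \<in> borel_measurable lborel" using g by simp
    show "s m \<in> borel_measurable lborel" for m unfolding s_def by measurable
    \<comment> \<open>The translates move by at most 1, so all difference quotients vanish outside
      the ball of radius \<open>R + 1\<close>.\<close>
    show "integrable lborel (\<lambda>x::'a. indicator (cball 0 (R + 1)) x *\<^sub>R K)"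
      using emeasure_lborel_cball_finite[of "0::'a" "R + 1"]
      by (intro integrableI_bounded_set_indicator[where B = "\<bar>K\<bar>"]) auto
    have "e \<longlonglongrightarrow> 0" unfolding e_def by (rule LIMSEQ_inverse_real_of_nat)
    have "(\<lambda>m. s m x) \<longlonglongrightarrow> g x" for x
    proof -
      have "((\<lambda>t. (h (x + t *\<^sub>R i) - h (x + 0 *\<^sub>R i)) / (t - 0)) \<longlongrightarrow> g x) (at 0)"
        using D[of x] unfolding has_field_derivative_iff .
      moreover have "filterlim e (at 0) sequentially"
        using \<open>e \<longlonglongrightarrow> 0\<close> e by (auto simp: filterlim_at less_imp_neq[THEN not_sym])
      ultimately have "(\<lambda>m. (h (x + e m *\<^sub>R i) - h (x + 0 *\<^sub>R i)) / (e m - 0)) \<longlonglongrightarrow> g x"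
        by (rule filterlim_compose)
      then show ?thesis by (simp add: s_def add.commute)
    qed
    then show "AE x in lborel. (\<lambda>m. s m x) \<longlonglongrightarrow> g x" by simp
    have "norm (s m x) \<le> indicator (cball 0 (R + 1)) x *\<^sub>R K" for m x
    proof (cases "norm x \<le> R + 1")
      case True
      have "norm (h (x + e m *\<^sub>R i) - h (x + 0 *\<^sub>R i)) \<le> K * norm (e m - 0)"
        by (rule field_differentiable_bound[of UNIV]) (use Ds bg in auto)
      then show ?thesis using True e[of m] by (simp add: s_def pos_divide_le_eq add.commute abs_mult)
    next
      case False
      have "norm x \<le> norm (e m *\<^sub>R i + x) + norm (e m *\<^sub>R i)"
        by (metis add_diff_cancel_left' norm_triangle_ineq4)
      then have "norm (e m *\<^sub>R i + x) > R" using False e[of m] i by simp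
      then show ?thesis using False supp R by (simp add: s_def)
    qed
    then show "AE x in lborel. norm (s m x) \<le> indicator (cball 0 (R + 1)) x *\<^sub>R K" for m by simp
  qed
  ultimately show ?thesis using LIMSEQ_unique[OF _ tendsto_const] by simp
qed

text \<open>The cutoff vanishes near the origin and outside the unit ball, so
  \<open>\<eta> (x \<bullet> x) * W x\<close> extends by zero with bounded partial derivatives and
  bounded support, even though \<open>W\<close> may be singular at the origin.\<close>

lemma integral_cutoff_partial_derivative:
  fixes W :: "'a::euclidean_space \<Rightarrow> real"
  assumes W: "smooth0 W" and i: "i \<in> Basis" and d: "0 < d"
    and \<eta>: "\<And>s. (\<eta> has_real_derivative \<eta>' s) (at s)" "continuous_on UNIV \<eta>'"
    and z: "\<And>s. s \<le> d \<Longrightarrow> \<eta> s = 0 \<and> \<eta>' s = 0" "\<And>s. s \<ge> 1 \<Longrightarrow> \<eta> s = 0 \<and> \<eta>' s = 0"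
  shows "integrable lborel (\<lambda>x. \<eta> (x \<bullet> x) * pdiff i W x + 2 * (x \<bullet> i) * \<eta>' (x \<bullet> x) * W x)"
    and "(\<integral>x. (\<eta> (x \<bullet> x) * pdiff i W x + 2 * (x \<bullet> i) * \<eta>' (x \<bullet> x) * W x) \<partial>lborel) = 0"
proof -
  define h where "h x = \<eta> (x \<bullet> x) * W x" for x
  define g where "g x = \<eta> (x \<bullet> x) * pdiff i W x + 2 * (x \<bullet> i) * \<eta>' (x \<bullet> x) * W x" for x
  define A where "A = {x::'a. d \<le> x \<bullet> x \<and> x \<bullet> x \<le> 1}"
  have c\<eta>: "continuous_on UNIV \<eta>" using \<eta>(1) by (meson DERIV_isCont continuous_at_imp_continuous_on)
  have ch: "continuous_on (- {0}) h"
    unfolding h_def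
    by (intro continuous_intros continuous_on_compose2[OF c\<eta>] smooth0_continuous W) auto
  have cg: "continuous_on (- {0}) g"
    unfolding g_def
    by (intro continuous_intros continuous_on_compose2[OF c\<eta>] continuous_on_compose2[OF \<eta>(2)]
        smooth0_continuous smooth0_pdiff W i) auto
  have off: "h x = 0" "g x = 0" if "x \<notin> A" for x
    using that z[of "x \<bullet> x"] by (auto simp: A_def h_def g_def not_le)
  have "compact A"
  proof -
    have "closed A" unfolding A_def by (intro closed_Collect_conj closed_Collect_le continuous_intros)
    moreover have "A \<subseteq> cball 0 1"
      by (auto simp: A_def norm_eq_sqrt_inner)
    ultimately show ?thesis by (meson bounded_cball bounded_subset compact_eq_bounded_closed)
  qed
  have A0: "A \<subseteq> - {0}" using d by (auto simp: A_def)
  have "\<exists>K. \<forall>x. \<bar>f x\<bar> \<le> K" if cf: "continuous_on (- {0}) f" and zf: "\<And>x. x \<notin> A \<Longrightarrow> f x = 0" for f :: "'a \<Rightarrow> real"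
  proof -
    obtain K where K: "K > 0" "\<And>x. x \<in> A \<Longrightarrow> \<bar>f x\<bar> \<le> K"
      using continuous_on_compact_bounded[OF \<open>compact A\<close> continuous_on_subset[OF cf A0]] by blast
    have "\<bar>f x\<bar> \<le> K" for x using K zf[of x] by (cases "x \<in> A") auto
    then show ?thesis by blast
  qed
  from this[OF ch off(1)] this[OF cg off(2)] obtain K1 K2
    where K: "\<And>x. \<bar>h x\<bar> \<le> K1" "\<And>x. \<bar>g x\<bar> \<le> K2" by blast
  have off1: "x \<notin> A" if "norm x > 1" for x
    using that by (auto simp: A_def norm_eq_sqrt_inner)
  have gm: "g \<in> borel_measurable borel" by (rule measurable_off_0[OF cg])
  have "integrable lborel (\<lambda>x. indicator (cball 0 1) x *\<^sub>R g x)"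
    using gm K(2) emeasure_lborel_cball_finite[of 0 1]
    by (intro integrableI_bounded_set_indicator[where B = K2]) auto
  also have "(\<lambda>x. indicator (cball 0 1) x *\<^sub>R g x) = g"
    using off(2)[OF off1] by (auto simp: indicator_def fun_eq_iff not_le)
  finally show "integrable lborel (\<lambda>x. \<eta> (x \<bullet> x) * pdiff i W x + 2 * (x \<bullet> i) * \<eta>' (x \<bullet> x) * W x)"
    unfolding g_def .
  have "(\<integral>x. g x \<partial>lborel) = 0"
  proof (rule integral_partial_derivative_eq_0[OF i, of 1 h g "max K1 K2"])
    show "((\<lambda>t. h (x + t *\<^sub>R i)) has_real_derivative g x) (at 0)" for x
    proof (cases "x = 0")
      case True
      \<comment> \<open>With \<open>\<bar>t\<bar>\<close> below both \<open>d\<close> and 1 the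
        square of \<open>t\<close> stays below \<open>d\<close>, where the cutoff is zero.\<close>
      have "\<forall>\<^sub>F t in nhds (0::real). t \<in> ball 0 (min d 1)"
        by (rule eventually_nhds_in_open) (use d in auto)
      then have "\<forall>\<^sub>F t in nhds (0::real). 0 = h (x + t *\<^sub>R i)"
      proof eventually_elim
        case (elim t)
        have "\<bar>t\<bar> * \<bar>t\<bar> \<le> \<bar>t\<bar> * 1" using elim by (intro mult_left_mono) auto
        then have "t * t \<le> d" using elim by auto
        then show ?case using True i z(1)[of "t * t"] by (simp add: h_def inner_Basis)
      qed
      moreover have "((\<lambda>t::real. 0::real) has_real_derivative g x) (at 0)"
        using True z(1)[of 0] d by (simp add: g_def)
      ultimately show ?thesis by (subst DERIV_cong_ev[symmetric]) auto
    next
      case False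
      have "((\<lambda>t. (x + t *\<^sub>R i) \<bullet> (x + t *\<^sub>R i)) has_real_derivative 2 * (x \<bullet> i)) (at 0)"
        unfolding inner_add_left inner_add_right
        by (auto intro!: derivative_eq_intros simp: inner_commute)
      from DERIV_chain2[OF _ this, of \<eta> "\<eta>' (x \<bullet> x)"]
      have "((\<lambda>t. \<eta> ((x + t *\<^sub>R i) \<bullet> (x + t *\<^sub>R i))) has_real_derivative \<eta>' (x \<bullet> x) * (2 * (x \<bullet> i))) (at 0)"
        using \<eta>(1) by simp
      from DERIV_mult[OF this smooth0_DERIV[OF W i False]]
      show ?thesis unfolding h_def g_def by (simp add: algebra_simps)
    qed
    show "\<bar>h x\<bar> \<le> max K1 K2" "\<bar>g x\<bar> \<le> max K1 K2" for x using K[of x] by auto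
  qed (use off1 off measurable_off_0[OF ch] gm in auto)
  then show "(\<integral>x. (\<eta> (x \<bullet> x) * pdiff i W x + 2 * (x \<bullet> i) * \<eta>' (x \<bullet> x) * W x) \<partial>lborel) = 0"
    unfolding g_def .
qed

text \<open>A tangential field is orthogonal to the gradient of a radial cutoff, so the cutoff does not
contribute to the divergence; no polar coordinates are needed.\<close>

lemma integral_cutoff_divergence:
  fixes W :: "'a::euclidean_space \<Rightarrow> 'a \<Rightarrow> real"
  assumes W: "\<And>i. i \<in> Basis \<Longrightarrow> smooth0 (W i)" and d: "0 < d"
    and tangential: "\<And>x. x \<noteq> 0 \<Longrightarrow> (\<Sum>i\<in>Basis. (x \<bullet> i) * W i x) = 0"
    and \<eta>: "\<And>s. (\<eta> has_real_derivative \<eta>' s) (at s)" "continuous_on UNIV \<eta>'"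
    and z: "\<And>s. s \<le> d \<Longrightarrow> \<eta> s = 0 \<and> \<eta>' s = 0" "\<And>s. s \<ge> 1 \<Longrightarrow> \<eta> s = 0 \<and> \<eta>' s = 0"
  shows "(\<integral>x. \<eta> (x \<bullet> x) * (\<Sum>i\<in>Basis. pdiff i (W i) x) \<partial>lborel) = 0"
proof -
  let ?g = "\<lambda>i x. \<eta> (x \<bullet> x) * pdiff i (W i) x + 2 * (x \<bullet> i) * \<eta>' (x \<bullet> x) * W i x"
  have "(\<Sum>i\<in>Basis. ?g i x) = \<eta> (x \<bullet> x) * (\<Sum>i\<in>Basis. pdiff i (W i) x)" for x
  proof (cases "x = 0")
    case True
    then show ?thesis using z(1)[of 0] d by simp
  next
    case False
    have "(\<Sum>i\<in>Basis. ?g i x) = \<eta> (x \<bullet> x) * (\<Sum>i\<in>Basis. pdiff i (W i) x)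
        + 2 * \<eta>' (x \<bullet> x) * (\<Sum>i\<in>Basis. (x \<bullet> i) * W i x)"
      by (simp add: sum.distrib sum_distrib_left mult_ac)
    then show ?thesis using tangential[OF False] by simp
  qed
  then have "(\<integral>x. \<eta> (x \<bullet> x) * (\<Sum>i\<in>Basis. pdiff i (W i) x) \<partial>lborel) = (\<integral>x. (\<Sum>i\<in>Basis. ?g i x) \<partial>lborel)"
    by simp
  also have "\<dots> = (\<Sum>i\<in>Basis. \<integral>x. ?g i x \<partial>lborel)"
    by (rule Bochner_Integration.integral_sum) (use integral_cutoff_partial_derivative(1)[OF W _ d \<eta> z] in auto)
  also have "\<dots> = 0"
    by (rule sum.neutral) (use integral_cutoff_partial_derivative(2)[OF W _ d \<eta> z] in auto)
  finally show ?thesis .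
qed

text \<open>The squared positive part is continuously differentiable, which is all the regularity a
  cutoff must have here.\<close>

lemma DERIV_pos_part_sq:
  "((\<lambda>s::real. (max 0 (s - a))\<^sup>2) has_real_derivative 2 * max 0 (s - a)) (at s)"
proof -
  consider "s < a" | "s = a" | "s > a" by linarith
  then show ?thesis
  proof cases
    case 1
    have "\<forall>\<^sub>F r in nhds s. r \<in> {..<a}" by (rule eventually_nhds_in_open) (use 1 in auto)
    then have "\<forall>\<^sub>F r in nhds s. 0 = (max 0 (r - a))\<^sup>2" by eventually_elim auto
    moreover have "((\<lambda>r::real. 0) has_real_derivative 2 * max 0 (s - a)) (at s)" using 1 by simp
    ultimately show ?thesis by (subst DERIV_cong_ev[symmetric]) auto
  next
    case 2
    have "((\<lambda>h::real. (max 0 h)\<^sup>2 / h) \<longlongrightarrow> 0) (at 0)"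
    proof (rule Lim_null_comparison)
      show "\<forall>\<^sub>F h::real in at 0. norm ((max 0 h)\<^sup>2 / h) \<le> \<bar>h\<bar>"
        by (intro always_eventually) (auto simp: max_def power2_eq_square)
      show "((\<lambda>h::real. \<bar>h\<bar>) \<longlongrightarrow> 0) (at 0)" by (auto intro!: tendsto_eq_intros)
    qed
    then show ?thesis using 2 by (simp add: DERIV_def)
  next
    case 3
    have "\<forall>\<^sub>F r in nhds s. r \<in> {a<..}" by (rule eventually_nhds_in_open) (use 3 in auto)
    then have "\<forall>\<^sub>F r in nhds s. (r - a)\<^sup>2 = (max 0 (r - a))\<^sup>2" by eventually_elim auto
    moreover have "((\<lambda>r::real. (r - a)\<^sup>2) has_real_derivative 2 * max 0 (s - a)) (at s)"
      using 3 by (auto intro!: derivative_eq_intros)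
    ultimately show ?thesis by (subst DERIV_cong_ev[symmetric]) auto
  qed
qed

text \<open>Cutoffs increase in effect to the indicator of the punctured ball; each one gives
  integral 0, and \<open>F\<close> is bounded, so dominated convergence passes to the limit.\<close>

lemma integral_divergence_eq_0:
  fixes W :: "'a::euclidean_space \<Rightarrow> 'a \<Rightarrow> real" and F :: "'a sphfun"
  assumes W: "\<And>i. i \<in> Basis \<Longrightarrow> smooth0 (W i)"
    and tangential: "\<And>x. x \<noteq> 0 \<Longrightarrow> (\<Sum>i\<in>Basis. (x \<bullet> i) * W i x) = 0"
    and F: "\<And>x. x \<noteq> 0 \<Longrightarrow> (\<Sum>i\<in>Basis. pdiff i (W i) x) = val F x"
  shows "intg F = 0"
proof -
  define d where "d m = inverse (real (Suc m))" for m
  have d: "d m > 0" for m by (simp add: d_def)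
  \<comment> \<open>A profile with values in [0, 1] for nonnegative \<open>s\<close>, vanishing for
    \<open>s \<le> d m\<close> and for \<open>s \<ge> 1\<close>.\<close>
  define q where "q m s = (max 0 (s - d m))\<^sup>2 * (max 0 (1 - s))\<^sup>2" for m s
  define q' where "q' m s = (max 0 (s - d m))\<^sup>2 * (- 2 * max 0 (1 - s)) + (2 * max 0 (s - d m)) * (max 0 (1 - s))\<^sup>2" for m s
  have Dq: "(q m has_real_derivative q' m s) (at s)" for m s
  proof -
    have "((\<lambda>s. (max 0 ((- s) - (- 1)))\<^sup>2) has_real_derivative (2 * max 0 ((- s) - (- 1))) * (- 1)) (at s)"
      by (rule DERIV_chain2[OF DERIV_pos_part_sq]) (auto intro!: derivative_eq_intros)
    then have "((\<lambda>s. (max 0 (1 - s))\<^sup>2) has_real_derivative - 2 * max 0 (1 - s)) (at s)" by simp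
    from DERIV_mult[OF DERIV_pos_part_sq[of "d m"] this] show ?thesis
      unfolding q_def[abs_def] q'_def by (simp add: algebra_simps)
  qed
  \<comment> \<open>Raising \<open>1 - q m s\<close> to a growing power drives it to 0 wherever
    \<open>q m s\<close> stays bounded below, so \<eta> tends to 1 on (0, 1) while keeping the zeros
    of \<open>q\<close>.\<close>
  define \<eta> where "\<eta> m s = 1 - (1 - q m s) ^ Suc m" for m s
  define \<eta>' where "\<eta>' m s = real (Suc m) * (1 - q m s) ^ m * q' m s" for m s
  have D\<eta>: "(\<eta> m has_real_derivative \<eta>' m s) (at s)" for m s
    unfolding \<eta>_def[abs_def] \<eta>'_def
    by (rule derivative_eq_intros Dq refl | simp)+
  have c\<eta>: "continuous_on UNIV (\<eta>' m)" for m
    unfolding \<eta>'_def q_def q'_def by (intro continuous_intros)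
  have z: "s \<le> d m \<Longrightarrow> \<eta> m s = 0 \<and> \<eta>' m s = 0" "s \<ge> 1 \<Longrightarrow> \<eta> m s = 0 \<and> \<eta>' m s = 0" for m s
    by (auto simp: \<eta>_def \<eta>'_def q_def q'_def max_def)
  have q01: "0 \<le> q m s" "q m s \<le> 1" if "0 \<le> s" for m s
  proof -
    show "0 \<le> q m s" by (simp add: q_def)
    show "q m s \<le> 1"
    proof (cases "s \<ge> 1")
      case False
      have "(max 0 (s - d m))\<^sup>2 \<le> 1" "(max 0 (1 - s))\<^sup>2 \<le> 1"
        using that False d[of m] by (auto intro!: power_le_one)
      then show ?thesis unfolding q_def by (intro mult_le_one) auto
    qed (simp add: q_def)
  qed
  have \<eta>01: "0 \<le> \<eta> m s" "\<eta> m s \<le> 1" if "0 \<le> s" for m s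
    using q01[OF that, of m] power_le_one[of "1 - q m s" "Suc m"] zero_le_power[of "1 - q m s" "Suc m"]
    by (auto simp: \<eta>_def simp del: power_Suc)
  have lim: "(\<lambda>m. \<eta> m s) \<longlonglongrightarrow> 1" if s: "0 < s" "s < 1" for s
  proof -
    define c where "c = (s * (1 - s))\<^sup>2"
    have c: "0 < c" using s by (simp add: c_def)
    have "(\<lambda>m. q m s) \<longlonglongrightarrow> (max 0 (s - 0))\<^sup>2 * (max 0 (1 - s))\<^sup>2"
      unfolding q_def d_def by (intro tendsto_intros LIMSEQ_inverse_real_of_nat)
    also have "(max 0 (s - 0))\<^sup>2 * (max 0 (1 - s))\<^sup>2 = c"
      using s by (simp add: c_def power_mult_distrib)
    finally have "\<forall>\<^sub>F m in sequentially. c / 2 < q m s" using c by (intro order_tendstoD) auto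
    then have ev: "\<forall>\<^sub>F m in sequentially. norm ((1 - q m s) ^ Suc m) \<le> (1 - c / 2) ^ Suc m"
    proof eventually_elim
      case (elim m)
      then show ?case using q01[of s m] s by (simp only: real_norm_def power_abs) (intro power_mono, auto)
    qed
    obtain m where "c / 2 < q m s" using eventually_happens[OF \<open>\<forall>\<^sub>F m in sequentially. c / 2 < q m s\<close>] by auto
    then have "c / 2 < 1" using q01[of s m] s by linarith
    then have "(\<lambda>m. (1 - c / 2) ^ Suc m) \<longlonglongrightarrow> 0"
      using c by (intro LIMSEQ_Suc LIMSEQ_realpow_zero) auto
    from Lim_null_comparison[OF ev this] have "(\<lambda>m. 1 - (1 - q m s) ^ Suc m) \<longlonglongrightarrow> 1 - 0"
      by (intro tendsto_intros)
    then show ?thesis by (simp add: \<eta>_def)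
  qed
  obtain K where K: "\<And>x. \<bar>val F x\<bar> \<le> K" using val_bounded[of F] by blast
  have m\<eta>: "(\<lambda>x::'a. \<eta> m (x \<bullet> x)) \<in> borel_measurable borel" for m
  proof -
    have "continuous_on UNIV (\<eta> m)"
      using D\<eta> DERIV_isCont continuous_at_imp_continuous_on by blast
    then have "continuous_on UNIV (\<lambda>x::'a. \<eta> m (x \<bullet> x))"
      by (rule continuous_on_compose2) (auto intro!: continuous_intros)
    then show ?thesis by (rule borel_measurable_continuous_onI)
  qed
  have zero: "integral\<^sup>L bm (\<lambda>x. \<eta> m (x \<bullet> x) * val F x) = 0" for m
  proof -
    have "integral\<^sup>L bm (\<lambda>x. \<eta> m (x \<bullet> x) * val F x) = (\<integral>x. indicator (ball 0 1) x *\<^sub>R (\<eta> m (x \<bullet> x) * val F x) \<partial>lborel)"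
      by (simp only: set_integral_bm[symmetric] set_lebesgue_integral_def)
    also have "\<dots> = (\<integral>x. \<eta> m (x \<bullet> x) * (\<Sum>i\<in>Basis. pdiff i (W i) x) \<partial>lborel)"
    proof (rule Bochner_Integration.integral_cong)
      fix x :: 'a
      show "indicator (ball 0 1) x *\<^sub>R (\<eta> m (x \<bullet> x) * val F x) = \<eta> m (x \<bullet> x) * (\<Sum>i\<in>Basis. pdiff i (W i) x)"
      proof (cases "x = 0")
        case True
        then show ?thesis using z(1)[of 0 m] d[of m] by simp
      next
        case False
        have "x \<bullet> x \<ge> 1" if "norm x \<ge> 1" using that by (simp add: norm_eq_sqrt_inner)
        then show ?thesis using F[OF False] z(2)[of "x \<bullet> x" m] by (auto simp: indicator_def)
      qed
    qed simp
    also have "\<dots> = 0"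
      by (rule integral_cutoff_divergence[OF W d tangential D\<eta> c\<eta> z]) auto
    finally show ?thesis .
  qed
  have "(\<lambda>m. integral\<^sup>L bm (\<lambda>x. \<eta> m (x \<bullet> x) * val F x)) \<longlonglongrightarrow> integral\<^sup>L bm (val F)"
  proof (rule tendsto_integral_bm)
    show "(\<lambda>x. \<eta> m (x \<bullet> x) * val F x) \<in> borel_measurable borel" for m
      using m\<eta> by (intro borel_measurable_times val_measurable)
    fix x :: 'a assume x: "norm x < 1"
    show "(\<lambda>m. \<eta> m (x \<bullet> x) * val F x) \<longlonglongrightarrow> val F x"
    proof (cases "x = 0")
      case False
      then have "0 < x \<bullet> x" "x \<bullet> x < 1" using x by (auto simp: norm_eq_sqrt_inner)
      from tendsto_mult_right[OF lim[OF this], of "val F x"] show ?thesis by simp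
    qed simp
    show "\<bar>\<eta> m (x \<bullet> x) * val F x\<bar> \<le> K" for m
      using mult_mono[OF \<eta>01(2)[of "x \<bullet> x" m] K[of x]] \<eta>01(1)[of "x \<bullet> x" m] by (simp add: abs_mult)
  qed (rule val_measurable)
  then have "integral\<^sup>L bm (val F) = 0" using LIMSEQ_unique[OF _ tendsto_const] by (simp add: zero)
  then show ?thesis by (simp add: intg_def)
qed

text \<open>The divergence theorem is applied to a field tangential to the spheres; Euler's identity
  in degree 0 removes both its radial component and the derivative of the weight.\<close>

lemma intg_lapl:
  fixes f g :: "'a::euclidean_space sphfun"
  shows "intg (f * lapl g) = intg (grad2 f g)"
proof -
  \<comment> \<open>The factor \<open>norm x * norm x\<close> makes the field homogeneous of degree
    1, so that its divergence has degree 0 and is the value of a sphere function.\<close>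
  define W where "W i x = (norm x * norm x) * (val f x * pdiff i (val g) x)" for i x :: 'a
  have "intg (grad2 f g - f * lapl g) = 0"
  proof (rule integral_divergence_eq_0[of W])
    show sW: "smooth0 (W i)" if "i \<in> Basis" for i
      unfolding W_def[abs_def] using that by (intro smooth0_mult smooth0_pdiff) auto
    fix x :: 'a assume x: "x \<noteq> 0"
    have e: "(\<Sum>i\<in>Basis. (x \<bullet> i) * pdiff i (val g) x) = 0"
      using euler_hom[OF smooth0_val hom_val x] by simp
    have "(\<Sum>i\<in>Basis. (x \<bullet> i) * W i x) = (norm x * norm x * val f x) * (\<Sum>i\<in>Basis. (x \<bullet> i) * pdiff i (val g) x)"
      by (simp add: W_def sum_distrib_left mult_ac)
    then show "(\<Sum>i\<in>Basis. (x \<bullet> i) * W i x) = 0" by (simp add: e)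
    have "pdiff i (W i) x = norm x * norm x * (pdiff i (val f) x * pdiff i (val g) x)
        + norm x * norm x * val f x * pdiff i (pdiff i (val g)) x
        + 2 * val f x * ((x \<bullet> i) * pdiff i (val g) x)" if i: "i \<in> Basis" for i
      unfolding W_def[abs_def]
      using i x by (simp add: pdiff_mult smooth0_mult smooth0_pdiff pdiff_norm field_simps)
    then have "(\<Sum>i\<in>Basis. pdiff i (W i) x) = norm x * norm x * (\<Sum>i\<in>Basis. pdiff i (val f) x * pdiff i (val g) x)
        + norm x * norm x * val f x * (\<Sum>i\<in>Basis. pdiff i (pdiff i (val g)) x)
        + 2 * val f x * (\<Sum>i\<in>Basis. (x \<bullet> i) * pdiff i (val g) x)"
      by (simp add: sum.distrib sum_distrib_left)
    then show "(\<Sum>i\<in>Basis. pdiff i (W i) x) = val (grad2 f g - f * lapl g) x"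
      by (simp add: e val_grad2 val_lapl lap_def[symmetric])
  qed
  then show ?thesis by (simp add: intg_diff)
qed


section \<open>Positivity of the conformal Laplacian\<close>

lemma conf_lapl_add: "conf_lapl \<tau> (f + g) = conf_lapl \<tau> f + conf_lapl \<tau> g"
  by (simp add: conf_lapl_def lapl_add grad2_add algebra_simps)

lemma conf_lapl_scaleR: "conf_lapl \<tau> (c *\<^sub>R f) = c *\<^sub>R conf_lapl \<tau> f"
  by (simp add: conf_lapl_def lapl_scaleR grad2_scaleR algebra_simps)

lemma conf_gj_add: "conf_gj \<tau> k (f + g) = conf_gj \<tau> k f + conf_gj \<tau> k g"
proof (induction k arbitrary: f g)
  case (Suc k)
  show ?case by (simp add: conf_lapl_add scaleR_add_right Suc.IH[symmetric] algebra_simps)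
qed simp

lemma conf_gj_scaleR: "conf_gj \<tau> k (c *\<^sub>R f) = c *\<^sub>R conf_gj \<tau> k f"
proof (induction k arbitrary: f)
  case (Suc k)
  show ?case by (simp add: conf_lapl_scaleR Suc.IH[symmetric] algebra_simps)
qed simp

lemma intg_0: "intg 0 = 0"
  using intg_scaleR[of 0 0] by simp

text \<open>The \<open>L^2\<close> product of the conformal metric, whose volume density relative to
  the round one is \<tau> to the power -n.\<close>

definition conf_inner :: "'a::euclidean_space sphfun \<Rightarrow> 'a sphfun \<Rightarrow> 'a sphfun \<Rightarrow> real" where
  "conf_inner \<tau> f g = intg (spow \<tau> (- sdim TYPE('a)) * (f * g))"

lemma conf_inner_commute: "conf_inner \<tau> f g = conf_inner \<tau> g f"
  by (simp add: conf_inner_def mult.commute)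

lemma conf_inner_add: "conf_inner \<tau> f (g + h) = conf_inner \<tau> f g + conf_inner \<tau> f h"
  by (simp add: conf_inner_def distrib_left intg_add)

lemma conf_inner_scaleR: "conf_inner \<tau> f (c *\<^sub>R g) = c * conf_inner \<tau> f g"
  by (simp add: conf_inner_def intg_scaleR)

lemma sphpos_nonneg: "sphpos f \<Longrightarrow> val f x \<ge> 0"
  by (cases "x = 0") (auto simp: sphpos_def less_imp_le)

lemma conf_inner_nonneg: "sphpos \<tau> \<Longrightarrow> conf_inner \<tau> f f \<ge> 0"
  unfolding conf_inner_def by (rule intg_nonneg) (simp add: val_spow)

lemma grad2_nonneg: "val (grad2 f f) x \<ge> 0"
  by (simp add: val_grad2 sum_nonneg)

text \<open>\<open>conf_lapl\<close> is minus \<tau> to the power n times the divergence of \<tau>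
  to the power 2 - n times the gradient, so integration by parts gives the Dirichlet form.\<close>

lemma conf_inner_lapl:
  fixes \<tau> :: "'a::euclidean_space sphfun"
  assumes "sphpos \<tau>"
  shows "conf_inner \<tau> f (conf_lapl \<tau> g) = intg (spow \<tau> (2 - sdim TYPE('a)) * grad2 f g)"
proof -
  let ?n = "sdim TYPE('a)"
  have 1: "spow \<tau> (2 - ?n) = spow \<tau> (- ?n) * (\<tau> * \<tau>)" "spow \<tau> (2 - ?n - 1) = spow \<tau> (- ?n) * \<tau>"
    using spow_mult[OF assms, of "- ?n" 1] spow_mult[OF assms, of "- ?n + 1" 1] spow_1[OF assms]
    by (simp_all add: algebra_simps)
  have "intg (spow \<tau> (2 - ?n) * f * lapl g) = intg (grad2 (spow \<tau> (2 - ?n) * f) g)"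
    by (rule intg_lapl)
  also have "grad2 (spow \<tau> (2 - ?n) * f) g = spow \<tau> (2 - ?n) * grad2 f g
      + f * ((2 - ?n) *\<^sub>R (spow \<tau> (2 - ?n - 1) * grad2 \<tau> g))"
    by (simp only: grad2_commute[of _ g] grad2_mult grad2_spow[OF assms])
  finally have "intg (spow \<tau> (2 - ?n) * grad2 f g)
     = intg (spow \<tau> (2 - ?n) * f * lapl g - f * ((2 - ?n) *\<^sub>R (spow \<tau> (2 - ?n - 1) * grad2 \<tau> g)))"
    by (simp add: intg_diff intg_add)
  also have "\<dots> = conf_inner \<tau> f (conf_lapl \<tau> g)"
    unfolding conf_inner_def conf_lapl_def 1
    by (rule arg_cong[where f = intg], rule sphfun_eqI) (simp add: algebra_simps)
  finally show ?thesis by simp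
qed

lemma conf_lapl_symmetric:
  assumes "sphpos \<tau>"
  shows "conf_inner \<tau> f (conf_lapl \<tau> g) = conf_inner \<tau> (conf_lapl \<tau> f) g"
  using conf_inner_lapl[OF assms, of f g] conf_inner_lapl[OF assms, of g f]
  by (simp add: grad2_commute[of f g] conf_inner_commute[of _ _ g])

lemma conf_lapl_nonneg:
  assumes "sphpos \<tau>"
  shows "conf_inner \<tau> f (conf_lapl \<tau> f) \<ge> 0"
  unfolding conf_inner_lapl[OF assms]
  by (rule intg_nonneg) (simp add: val_spow[OF assms] grad2_nonneg)

text \<open>Symmetry moves one operator to the left factor, lowering the exponent by two; what
  remains is a square norm or a Dirichlet form.\<close>

lemma conf_lapl_power_nonneg:
  assumes "sphpos \<tau>"
  shows "conf_inner \<tau> f ((conf_lapl \<tau> ^^ i) f) \<ge> 0"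
proof (induction i arbitrary: f rule: less_induct)
  case (less i)
  consider "i = 0" | "i = 1" | j where "i = Suc (Suc j)"
    by (metis One_nat_def not0_implies_Suc)
  then show ?case
  proof cases
    case 3
    have "(conf_lapl \<tau> ^^ i) f = conf_lapl \<tau> ((conf_lapl \<tau> ^^ j) (conf_lapl \<tau> f))"
      using 3 by (simp add: funpow_swap1)
    then have "conf_inner \<tau> f ((conf_lapl \<tau> ^^ i) f)
        = conf_inner \<tau> (conf_lapl \<tau> f) ((conf_lapl \<tau> ^^ j) (conf_lapl \<tau> f))"
      by (simp only: conf_lapl_symmetric[OF assms])
    then show ?thesis using less.IH[of j] 3 by simp
  qed (use conf_inner_nonneg[OF assms] conf_lapl_nonneg[OF assms] in auto)
qed

text \<open>Expanding a factor \<open>A + c\<close> produces nonnegative terms, so keeping only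
  \<open>c\<close> from each factor gives a lower bound. The free exponent \<open>i\<close> is the
  induction device: the discarded term contains one more power of \<open>A\<close>. The
  classification uses \<open>i = 1\<close>.\<close>

lemma conf_gj_ge:
  fixes \<tau> :: "'a::euclidean_space sphfun"
  assumes pos: "sphpos \<tau>" and c: "\<And>j. 1 \<le> j \<Longrightarrow> j \<le> k \<Longrightarrow> gjms_const TYPE('a) j > 0"
  shows "conf_inner \<tau> f (conf_gj \<tau> k ((conf_lapl \<tau> ^^ i) f))
    \<ge> (\<Prod>j=1..k. gjms_const TYPE('a) j) * conf_inner \<tau> f ((conf_lapl \<tau> ^^ i) f)"
  using c
proof (induction k arbitrary: i)
  case (Suc k)
  let ?A = "conf_lapl \<tau>" and ?c = "gjms_const TYPE('a)" and ?P = "\<Prod>j=1..k. gjms_const TYPE('a) j"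
  have P: "?P > 0" using Suc.prems by (intro prod_pos) auto
  have IH: "conf_inner \<tau> f (conf_gj \<tau> k ((?A ^^ i) f)) \<ge> ?P * conf_inner \<tau> f ((?A ^^ i) f)" for i
    using Suc by auto
  have "0 \<le> ?P * conf_inner \<tau> f ((?A ^^ Suc i) f)"
    using P conf_lapl_power_nonneg[OF pos, of f "Suc i"] by simp
  also have "\<dots> \<le> conf_inner \<tau> f (conf_gj \<tau> k ((?A ^^ Suc i) f))" by (rule IH)
  finally have 1: "0 \<le> conf_inner \<tau> f (conf_gj \<tau> k ((?A ^^ Suc i) f))" .
  have "(\<Prod>j=1..Suc k. ?c j) * conf_inner \<tau> f ((?A ^^ i) f) = ?c (Suc k) * (?P * conf_inner \<tau> f ((?A ^^ i) f))"
    by simp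
  also have "\<dots> \<le> ?c (Suc k) * conf_inner \<tau> f (conf_gj \<tau> k ((?A ^^ i) f))"
    using Suc.prems[of "Suc k"] IH by (intro mult_left_mono) auto
  also have "\<dots> \<le> conf_inner \<tau> f (conf_gj \<tau> (Suc k) ((?A ^^ i) f))"
    using 1 by (simp add: conf_gj_add conf_gj_scaleR conf_inner_add conf_inner_scaleR)
  finally show ?case .
qed simp

text \<open>In ambient dimension at least 2 the punctured space is connected, so a function with
  zero derivative there is constant.\<close>

lemma grad2_eq_0_imp_const:
  fixes f :: "'a::euclidean_space sphfun"
  assumes dim: "DIM('a) \<ge> 2" and 0: "grad2 f f = 0"
  shows "\<exists>c. f = c *\<^sub>R 1"
proof -
  have der: "(val f has_derivative (\<lambda>h. 0)) (at x)" if x: "x \<in> - {0}" for x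
  proof -
    have "val (grad2 f f) x = 0" using 0 by simp
    then have "(\<Sum>i\<in>Basis. pdiff i (val f) x * pdiff i (val f) x) = 0"
      using x by (simp add: val_grad2)
    then have "\<forall>i\<in>Basis. pdiff i (val f) x * pdiff i (val f) x = 0"
      by (subst (asm) sum_nonneg_eq_0_iff) auto
    then show ?thesis using smooth0_has_derivative[of "val f" x] x by simp
  qed
  obtain b :: 'a where b: "b \<noteq> 0" using nonzero_Basis SOME_Basis by metis
  have "val f x = val f b" if "x \<noteq> 0" for x
    by (rule has_derivative_zero_unique_connected[of "- {0}"])
      (use der that b dim connected_punctured_universe in auto)
  then have "f = val f b *\<^sub>R 1" by (intro sphfun_eqI) (simp add: val_1)
  then show ?thesis by blast
qed

section \<open>The conformal volume\<close>

lemma val_aff: "val (aff a b) x = (if x = 0 then 0 else a + (x \<bullet> b) / norm x)"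
  by (simp add: aff_def val_1 val_coord)

lemma abs_inner_le: "x \<noteq> 0 \<Longrightarrow> \<bar>(x \<bullet> b) / norm x\<bar> \<le> norm b"
  using Cauchy_Schwarz_ineq2[of x b] by (simp add: abs_divide divide_le_eq mult.commute)

lemma sphpos_aff: "norm b < a \<Longrightarrow> sphpos (aff a b)"
proof -
  assume b: "norm b < a"
  have "0 < a + (x \<bullet> b) / norm x" if "x \<noteq> 0" for x
    using abs_inner_le[OF that, of b] b by linarith
  then show ?thesis by (simp add: sphpos_def val_aff)
qed

text \<open>The Laplacian of \<open>spow (aff a b) (1 - n)\<close> has integral zero, and it equals
  n (n - 1) times the difference of the two integrands; dividing by this factor uses n > 1.\<close>

lemma intg_spow_aff_succ:
  fixes b :: "'a::euclidean_space"
  assumes ab: "a\<^sup>2 - b \<bullet> b = 1" and pos: "sphpos (aff a b)" and n: "sdim TYPE('a) > 1"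
  shows "intg (spow (aff a b) (- sdim TYPE('a) - 1)) = a * intg (spow (aff a b) (- sdim TYPE('a)))"
proof -
  let ?n = "sdim TYPE('a)" and ?t = "aff a b"
  have "intg (1 * lapl (spow ?t (1 - ?n))) = 0"
    unfolding intg_lapl by (simp add: grad2_commute[of 1] grad2_one intg_0)
  moreover have "1 * lapl (spow ?t (1 - ?n)) = ((?n - 1) * ?n) *\<^sub>R (spow ?t (- ?n - 1) - a *\<^sub>R spow ?t (- ?n))"
  proof (rule sphfun_eqI)
    fix x :: 'a assume x: "x \<noteq> 0"
    define t where "t = val ?t x"
    have t: "t > 0" using pos x by (simp add: sphpos_def t_def)
    define p where "p = t powr (- ?n - 1)"
    have p: "t powr (- ?n) = p * t" using t powr_add[of t "- ?n - 1" 1] by (simp add: p_def)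
    have bb: "b \<bullet> b = a\<^sup>2 - 1" using ab by simp
    have e: "1 - ?n - 1 = - ?n" "1 - ?n - 2 = - ?n - 1" by simp_all
    show "val (1 * lapl (spow ?t (1 - ?n))) x
        = val (((?n - 1) * ?n) *\<^sub>R (spow ?t (- ?n - 1) - a *\<^sub>R spow ?t (- ?n))) x"
      unfolding lapl_spow[OF pos] e lapl_aff grad2_aff_aff bb
      using x by (simp add: val_spow[OF pos] val_1 t_def[symmetric] p p_def[symmetric])
        (simp add: algebra_simps power2_eq_square)
  qed
  ultimately have "(?n - 1) * ?n * (intg (spow ?t (- ?n - 1)) - a * intg (spow ?t (- ?n))) = 0"
    by (simp add: intg_scaleR intg_diff)
  then show ?thesis using n by simp
qed

lemma abs_sinh_less_cosh: "\<bar>sinh t\<bar> < cosh (t::real)"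
proof -
  have "cosh t - sinh t > 0" unfolding cosh_minus_sinh by simp
  moreover have "cosh t + sinh t > 0" unfolding cosh_plus_sinh by simp
  ultimately show ?thesis by linarith
qed

text \<open>The parameter \<open>t\<close> is the rapidity of a boost in direction \<open>e\<close>.
  Since \<open>cosh t\<close> plus or minus the absolute value of \<open>sinh t\<close> is
  \<open>exp\<close> of plus or minus \<open>\<bar>t\<bar>\<close>, one exponential bounds
  everything near \<open>t0\<close>.\<close>

lemma DERIV_intg_boost:
  fixes e :: "'a::euclidean_space" and t0 :: real
  assumes e: "norm e = 1"
  defines "\<tau> \<equiv> \<lambda>t. aff (cosh t) (sinh t *\<^sub>R e)"
  shows "((\<lambda>t. intg (spow (\<tau> t) s)) has_real_derivative
      s * intg (spow (\<tau> t0) (s - 1) * aff (sinh t0) (cosh t0 *\<^sub>R e))) (at t0)"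
proof -
  let ?\<tau>' = "\<lambda>t. aff (sinh t) (cosh t *\<^sub>R e)"
  define R where "R = \<bar>t0\<bar> + 1"
  have "((\<lambda>t. intg (spow (\<tau> t) s * 1)) has_real_derivative s * intg (spow (\<tau> t0) (s - 1) * (?\<tau>' t0 * 1))) (at t0)"
  proof (rule DERIV_intg_spow[where e = 1 and C = "exp R"])
    fix t :: real and x :: 'a assume t: "t \<in> ball t0 1" and x: "x \<noteq> 0"
    define X where "X = (x \<bullet> e) / norm x"
    have X: "\<bar>X\<bar> \<le> 1" using abs_inner_le[OF x, of e] e by (simp add: X_def)
    have v: "val (\<tau> t) x = cosh t + sinh t * X" "val (?\<tau>' t) x = sinh t + cosh t * X" for t
      using x by (simp_all add: \<tau>_def val_aff X_def)
    show "((\<lambda>t. val (\<tau> t) x) has_real_derivative val (?\<tau>' t) x) (at t)"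
      unfolding v by (auto intro!: derivative_eq_intros)
    have sX: "\<bar>sinh t * X\<bar> \<le> \<bar>sinh t\<bar>" using X mult_left_mono[of "\<bar>X\<bar>" 1 "\<bar>sinh t\<bar>"] by (simp add: abs_mult)
    have cX: "\<bar>cosh t * X\<bar> \<le> cosh t" using X mult_left_mono[of "\<bar>X\<bar>" 1 "cosh t"] by (simp add: abs_mult)
    have ex: "cosh t + \<bar>sinh t\<bar> = exp \<bar>t\<bar>" "cosh t - \<bar>sinh t\<bar> = exp (- \<bar>t\<bar>)"
      using cosh_plus_sinh[of t] cosh_minus_sinh[of t] by (auto simp: abs_if)
    have "\<bar>t\<bar> \<le> R" using t by (auto simp: R_def dist_real_def)
    then have le: "exp (- R) \<le> exp (- \<bar>t\<bar>)" "exp \<bar>t\<bar> \<le> exp R" by simp_all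
    have "exp (- R) \<le> val (\<tau> t) x \<and> val (\<tau> t) x \<le> exp R" "\<bar>val (?\<tau>' t) x\<bar> \<le> exp R"
      unfolding v using sX cX ex le by linarith+
    then show "1 / exp R \<le> val (\<tau> t) x \<and> val (\<tau> t) x \<le> exp R" "\<bar>val (?\<tau>' t) x\<bar> \<le> exp R"
      by (simp_all add: exp_minus divide_inverse)
  qed auto
  then show ?thesis by simp
qed

text \<open>The volume of the conformal metric is followed along the boosts joining the identity to
  the given one; its derivative in the rapidity is zero.\<close>

lemma intg_spow_aff:
  fixes b :: "'a::euclidean_space"
  assumes ab: "a\<^sup>2 - b \<bullet> b = 1" and a: "a > 0" and n: "sdim TYPE('a) > 1"
  shows "intg (spow (aff a b) (- sdim TYPE('a))) = intg (1 :: 'a sphfun)"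
proof -
  let ?n = "sdim TYPE('a)"
  obtain e where e: "norm e = 1" "b = norm b *\<^sub>R e"
  proof (cases "b = 0")
    case True
    show ?thesis
      by (rule that[of "SOME i. i \<in> Basis"]) (use True norm_Basis[OF SOME_Basis] in auto)
  next
    case False
    then show ?thesis by (intro that[of "sgn b"]) (auto simp: norm_sgn sgn_div_norm)
  qed
  define J where "J t = intg (spow (aff (cosh t) (sinh t *\<^sub>R e)) (- ?n))" for t
  have pos: "sphpos (aff (cosh t) (sinh t *\<^sub>R e))" for t
    by (rule sphpos_aff) (use e abs_sinh_less_cosh[of t] in simp)
  have J: "(J has_real_derivative - ?n * intg (spow (aff (cosh t) (sinh t *\<^sub>R e)) (- ?n - 1) * aff (sinh t) (cosh t *\<^sub>R e))) (at t)" for t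
    unfolding J_def[abs_def] by (rule DERIV_intg_boost[OF e(1)])
  \<comment> \<open>Strictly positive rapidity allows division by \<open>sinh t\<close>; continuity
    of \<open>J\<close> covers the endpoint 0.\<close>
  have J0: "(J has_real_derivative 0) (at t)" if t: "0 < t" for t
  proof -
    let ?\<tau> = "aff (cosh t) (sinh t *\<^sub>R e)"
    have "e \<bullet> e = 1" using e(1) by (simp add: norm_eq_1)
    then have "(cosh t)\<^sup>2 - (sinh t *\<^sub>R e) \<bullet> (sinh t *\<^sub>R e) = 1"
      using cosh_square_eq[of t] by (simp add: power2_eq_square)
    from intg_spow_aff_succ[OF this pos n]
    have s: "intg (spow ?\<tau> (- ?n - 1)) = cosh t * intg (spow ?\<tau> (- ?n))" .
    \<comment> \<open>With \<tau>' the rapidity derivative of \<tau>, one has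
      \<open>sinh t * \<tau>' = cosh t * \<tau> - 1\<close>, which rewrites the derivative through
      the two integrals compared by \<open>intg_spow_aff_succ\<close>.\<close>
    have "sinh t *\<^sub>R (spow ?\<tau> (- ?n - 1) * aff (sinh t) (cosh t *\<^sub>R e)) = cosh t *\<^sub>R spow ?\<tau> (- ?n) - spow ?\<tau> (- ?n - 1)"
    proof (rule sphfun_eqI)
      fix x :: 'a assume x: "x \<noteq> 0"
      define X where "X = (x \<bullet> e) / norm x"
      have v: "val ?\<tau> x = cosh t + sinh t * X" "val (aff (sinh t) (cosh t *\<^sub>R e)) x = sinh t + cosh t * X"
        using x by (simp_all add: val_aff X_def)
      have "val ?\<tau> x > 0" using pos x by (auto simp: sphpos_def)
      then have p: "val ?\<tau> x powr (- ?n) = val ?\<tau> x powr (- ?n - 1) * val ?\<tau> x"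
        using powr_add[of "val ?\<tau> x" "- ?n - 1" 1] by simp
      have "sinh t * (sinh t + cosh t * X) = cosh t * (cosh t + sinh t * X) - 1"
        using cosh_square_eq[of t] by (simp add: algebra_simps power2_eq_square)
      then have "sinh t * val (aff (sinh t) (cosh t *\<^sub>R e)) x = cosh t * val ?\<tau> x - 1"
        unfolding v .
      then have "val ?\<tau> x powr (- ?n - 1) * (sinh t * val (aff (sinh t) (cosh t *\<^sub>R e)) x)
         = val ?\<tau> x powr (- ?n - 1) * (cosh t * val ?\<tau> x - 1)" by simp
      then show "val (sinh t *\<^sub>R (spow ?\<tau> (- ?n - 1) * aff (sinh t) (cosh t *\<^sub>R e))) x
         = val (cosh t *\<^sub>R spow ?\<tau> (- ?n) - spow ?\<tau> (- ?n - 1)) x"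
        by (simp add: val_spow[OF pos] p algebra_simps)
    qed
    from arg_cong[OF this, of intg] s
    have "sinh t * intg (spow ?\<tau> (- ?n - 1) * aff (sinh t) (cosh t *\<^sub>R e)) = 0"
      by (simp add: intg_scaleR intg_diff)
    then have "intg (spow ?\<tau> (- ?n - 1) * aff (sinh t) (cosh t *\<^sub>R e)) = 0"
      using t by simp
    then show ?thesis using J[of t] by simp
  qed
  have "J t = J 0" if "t \<ge> 0" for t
  proof (cases "t = 0")
    case False
    show ?thesis
    proof (rule DERIV_isconst_end[of 0 t J])
      show "continuous_on {0..t} J"
        using J by (meson DERIV_isCont continuous_at_imp_continuous_on)
    qed (use that False J0 in auto)
  qed simp
  moreover have "J 0 = intg (1 :: 'a sphfun)"
  proof -
    have "spow (aff (cosh 0) (sinh 0 *\<^sub>R e)) (- ?n) = 1"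
      by (rule sphfun_eqI) (simp add: val_spow[OF pos] val_aff val_1 del: cosh_0 sinh_0, simp)
    then show ?thesis by (simp add: J_def)
  qed
  \<comment> \<open>This is the rapidity with \<open>sinh\<close> equal to \<open>norm b\<close>;
    the relation between \<open>a\<close> and \<open>b\<close> and the sign of \<open>a\<close> then
    force \<open>cosh\<close> to be \<open>a\<close>.\<close>
  moreover have "J (arsinh (norm b)) = intg (spow (aff a b) (- ?n))"
  proof -
    have sh: "sinh (arsinh (norm b)) = norm b" by simp
    have "(cosh (arsinh (norm b)))\<^sup>2 = a\<^sup>2"
      unfolding cosh_square_eq sh using ab by (simp add: power2_norm_eq_inner)
    then have "cosh (arsinh (norm b)) = a"
      using a cosh_real_pos[of "arsinh (norm b)"] by (simp add: power2_eq_iff)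
    then show ?thesis using e(2) sh by (simp add: J_def)
  qed
  moreover have "arsinh (norm b) \<ge> 0"
  proof -
    have "1 \<le> sqrt ((norm b)\<^sup>2 + 1)" by simp
    then have "1 \<le> norm b + sqrt ((norm b)\<^sup>2 + 1)" using norm_ge_zero[of b] by linarith
    then show ?thesis by (simp add: arsinh_real_def ln_ge_zero)
  qed
  ultimately show ?thesis by metis
qed


section \<open>Balancing by a conformal transformation\<close>

lemma coord_add: "coord (a + b) = coord a + coord b"
  by (rule sphfun_eqI) (simp add: val_coord inner_add_right add_divide_distrib)

lemma coord_scaleR: "coord (c *\<^sub>R b) = c *\<^sub>R coord b"
  by (rule sphfun_eqI) (simp add: val_coord)

lemma abs_val_coord_le: "\<bar>val (coord b) x\<bar> \<le> norm b"
  by (cases "x = 0") (use abs_inner_le in \<open>auto simp: val_coord\<close>)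

lemma abs_ln_one_plus_le:
  fixes r y :: real
  assumes "\<bar>y\<bar> \<le> r" "r < 1"
  shows "\<bar>ln (1 + y)\<bar> \<le> ln 2 - ln (1 - r)"
proof -
  have r: "0 \<le> r" using assms by linarith
  have "ln (1 + y) \<le> ln 2" using assms by (intro ln_mono) auto
  moreover have "ln (1 - r) \<le> ln (1 + y)" using assms by (intro ln_mono) auto
  moreover have "ln (1 - r) \<le> 0" using assms r by simp
  moreover have "0 < ln (2::real)" by simp
  ultimately show ?thesis by linarith
qed

text \<open>Equality in Cauchy-Schwarz puts the exceptional points on the line through
  \<open>l\<close>, which is negligible in dimension at least 2.\<close>

lemma AE_not_antipodal:
  fixes l :: "'a::euclidean_space"
  assumes dim: "DIM('a) \<ge> 2" and l: "norm l = 1"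
  shows "AE x in bm. 1 + val (coord l) x > 0"
proof -
  have "dim (span {l}) < DIM('a)" using dim l by auto
  then have "negligible (span {l})" by (rule negligible_lowdim)
  moreover have "span {l} \<in> sets lborel" by (simp add: closed_subspace)
  ultimately have "span {l} \<in> null_sets lborel"
    by (simp add: negligible_iff_null_sets null_sets_completion_iff)
  then have "AE x in lborel. x \<notin> span {l}" by (rule AE_not_in)
  then have "AE x in bm. x \<notin> span {l}"
    unfolding bm_def by (subst AE_restrict_space_iff) auto
  then show ?thesis
  proof eventually_elim
    case (elim x)
    then have x: "x \<noteq> 0" using span_zero by metis
    have "1 + val (coord l) x \<noteq> 0"
    proof
      assume "1 + val (coord l) x = 0"
      then have "x \<bullet> (- l) = norm x * norm (- l)" using x l by (simp add: val_coord field_simps)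
      then have "norm x *\<^sub>R (- l) = norm (- l) *\<^sub>R x" unfolding norm_cauchy_schwarz_eq .
      then have "x = (- norm x) *\<^sub>R l" using l by simp
      then have "x \<in> span {l}" by (metis span_base singletonI span_scale)
      with elim show False by simp
    qed
    then show ?case using abs_val_coord_le[of l x] l by simp
  qed
qed

text \<open>A critical point of this functional on the unit ball balances the measure with density \<open>P\<close>.\<close>

definition balance_fun :: "'a::euclidean_space sphfun \<Rightarrow> 'a \<Rightarrow> real" where
  "balance_fun P \<xi> = integral\<^sup>L bm (\<lambda>x. ln (1 + val (coord \<xi>) x) * val P x)
     - ln (1 - \<xi> \<bullet> \<xi>) / 2 * integral\<^sup>L bm (val P)"

lemma ln_coord_measurable [measurable]: "(\<lambda>x. ln (1 + val (coord \<xi>) x) * val P x) \<in> borel_measurable borel"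
  by measurable

lemma ln_coord_bounded:
  assumes "\<And>x. \<bar>val P x\<bar> \<le> K" "norm \<xi> \<le> r" "r < 1"
  shows "\<bar>ln (1 + val (coord \<xi>) x) * val P x\<bar> \<le> (ln 2 - ln (1 - r)) * K"
proof -
  have "\<bar>val (coord \<xi>) x\<bar> \<le> r" using abs_val_coord_le[of \<xi> x] assms(2) by linarith
  from abs_ln_one_plus_le[OF this assms(3)] have *: "\<bar>ln (1 + val (coord \<xi>) x)\<bar> \<le> ln 2 - ln (1 - r)" .
  then have "0 \<le> ln 2 - ln (1 - r)" by linarith
  with * show ?thesis unfolding abs_mult by (intro mult_mono assms(1)) auto
qed

lemma continuous_on_balance_fun:
  fixes P :: "'a::euclidean_space sphfun"
  assumes r: "r < 1"
  shows "continuous_on (cball 0 r) (balance_fun P)"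
  unfolding continuous_on_sequentially comp_def
proof (intro allI ballI impI)
  fix X :: "nat \<Rightarrow> 'a" and a :: 'a
  assume a: "a \<in> cball 0 r" and X: "(\<forall>n. X n \<in> cball 0 r) \<and> X \<longlonglongrightarrow> a"
  obtain K where K: "\<And>x. \<bar>val P x\<bar> \<le> K" using val_bounded[of P] by blast
  have "(\<lambda>n. integral\<^sup>L bm (\<lambda>x. ln (1 + val (coord (X n)) x) * val P x))
      \<longlonglongrightarrow> integral\<^sup>L bm (\<lambda>x. ln (1 + val (coord a) x) * val P x)"
  proof (rule tendsto_integral_bm)
    fix x :: 'a
    have "1 + val (coord a) x \<noteq> 0" using abs_val_coord_le[of a x] a r by auto
    moreover have "(\<lambda>n. val (coord (X n)) x) \<longlonglongrightarrow> val (coord a) x"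
      unfolding val_coord divide_inverse using X by (intro tendsto_intros) auto
    ultimately show "(\<lambda>n. ln (1 + val (coord (X n)) x) * val P x) \<longlonglongrightarrow> ln (1 + val (coord a) x) * val P x"
      by (intro tendsto_intros)
    show "\<bar>ln (1 + val (coord (X n)) x) * val P x\<bar> \<le> (ln 2 - ln (1 - r)) * K" for n
      by (rule ln_coord_bounded[OF K _ r]) (use X in auto)
  qed (rule ln_coord_measurable)+
  moreover have "1 - a \<bullet> a \<noteq> 0"
  proof -
    have "norm a < 1" using a r by simp
    then show ?thesis by (auto simp: norm_eq_sqrt_inner)
  qed
  ultimately show "(\<lambda>n. balance_fun P (X n)) \<longlonglongrightarrow> balance_fun P a"
    unfolding balance_fun_def using X by (intro tendsto_intros) auto
qed

text \<open>Off the cap around the antipode of \<open>l\<close> the logarithm is at least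
  \<open>ln \<delta>\<close>; on the cap it is at least \<open>ln (1 - norm \<xi>)\<close>, charged
  to at most a quarter of the mass. The subtracted term offers half of the same logarithm, so a net
  quarter remains and blows up at the boundary.\<close>

lemma balance_fun_ge:
  fixes P :: "'a::euclidean_space sphfun"
  assumes P: "sphpos P" and \<delta>: "0 < \<delta>" "\<delta> \<le> 1" and \<xi>: "norm \<xi> < 1" "norm (\<xi> - l) < \<delta>"
    and small: "integral\<^sup>L bm (\<lambda>x. indicator {x. 1 + val (coord l) x < 2 * \<delta>} x * val P x) \<le> integral\<^sup>L bm (val P) / 4"
  shows "balance_fun P \<xi> \<ge> integral\<^sup>L bm (val P) * (ln \<delta> - ln 2 / 2 - ln (1 - norm \<xi>) / 4)"
proof -
  define M where "M = integral\<^sup>L bm (val P)"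
  have Pn: "val P x \<ge> 0" for x by (rule sphpos_nonneg[OF P])
  have M: "M \<ge> 0" unfolding M_def using Pn by simp
  define A where "A = {x. 1 + val (coord l) x < 2 * \<delta>}"
  have A: "A \<in> sets borel" unfolding A_def by measurable
  obtain K where K: "\<And>x. \<bar>val P x\<bar> \<le> K" using val_bounded[of P] by blast
  have iA: "integrable bm (\<lambda>x. indicator A x * val P x)"
  proof (rule integrable_bm)
    show "(\<lambda>x. indicator A x * val P x) \<in> borel_measurable borel" using A by measurable
    show "\<bar>indicator A x * val P x\<bar> \<le> K" for x using K[of x] by (auto simp: indicator_def)
  qed
  have \<rho>: "ln (1 - norm \<xi>) \<le> 0" using \<xi>(1) by simp
  have "M * ln \<delta> + ln (1 - norm \<xi>) * (M / 4) \<le> ln \<delta> * M + ln (1 - norm \<xi>) * integral\<^sup>L bm (\<lambda>x. indicator A x * val P x)"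
    using mult_left_mono_neg[OF small \<rho>] unfolding A_def M_def by (simp add: mult.commute)
  also have "\<dots> = integral\<^sup>L bm (\<lambda>x. ln \<delta> * val P x + ln (1 - norm \<xi>) * (indicator A x * val P x))"
    using iA val_integrable[of P] by (simp add: M_def)
  also have "\<dots> \<le> integral\<^sup>L bm (\<lambda>x. ln (1 + val (coord \<xi>) x) * val P x)"
  proof (rule integral_mono)
    show "integrable bm (\<lambda>x. ln \<delta> * val P x + ln (1 - norm \<xi>) * (indicator A x * val P x))"
      using iA val_integrable[of P] by simp
    show "integrable bm (\<lambda>x. ln (1 + val (coord \<xi>) x) * val P x)"
      by (rule integrable_bm[OF ln_coord_measurable ln_coord_bounded[OF K order_refl \<xi>(1)]])
    fix x :: 'a
    have v: "- norm \<xi> \<le> val (coord \<xi>) x" using abs_val_coord_le[of \<xi> x] by linarith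
    show "ln \<delta> * val P x + ln (1 - norm \<xi>) * (indicator A x * val P x) \<le> ln (1 + val (coord \<xi>) x) * val P x"
    proof (cases "x \<in> A")
      case True
      \<comment> \<open>The lower bound charges \<open>ln \<delta>\<close> on the cap as well, which
        only lowers it.\<close>
      have "ln \<delta> \<le> 0" using \<delta> by simp
      moreover have "ln (1 - norm \<xi>) \<le> ln (1 + val (coord \<xi>) x)" using v \<xi>(1) by (intro ln_mono) auto
      ultimately have "(ln \<delta> + ln (1 - norm \<xi>)) * val P x \<le> ln (1 + val (coord \<xi>) x) * val P x"
        by (intro mult_right_mono Pn) auto
      then show ?thesis using True by (simp add: algebra_simps)
    next
      case False
      have "val (coord \<xi>) x = val (coord l) x + val (coord (\<xi> - l)) x"
        using coord_add[of l "\<xi> - l"] by (metis add.commute diff_add_cancel val_simps(1))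
      moreover have "\<bar>val (coord (\<xi> - l)) x\<bar> < \<delta>" using abs_val_coord_le[of "\<xi> - l" x] \<xi>(2) by linarith
      \<comment> \<open>Off the cap the function with \<open>l\<close> is at least
        \<open>2 * \<delta>\<close>, and replacing \<open>l\<close> by \<xi> costs less than
        \<delta>.\<close>
      ultimately have "\<delta> \<le> 1 + val (coord \<xi>) x" using False by (simp add: A_def)
      then have "ln \<delta> \<le> ln (1 + val (coord \<xi>) x)" using \<delta> by (intro ln_mono) auto
      then show ?thesis using False by (simp add: mult_right_mono Pn)
    qed
  qed
  finally have 1: "M * ln \<delta> + ln (1 - norm \<xi>) * (M / 4) \<le> integral\<^sup>L bm (\<lambda>x. ln (1 + val (coord \<xi>) x) * val P x)" .
  have "ln (1 - \<xi> \<bullet> \<xi>) \<le> ln (1 - norm \<xi>) + ln 2"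
  proof -
    have "1 - \<xi> \<bullet> \<xi> = (1 - norm \<xi>) * (1 + norm \<xi>)"
      by (simp add: algebra_simps power2_norm_eq_inner[symmetric] power2_eq_square)
    then have "ln (1 - \<xi> \<bullet> \<xi>) = ln (1 - norm \<xi>) + ln (1 + norm \<xi>)"
      using \<xi>(1) by (simp add: ln_mult_pos add_pos_nonneg)
    moreover have "ln (1 + norm \<xi>) \<le> ln 2" using \<xi>(1) by (intro ln_mono) (auto simp: add_pos_nonneg)
    ultimately show ?thesis by simp
  qed
  then have "ln (1 - \<xi> \<bullet> \<xi>) / 2 * M \<le> (ln (1 - norm \<xi>) + ln 2) / 2 * M"
    using M by (intro mult_right_mono) auto
  with 1 show ?thesis unfolding balance_fun_def M_def[symmetric] by (simp add: algebra_simps)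
qed

text \<open>As the cap shrinks its indicator converges to that of the single antipodal direction, a
  null set by \<open>AE_not_antipodal\<close>.\<close>

lemma small_cap:
  fixes P :: "'a::euclidean_space sphfun"
  assumes dim: "DIM('a) \<ge> 2" and P: "sphpos P" and l: "norm l = 1" and e: "e > 0"
  shows "\<exists>\<delta>. 0 < \<delta> \<and> \<delta> \<le> 1 \<and> integral\<^sup>L bm (\<lambda>x. indicator {x. 1 + val (coord l) x < 2 * \<delta>} x * val P x) \<le> e"
proof -
  define d where "d j = inverse (real (Suc j))" for j
  have d: "0 < d j" "d j \<le> 1" for j by (auto simp: d_def field_simps)
  have dlim: "d \<longlonglongrightarrow> 0" unfolding d_def by (rule LIMSEQ_inverse_real_of_nat)
  obtain K where K: "\<And>x. \<bar>val P x\<bar> \<le> K" using val_bounded[of P] by blast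
  define g where "g c x = indicator {x. 1 + val (coord l) x < c} x * val P x" for c x
  have gm: "g c \<in> borel_measurable borel" for c unfolding g_def by measurable
  define g0 where "g0 x = indicator {x. 1 + val (coord l) x \<le> 0} x * val P x" for x
  have g0m: "g0 \<in> borel_measurable borel" unfolding g0_def by measurable
  have "(\<lambda>j. integral\<^sup>L bm (g (2 * d j))) \<longlonglongrightarrow> integral\<^sup>L bm g0"
  proof (rule tendsto_integral_bm[OF gm g0m])
    fix x :: 'a
    show "\<bar>g (2 * d i) x\<bar> \<le> K" for i using K[of x] by (auto simp: g_def indicator_def)
    show "(\<lambda>j. g (2 * d j) x) \<longlonglongrightarrow> g0 x"
    proof (cases "1 + val (coord l) x \<le> 0")
      case True
      then have "g (2 * d j) x = g0 x" for j using d(1)[of j] by (simp add: g_def g0_def)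
      then show ?thesis by simp
    next
      case False
      have "(\<lambda>j. 2 * d j) \<longlonglongrightarrow> 2 * 0" by (intro tendsto_intros dlim)
      then have "\<forall>\<^sub>F j in sequentially. 2 * d j < 1 + val (coord l) x"
        by (rule order_tendstoD(2)) (use False in auto)
      then have "\<forall>\<^sub>F j in sequentially. g (2 * d j) x = g0 x"
        by eventually_elim (use False in \<open>auto simp: g_def g0_def\<close>)
      then show ?thesis by (rule tendsto_eventually)
    qed
  qed
  also have "integral\<^sup>L bm g0 = integral\<^sup>L (bm :: 'a measure) (\<lambda>x. 0)"
  proof (rule integral_cong_AE)
    show "AE x in bm. g0 x = 0"
      using AE_not_antipodal[OF dim l] by eventually_elim (auto simp: g0_def)
  qed (use g0m measurable_bm in auto)
  finally have "(\<lambda>j. integral\<^sup>L bm (g (2 * d j))) \<longlonglongrightarrow> 0" by simp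
  then have "\<forall>\<^sub>F j in sequentially. integral\<^sup>L bm (g (2 * d j)) < e"
    using e by (intro order_tendstoD(2)) auto
  then obtain j where "integral\<^sup>L bm (g (2 * d j)) < e" using eventually_happens by force
  then show ?thesis using d unfolding g_def by (intro exI[of _ "d j"]) auto
qed

text \<open>Otherwise points with negative value approach the boundary, and a subsequence converges
  to some \<open>l\<close> of norm 1. The lower bound near that single direction gives a
  contradiction, so \<delta> may depend on \<open>l\<close>.\<close>

lemma balance_fun_coercive:
  fixes P :: "'a::euclidean_space sphfun"
  assumes dim: "DIM('a) \<ge> 2" and P: "sphpos P"
  shows "\<exists>r<1. \<forall>\<xi>. r \<le> norm \<xi> \<and> norm \<xi> < 1 \<longrightarrow> balance_fun P \<xi> \<ge> 0"
proof (rule ccontr)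
  assume "\<not> ?thesis"
  then have "\<exists>\<xi>. r \<le> norm \<xi> \<and> norm \<xi> < 1 \<and> balance_fun P \<xi> < 0" if "r < 1" for r
    using that by (meson not_le)
  then have "\<exists>\<xi>. 1 - inverse (real (Suc m)) \<le> norm \<xi> \<and> norm \<xi> < 1 \<and> balance_fun P \<xi> < 0" for m
    by simp
  then obtain \<xi> where \<xi>: "\<And>m. 1 - inverse (real (Suc m)) \<le> norm (\<xi> m)" "\<And>m. norm (\<xi> m) < 1"
    "\<And>m. balance_fun P (\<xi> m) < 0" by metis
  have "\<forall>m. \<xi> m \<in> cball 0 1" using \<xi>(2) by (simp add: less_imp_le)
  then obtain l s where ls: "strict_mono (s :: nat \<Rightarrow> nat)" "(\<xi> \<circ> s) \<longlonglongrightarrow> l"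
    using compact_cball[of "0::'a" 1] unfolding compact_def by metis
  have nl: "(\<lambda>m. norm (\<xi> m)) \<longlonglongrightarrow> 1"
  proof (rule tendsto_sandwich)
    show "(\<lambda>m. 1 - inverse (real (Suc m))) \<longlonglongrightarrow> 1"
      using tendsto_diff[OF tendsto_const LIMSEQ_inverse_real_of_nat, of 1] by simp
    show "(\<lambda>m::nat. 1::real) \<longlonglongrightarrow> 1" by simp
  qed (use \<xi> in \<open>auto simp: less_imp_le\<close>)
  have nls: "(\<lambda>m. norm ((\<xi> \<circ> s) m)) \<longlonglongrightarrow> 1"
    using LIMSEQ_subseq_LIMSEQ[OF nl ls(1)] by (simp add: comp_def)
  then have l: "norm l = 1" using tendsto_norm[OF ls(2)] LIMSEQ_unique by blast
  define M where "M = integral\<^sup>L bm (val P)"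
  have M: "M > 0" using intg_pos[OF P] by (simp add: intg_def M_def zero_less_mult_iff)
  then obtain \<delta> where \<delta>: "0 < \<delta>" "\<delta> \<le> 1"
    "integral\<^sup>L bm (\<lambda>x. indicator {x. 1 + val (coord l) x < 2 * \<delta>} x * val P x) \<le> M / 4"
    using small_cap[OF dim P l, of "M / 4"] by auto
  \<comment> \<open>Chosen so that \<open>1 - norm \<xi> < c\<close> makes the factor of the mass in
    \<open>balance_fun_ge\<close> positive.\<close>
  define c where "c = exp (4 * ln \<delta> - 2 * ln 2)"
  have c: "c > 0" by (simp add: c_def)
  have "\<forall>\<^sub>F m in sequentially. norm ((\<xi> \<circ> s) m - l) < \<delta>"
    using tendsto_norm_zero[OF LIM_zero[OF ls(2)]] \<delta>(1) by (intro order_tendstoD(2)) auto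
  moreover have "\<forall>\<^sub>F m in sequentially. 1 - c < norm ((\<xi> \<circ> s) m)"
    using nls c by (intro order_tendstoD(1)) auto
  ultimately have "\<forall>\<^sub>F m in sequentially. False"
  proof eventually_elim
    case (elim m)
    let ?z = "(\<xi> \<circ> s) m"
    have z: "norm ?z < 1" using \<xi>(2) by simp
    have "M * (ln \<delta> - ln 2 / 2 - ln (1 - norm ?z) / 4) \<le> balance_fun P ?z"
      unfolding M_def by (rule balance_fun_ge[OF P \<delta>(1,2) z elim(1)]) (use \<delta>(3) M_def in auto)
    also have "\<dots> < 0" using \<xi>(3) by simp
    finally have "ln \<delta> - ln 2 / 2 - ln (1 - norm ?z) / 4 < 0"
      using M by (simp add: mult_less_0_iff)
    then have "4 * ln \<delta> - 2 * ln 2 < ln (1 - norm ?z)" by linarith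
    then have "c < exp (ln (1 - norm ?z))" unfolding c_def by simp
    then have "c < 1 - norm ?z" using z by simp
    with elim(2) show False by simp
  qed
  then show False by simp
qed

text \<open>The functional is 0 at the centre and nonnegative near the boundary, so a minimum over a
  smaller closed ball is global.\<close>

lemma balance_fun_minimum:
  fixes P :: "'a::euclidean_space sphfun"
  assumes dim: "DIM('a) \<ge> 2" and P: "sphpos P"
  shows "\<exists>\<xi>. norm \<xi> < 1 \<and> (\<forall>y. norm y < 1 \<longrightarrow> balance_fun P \<xi> \<le> balance_fun P y)"
proof -
  obtain r where r: "r < 1" "\<And>\<xi>. r \<le> norm \<xi> \<Longrightarrow> norm \<xi> < 1 \<Longrightarrow> balance_fun P \<xi> \<ge> 0"
    using balance_fun_coercive[OF assms] by blast
  \<comment> \<open>The radius from coercivity may be negative; the closed ball must contain the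
    centre as comparison point.\<close>
  define R where "R = max r 0"
  have R: "R < 1" "0 \<le> R" using r by (auto simp: R_def)
  have "\<exists>\<xi>\<in>cball 0 R. \<forall>y\<in>cball 0 R. balance_fun P \<xi> \<le> balance_fun P y"
    using R by (intro continuous_attains_inf continuous_on_balance_fun) auto
  then obtain \<xi> where \<xi>: "\<xi> \<in> cball 0 R" "\<And>y. y \<in> cball 0 R \<Longrightarrow> balance_fun P \<xi> \<le> balance_fun P y" by blast
  have "balance_fun P 0 = 0" by (simp add: balance_fun_def val_coord)
  then have "balance_fun P \<xi> \<le> 0" using \<xi>(2)[of 0] R by simp
  then have "balance_fun P \<xi> \<le> balance_fun P y" if "norm y < 1" for y
  proof (cases "norm y \<le> R")
    case False
    then have "balance_fun P y \<ge> 0" using r(2)[of y] that by (simp add: R_def)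
    then show ?thesis using \<open>balance_fun P \<xi> \<le> 0\<close> by linarith
  qed (use \<xi>(2) in auto)
  then show ?thesis using \<xi>(1) R by (intro exI[of _ \<xi>]) auto
qed

lemma DERIV_balance_fun:
  fixes P :: "'a::euclidean_space sphfun"
  assumes \<xi>: "norm \<xi> < 1"
  shows "((\<lambda>t. balance_fun P (\<xi> + t *\<^sub>R b)) has_real_derivative
    (intg (coord b * spow (aff 1 \<xi>) (- 1) * P) + (\<xi> \<bullet> b) / (1 - \<xi> \<bullet> \<xi>) * intg P) / real DIM('a)) (at 0)"
proof -
  define r where "r = (1 + norm \<xi>) / 2"
  have r: "norm \<xi> < r" "r < 1" using \<xi> by (auto simp: r_def)
  define e where "e = (r - norm \<xi>) / (norm b + 1)"
  have e: "e > 0" using r norm_ge_zero[of b] by (simp add: e_def add_nonneg_pos)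
  obtain K where K: "\<And>x. \<bar>val P x\<bar> \<le> K" using val_bounded[of P] by blast
  have K0: "K \<ge> 0" using K[of 0] by simp
  have near: "norm (\<xi> + t *\<^sub>R b) \<le> r" if "t \<in> ball 0 e" for t
  proof -
    have "norm (\<xi> + t *\<^sub>R b) \<le> norm \<xi> + \<bar>t\<bar> * norm b" using norm_triangle_ineq[of \<xi> "t *\<^sub>R b"] by simp
    also have "\<bar>t\<bar> * norm b \<le> e * (norm b + 1)" using that e by (intro mult_mono) auto
    also have "e * (norm b + 1) = r - norm \<xi>"
    proof -
      have "norm b + 1 \<noteq> 0" using norm_ge_zero[of b] by linarith
      then show ?thesis by (simp add: e_def)
    qed
    finally show ?thesis by simp
  qed
  define f' where "f' t x = val (coord b) x / (1 + val (coord (\<xi> + t *\<^sub>R b)) x) * val P x" for t x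
  have low: "1 + val (coord (\<xi> + t *\<^sub>R b)) x \<ge> 1 - r" if "t \<in> ball 0 e" for t x
    using abs_val_coord_le[of "\<xi> + t *\<^sub>R b" x] near[OF that] by linarith
  have D1: "((\<lambda>t. integral\<^sup>L bm (\<lambda>x. ln (1 + val (coord (\<xi> + t *\<^sub>R b)) x) * val P x)) has_real_derivative
      integral\<^sup>L bm (f' 0)) (at 0)"
  proof (rule DERIV_integral_bm[OF e, where K = "norm b / (1 - r) * K"])
    show "integrable bm (\<lambda>x. ln (1 + val (coord (\<xi> + t *\<^sub>R b)) x) * val P x)" if "t \<in> ball 0 e" for t
      by (rule integrable_bm[OF ln_coord_measurable ln_coord_bounded[OF K near[OF that] r(2)]])
    show "f' 0 \<in> borel_measurable borel" unfolding f'_def by measurable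
    fix t :: real and x :: 'a assume t: "t \<in> ball 0 e"
    have "1 + val (coord (\<xi> + t *\<^sub>R b)) x > 0" using low[OF t, of x] r by linarith
    then show "((\<lambda>t. ln (1 + val (coord (\<xi> + t *\<^sub>R b)) x) * val P x) has_real_derivative f' t x) (at t)"
      unfolding f'_def coord_add coord_scaleR val_simps
      by (auto intro!: derivative_eq_intros simp: divide_inverse)
    have "\<bar>val (coord b) x / (1 + val (coord (\<xi> + t *\<^sub>R b)) x)\<bar> \<le> norm b / (1 - r)"
      unfolding abs_divide using low[OF t, of x] r abs_val_coord_le[of b x] by (intro frac_le) auto
    then show "\<bar>f' t x\<bar> \<le> norm b / (1 - r) * K"
      unfolding f'_def abs_mult using K[of x] r by (intro mult_mono) auto
  qed (rule ln_coord_measurable)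
  have s: "1 - \<xi> \<bullet> \<xi> > 0" using \<xi> by (simp add: norm_eq_sqrt_inner)
  have "((\<lambda>t. (\<xi> + t *\<^sub>R b) \<bullet> (\<xi> + t *\<^sub>R b)) has_real_derivative 2 * (\<xi> \<bullet> b)) (at 0)"
    unfolding inner_add_left inner_add_right by (auto intro!: derivative_eq_intros simp: inner_commute)
  from DERIV_diff[OF DERIV_const[of 1] this]
  have "((\<lambda>t. 1 - (\<xi> + t *\<^sub>R b) \<bullet> (\<xi> + t *\<^sub>R b)) has_real_derivative - (2 * (\<xi> \<bullet> b))) (at 0)" by simp
  from DERIV_chain2[OF _ this, of ln "1 / (1 - \<xi> \<bullet> \<xi>)"]
  have "((\<lambda>t. ln (1 - (\<xi> + t *\<^sub>R b) \<bullet> (\<xi> + t *\<^sub>R b))) has_real_derivative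
      1 / (1 - \<xi> \<bullet> \<xi>) * - (2 * (\<xi> \<bullet> b))) (at 0)"
    using DERIV_ln_divide[OF s] by simp
  note * = DERIV_cmult_right[OF DERIV_cdivide[OF this, of 2], of "integral\<^sup>L bm (val P)"]
  have D2: "((\<lambda>t. ln (1 - (\<xi> + t *\<^sub>R b) \<bullet> (\<xi> + t *\<^sub>R b)) / 2 * integral\<^sup>L bm (val P)) has_real_derivative
      - (\<xi> \<bullet> b) / (1 - \<xi> \<bullet> \<xi>) * integral\<^sup>L bm (val P)) (at 0)"
  proof -
    have "1 / (1 - \<xi> \<bullet> \<xi>) * - (2 * (\<xi> \<bullet> b)) / 2 = - (\<xi> \<bullet> b) / (1 - \<xi> \<bullet> \<xi>)"
      using s by (simp add: field_simps)
    with * show ?thesis by (simp only:)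
  qed
  have pos: "sphpos (aff 1 \<xi>)" by (rule sphpos_aff[OF \<xi>])
  have "f' 0 = val (coord b * spow (aff 1 \<xi>) (- 1) * P)"
    using sphpos_nonneg[OF pos] by (auto simp: f'_def val_spow[OF pos] val_aff val_coord powr_minus divide_inverse fun_eq_iff)
  then have "integral\<^sup>L bm (f' 0) = intg (coord b * spow (aff 1 \<xi>) (- 1) * P) / real DIM('a)"
    by (simp add: intg_def)
  moreover have "integral\<^sup>L bm (val P) = intg P / real DIM('a)" by (simp add: intg_def)
  ultimately show ?thesis
    using DERIV_diff[OF D1 D2] unfolding balance_fun_def by (simp add: add_divide_distrib)
qed

text \<open>Criticality in direction \<open>b\<close> computes the integral of
  \<open>coord b / (1 + coord \<xi>)\<close> against \<open>P\<close>. The choice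
  \<open>b = \<xi>\<close> evaluates the integral of \<open>P / (1 + coord \<xi>)\<close>, and
  combining the two gives the balanced form for every \<open>b\<close>.\<close>

lemma balance:
  fixes P :: "'a::euclidean_space sphfun"
  assumes dim: "DIM('a) \<ge> 2" and P: "sphpos P"
  shows "\<exists>\<xi>. norm \<xi> < 1 \<and> (\<forall>b. intg ((coord b + (\<xi> \<bullet> b) *\<^sub>R 1) * (spow (aff 1 \<xi>) (- 1) * P)) = 0)"
proof -
  obtain \<xi> where \<xi>: "norm \<xi> < 1" and min: "\<And>y. norm y < 1 \<Longrightarrow> balance_fun P \<xi> \<le> balance_fun P y"
    using balance_fun_minimum[OF assms] by blast
  let ?s = "spow (aff 1 \<xi>) (- 1)"
  have pos: "sphpos (aff 1 \<xi>)" by (rule sphpos_aff[OF \<xi>])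
  have crit: "intg (coord b * ?s * P) = - (\<xi> \<bullet> b) / (1 - \<xi> \<bullet> \<xi>) * intg P" for b
  proof -
    define e where "e = (1 - norm \<xi>) / (norm b + 1)"
    have e: "e > 0" using \<xi> norm_ge_zero[of b] by (simp add: e_def add_nonneg_pos)
    have "norm (\<xi> + t *\<^sub>R b) < 1" if "\<bar>0 - t\<bar> < e" for t
    proof -
      have "norm (\<xi> + t *\<^sub>R b) \<le> norm \<xi> + \<bar>t\<bar> * norm b" using norm_triangle_ineq[of \<xi> "t *\<^sub>R b"] by simp
      also have "\<bar>t\<bar> * norm b \<le> \<bar>t\<bar> * (norm b + 1)" by (simp add: mult_left_mono)
      also have "\<bar>t\<bar> * (norm b + 1) < e * (norm b + 1)"
        using that norm_ge_zero[of b] by (intro mult_strict_right_mono) (auto simp: add_nonneg_pos)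
      also have "e * (norm b + 1) = 1 - norm \<xi>"
      proof -
        have "norm b + 1 \<noteq> 0" using norm_ge_zero[of b] by linarith
        then show ?thesis by (simp add: e_def)
      qed
      finally show ?thesis by simp
    qed
    then have "\<forall>t. \<bar>0 - t\<bar> < e \<longrightarrow> balance_fun P (\<xi> + 0 *\<^sub>R b) \<le> balance_fun P (\<xi> + t *\<^sub>R b)"
      using min by simp
    from DERIV_local_min[OF DERIV_balance_fun[OF \<xi>] e this] show ?thesis by simp
  qed
  have s: "1 - \<xi> \<bullet> \<xi> > 0"
    using \<xi> by (simp add: norm_eq_sqrt_inner)
  \<comment> \<open>This is \<open>z / (1 + z) = 1 - 1 / (1 + z)\<close> for the coordinate along
    \<xi>.\<close>
  have "coord \<xi> * ?s * P = P - ?s * P"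
  proof (rule sphfun_eqI)
    fix x :: 'a assume x: "x \<noteq> 0"
    have "val (aff 1 \<xi>) x > 0" using pos x by (simp add: sphpos_def)
    then have "(1 + val (coord \<xi>) x) * val ?s x = 1"
      using x by (simp add: val_spow[OF pos] powr_minus val_aff val_coord)
    then have "val (coord \<xi>) x * val ?s x * val P x = val P x - val ?s x * val P x"
      by (simp add: algebra_simps) (metis distrib_left mult.assoc mult.commute mult.right_neutral)
    then show "val (coord \<xi> * ?s * P) x = val (P - ?s * P) x" by simp
  qed
  then have "intg P - intg (?s * P) = - (\<xi> \<bullet> \<xi>) / (1 - \<xi> \<bullet> \<xi>) * intg P"
    using crit[of \<xi>] by (simp add: intg_diff)
  then have "intg (?s * P) = intg P / (1 - \<xi> \<bullet> \<xi>)" using s by (simp add: field_simps)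
  then have "intg ((coord b + (\<xi> \<bullet> b) *\<^sub>R 1) * (?s * P)) = 0" for b
    using crit[of b] by (simp add: distrib_right intg_add intg_scaleR mult.assoc)
  with \<xi> show ?thesis by blast
qed


section \<open>The second variation\<close>

lemma sphpos_one [simp]: "sphpos 1"
  by (simp add: sphpos_def val_1)

lemma spow_one: "spow 1 s = 1"
  by (rule sphfun_eqI) (simp add: val_spow val_1)

lemma spow_mult_base:
  assumes "sphpos f" "sphpos g"
  shows "spow (f * g) s = spow f s * spow g s"
proof -
  have "sphpos (f * g)" using assms by (simp add: sphpos_def)
  then show ?thesis using assms
    by (intro sphfun_eqI) (simp add: val_spow powr_mult sphpos_nonneg)
qed

lemma sphpos_scaleR: "c > 0 \<Longrightarrow> sphpos f \<Longrightarrow> sphpos (c *\<^sub>R f)"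
  by (simp add: sphpos_def)

lemma spow_scaleR:
  assumes "c > 0" "sphpos f"
  shows "spow (c *\<^sub>R f) s = c powr s *\<^sub>R spow f s"
  using assms sphpos_scaleR[OF assms]
  by (intro sphfun_eqI) (simp add: val_spow powr_mult sphpos_nonneg)

lemma sphpos_spow: "sphpos f \<Longrightarrow> sphpos (spow f s)"
  using val_spow[of f s] by (simp add: sphpos_def) (metis less_irrefl)

lemma spow_spow: "sphpos f \<Longrightarrow> spow (spow f s) t = spow f (s * t)"
  using sphpos_spow[of f s] by (intro sphfun_eqI) (simp add: val_spow powr_powr)

text \<open>The half in the bound on \<open>t\<close> keeps the line within [1/2, 3/2], giving a
  uniform distance from 0 for real powers.\<close>

lemma sphpos_line:
  assumes B: "\<And>x. \<bar>val f x\<bar> \<le> B" and B0: "B > 0" and t: "\<bar>t\<bar> < 1 / (2 * B)"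
  shows "x \<noteq> 0 \<Longrightarrow> val (1 + t *\<^sub>R f) x \<in> {1/2..3/2}"
    and "sphpos (1 + t *\<^sub>R f)"
proof -
  have *: "\<bar>t * val f x\<bar> \<le> 1/2" for x
  proof -
    have "\<bar>t\<bar> * \<bar>val f x\<bar> \<le> 1 / (2 * B) * B" using B[of x] t B0 by (intro mult_mono) auto
    then show ?thesis using B0 by (simp add: abs_mult)
  qed
  then show "x \<noteq> 0 \<Longrightarrow> val (1 + t *\<^sub>R f) x \<in> {1/2..3/2}"
  proof -
    assume x: "x \<noteq> 0"
    have "t * val f x \<le> 1/2" "- (t * val f x) \<le> 1/2" using *[of x] by (simp_all only: abs_le_iff)
    with x show ?thesis by (simp add: val_1)
  qed
  show "sphpos (1 + t *\<^sub>R f)"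
    unfolding sphpos_def
  proof (intro allI impI)
    fix x :: 'a assume "x \<noteq> 0"
    then show "0 < val (1 + t *\<^sub>R f) x" using *[of x] by (simp add: val_1 abs_le_iff)
  qed
qed

lemma DERIV_intg_spow_line:
  fixes f g :: "'a::euclidean_space sphfun"
  assumes B: "\<And>x. \<bar>val f x\<bar> \<le> B" and B0: "B > 0" and t0: "\<bar>t0\<bar> < 1 / (2 * B)"
  shows "((\<lambda>t. intg (spow (1 + t *\<^sub>R f) s * g)) has_real_derivative
     s * intg (spow (1 + t0 *\<^sub>R f) (s - 1) * (f * g))) (at t0)"
proof (rule DERIV_intg_spow[where e = "1 / (2 * B) - \<bar>t0\<bar>" and C = "max 2 B"])
  fix t :: real and x :: 'a assume t: "t \<in> ball t0 (1 / (2 * B) - \<bar>t0\<bar>)" and x: "x \<noteq> 0"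
  have "\<bar>t\<bar> < 1 / (2 * B)" using t by (auto simp: dist_real_def)
  from sphpos_line(1)[OF B B0 this x] have v: "1/2 \<le> val (1 + t *\<^sub>R f) x" "val (1 + t *\<^sub>R f) x \<le> 3/2" by auto
  have "1 / max 2 B \<le> 1/2" by (intro divide_left_mono) auto
  then show "1 / max 2 B \<le> val (1 + t *\<^sub>R f) x \<and> val (1 + t *\<^sub>R f) x \<le> max 2 B" using v by linarith
  show "\<bar>val f x\<bar> \<le> max 2 B" using B[of x] by linarith
  show "((\<lambda>t. val (1 + t *\<^sub>R f) x) has_real_derivative val f x) (at t)"
    by (auto intro!: derivative_eq_intros)
qed (use t0 in auto)

text \<open>The hypothesis on \<open>f\<close> kills the first-order term. One application of
  l'Hopital reduces the quotient to the derivative of the first derivative at 0.\<close>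

lemma second_order_expansion:
  fixes f P :: "'a::euclidean_space sphfun"
  assumes fP: "intg (f * P) = 0"
  shows "((\<lambda>t. (intg (spow (1 + t *\<^sub>R f) p * P) - intg P) / t\<^sup>2) \<longlongrightarrow> p * (p - 1) / 2 * intg (f * f * P)) (at 0)"
proof -
  obtain B where B0: "B > 0" and B: "\<And>x. \<bar>val f x\<bar> \<le> B" using val_bounded[of f] by blast
  note D = DERIV_intg_spow_line[OF B B0]
  define N where "N t = intg (spow (1 + t *\<^sub>R f) p * P)" for t
  define N1 where "N1 t = p * intg (spow (1 + t *\<^sub>R f) (p - 1) * (f * P))" for t
  have DN: "(N has_real_derivative N1 t) (at t)" if "\<bar>t\<bar> < 1 / (2 * B)" for t
    unfolding N_def[abs_def] N1_def by (rule D[OF that])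
  have N0: "N 0 = intg P" "N1 0 = 0" using fP by (simp_all add: N_def N1_def spow_one)
  have "(N1 has_real_derivative p * ((p - 1) * intg (spow (1 + 0 *\<^sub>R f) (p - 1 - 1) * (f * (f * P))))) (at 0)"
    unfolding N1_def[abs_def] by (intro DERIV_cmult D) (use B0 in simp)
  then have DN1: "(N1 has_real_derivative p * (p - 1) * intg (f * f * P)) (at 0)"
    by (simp add: spow_one mult.assoc)
  have "\<forall>\<^sub>F t in nhds (0::real). t \<in> ball 0 (1 / (2 * B))" by (rule eventually_nhds_in_open) (use B0 in auto)
  then have ev: "\<forall>\<^sub>F t in at (0::real). t \<in> ball 0 (1 / (2 * B))" by (simp add: eventually_at_filter eventually_mono)
  have "((\<lambda>t. (N t - intg P) / t\<^sup>2) \<longlongrightarrow> p * (p - 1) / 2 * intg (f * f * P)) (at 0)"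
  proof (rule lhopital[where f' = N1 and g' = "\<lambda>t. 2 * t"])
    have "isCont N 0" using DN[of 0] B0 by (intro DERIV_isCont) auto
    then have "(N \<longlongrightarrow> intg P) (at 0)" unfolding isCont_def N0 .
    from LIM_zero[OF this] show "((\<lambda>t. N t - intg P) \<longlongrightarrow> 0) (at 0)" .
    show "((\<lambda>t::real. t\<^sup>2) \<longlongrightarrow> 0) (at 0)" by (auto intro!: tendsto_eq_intros)
    show "\<forall>\<^sub>F t in at 0. t\<^sup>2 \<noteq> (0::real)" "\<forall>\<^sub>F t in at 0. 2 * t \<noteq> (0::real)"
      by (auto simp: eventually_at_filter)
    show "\<forall>\<^sub>F t in at 0. ((\<lambda>t. N t - intg P) has_real_derivative N1 t) (at t)"
      using ev
    proof eventually_elim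
      case (elim t)
      then have "\<bar>t\<bar> < 1 / (2 * B)" by simp
      from DERIV_diff[OF DN[OF this] DERIV_const[of "intg P"]] show ?case by simp
    qed
    show "\<forall>\<^sub>F t in at 0. ((\<lambda>t::real. t\<^sup>2) has_real_derivative 2 * t) (at t)"
      by (intro always_eventually allI) (auto intro!: derivative_eq_intros)
    have "((\<lambda>t. (N1 t - N1 0) / (t - 0)) \<longlongrightarrow> p * (p - 1) * intg (f * f * P)) (at 0)"
      using DN1 unfolding has_field_derivative_iff .
    then have "((\<lambda>t. N1 t / t / 2) \<longlongrightarrow> p * (p - 1) * intg (f * f * P) / 2) (at 0)"
      unfolding N0 by (intro tendsto_intros) auto
    then show "((\<lambda>t. N1 t / (2 * t)) \<longlongrightarrow> p * (p - 1) / 2 * intg (f * f * P)) (at 0)"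
      by (simp add: mult.commute)
  qed
  then show ?thesis by (simp add: N_def)
qed

lemma powr_second_order:
  fixes N :: "real \<Rightarrow> real"
  assumes "((\<lambda>t. (N t - 1) / t\<^sup>2) \<longlongrightarrow> A) (at 0)"
  shows "((\<lambda>t. (N t powr q - 1) / t\<^sup>2) \<longlongrightarrow> q * A) (at 0)" and "(N \<longlongrightarrow> 1) (at 0)"
proof -
  have "((\<lambda>t. (N t - 1) / t\<^sup>2 * t\<^sup>2 + 1) \<longlongrightarrow> A * 0\<^sup>2 + 1) (at 0)"
    by (intro tendsto_intros assms)
  moreover have "\<forall>\<^sub>F t in at 0. (N t - 1) / t\<^sup>2 * t\<^sup>2 + 1 = N t"
    by (auto simp: eventually_at_filter)
  ultimately have "(N \<longlongrightarrow> A * 0\<^sup>2 + 1) (at 0)" by (rule Lim_transform_eventually)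
  then show N: "(N \<longlongrightarrow> 1) (at 0)" by simp
  have "((\<lambda>y. y powr q) has_real_derivative q * 1 powr (q - 1)) (at 1)"
    by (rule has_real_derivative_powr) simp
  \<comment> \<open>The Caratheodory slope function: the factorisation holds also at parameters
    where \<open>N t = 1\<close>, where a difference quotient would divide by zero.\<close>
  then obtain g where g: "\<And>z. z powr q - 1 = g z * (z - 1)" "isCont g 1" "g 1 = q"
    unfolding CARAT_DERIV by auto
  have "((\<lambda>t. g (N t) * ((N t - 1) / t\<^sup>2)) \<longlongrightarrow> q * A) (at 0)"
    using isCont_tendsto_compose[OF g(2) N] g(3) assms by (intro tendsto_mult) auto
  then show "((\<lambda>t. (N t powr q - 1) / t\<^sup>2) \<longlongrightarrow> q * A) (at 0)"
    by (simp add: g(1))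
qed

text \<open>The hypothesis is averaged over \<open>t\<close> and \<open>- t\<close>, which cancels
  the linear coefficient \<open>b\<close> whatever its value, and then divided by the square of
  \<open>t\<close>.\<close>

lemma second_variation_ineq:
  fixes N :: "real \<Rightarrow> real" and E0 b e A q :: real
  assumes N: "((\<lambda>t. (N t - 1) / t\<^sup>2) \<longlongrightarrow> A) (at 0)"
    and ev: "\<forall>\<^sub>F t in at 0. E0 * N t powr q \<le> E0 + t * b + t\<^sup>2 * e"
  shows "E0 * (q * A) \<le> e"
proof -
  have neg: "filterlim (\<lambda>t::real. - t) (at 0) (at 0)"
    by (auto simp: filterlim_at eventually_at_filter intro!: tendsto_eq_intros)
  let ?g = "\<lambda>t. (N t powr q - 1) / t\<^sup>2"
  have g: "(?g \<longlongrightarrow> q * A) (at 0)" by (rule powr_second_order(1)[OF N])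
  have "((\<lambda>t. E0 * ((?g t + ?g (- t)) / 2)) \<longlongrightarrow> E0 * ((q * A + q * A) / 2)) (at 0)"
    by (intro tendsto_intros g filterlim_compose[OF g neg]) auto
  moreover have "\<forall>\<^sub>F t in at 0. E0 * ((?g t + ?g (- t)) / 2) \<le> e"
    using ev eventually_compose_filterlim[OF ev neg] eventually_neq_at_within[of 0 0 UNIV]
  proof eventually_elim
    case (elim t)
    have "E0 * (N t powr q - 1) + E0 * (N (- t) powr q - 1) \<le> 2 * (t\<^sup>2 * e)"
      using elim by (simp add: algebra_simps)
    then have "(E0 * (N t powr q - 1) + E0 * (N (- t) powr q - 1)) / (2 * t\<^sup>2) \<le> e"
      using elim(3) by (simp add: divide_le_eq algebra_simps)
    then show ?case by (simp add: add_divide_distrib distrib_left)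
  qed
  ultimately have "E0 * ((q * A + q * A) / 2) \<le> e"
    by (rule tendsto_upperbound) simp
  then show ?thesis by (simp add: mult.commute)
qed

section \<open>Smooth functions on the sphere and their representatives\<close>

lemma sph_ext_val: "sph_ext (val V) = val V"
  using val_sgn[of V] by (auto simp: sph_ext_def sgn_div_norm fun_eq_iff)

lemma ex_sphfun:
  fixes u :: "'a::euclidean_space \<Rightarrow> real"
  assumes "sph_smooth u"
  shows "\<exists>U. \<forall>x. x \<noteq> 0 \<longrightarrow> sph_ext u x = val U x"
proof -
  define f where "f x = (if x = 0 then 0 else sph_ext u x)" for x
  have "smooth0 f"
    using assms unfolding sph_smooth_iff by (rule smooth0_cong) (simp add: f_def)
  moreover have "hom 0 f"
  proof -
    have "sph_ext u (c *\<^sub>R x) = sph_ext u x" if "c > 0" for c x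
    proof -
      have "inverse (c * norm x) * c = (inverse c * c) * inverse (norm x)" by simp
      also have "inverse c * c = 1" using that by simp
      finally have e: "inverse (c * norm x) * c = 1 * inverse (norm x)" .
      show ?thesis
        unfolding sph_ext_def norm_scaleR scaleR_scaleR abs_of_pos[OF that] e by simp
    qed
    then show ?thesis by (simp add: hom_def f_def)
  qed
  ultimately have "val (Abs_sphfun f) = f"
    by (intro Abs_sphfun_inverse) (simp add: f_def)
  then show ?thesis by (intro exI[of _ "Abs_sphfun f"]) (simp add: f_def)
qed

lemma sph_ext_cong_sphere:
  assumes "\<And>x. norm x = 1 \<Longrightarrow> u x = val U x" and x: "x \<noteq> 0"
  shows "sph_ext u x = val U x"
proof -
  have "norm (x /\<^sub>R norm x) = 1" using x by simp
  from assms(1)[OF this] show ?thesis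
    using val_sgn[of U x] by (simp add: sph_ext_def sgn_div_norm)
qed

text \<open>Agreement on the unit sphere suffices at each stage, because \<open>sph_lap\<close>
  extends along rays anew before every differentiation.\<close>

lemma gjms_eq:
  fixes U :: "'a::euclidean_space sphfun"
  assumes dim: "DIM('a) = Suc n"
    and "\<And>x. norm x = 1 \<Longrightarrow> u x = val U x" and "norm x = 1"
  shows "gjms n k u x = val (gj k U) x"
  using assms(2,3)
proof (induction k arbitrary: u U)
  case (Suc k)
  let ?v = "\<lambda>x. - sph_lap u x + ((real n - 2 * real (Suc k)) * (real n + 2 * real (Suc k) - 2) / 4) * u x"
  have "gjms n (Suc k) u = gjms n k ?v"
    by (simp add: gjms_def)
  moreover have "?v y = val (lapl U + gjms_const TYPE('a) (Suc k) *\<^sub>R U) y" if y: "norm y = 1" for y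
  proof -
    have "y \<noteq> 0" using y by auto
    then have "sph_lap u y = lap (val U) y"
      unfolding sph_lap_def lap_def[symmetric]
      by (intro lap_cong0 sph_ext_cong_sphere) (use Suc.prems in auto)
    moreover have "sdim TYPE('a) = real n" by (simp add: sdim_def dim)
    ultimately show ?thesis using Suc.prems(1)[OF y] y by (simp add: val_lapl gjms_const_def)
  qed
  ultimately show ?case using Suc.IH[of ?v] Suc.prems(2) by simp
qed (simp add: gjms_def)

definition qform :: "nat \<Rightarrow> 'a::euclidean_space sphfun \<Rightarrow> real" where
  "qform k f = intg (f * gj k f)"

lemma energy_eq:
  fixes U :: "'a::euclidean_space sphfun"
  assumes "DIM('a) = Suc n" and "\<And>x. norm x = 1 \<Longrightarrow> u x = val U x"
  shows "energy n k u = qform k U"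
  unfolding energy_def qform_def
  by (rule sph_integral_eq) (simp add: assms(2) gjms_eq[OF assms])

lemma Vset_iff:
  fixes U :: "'a::euclidean_space sphfun"
  assumes "\<And>x. norm x = 1 \<Longrightarrow> u x = val U x" and U: "sphpos U" and "sph_smooth u"
  shows "u \<in> Vset n k \<longleftrightarrow> intg (spow U (2 * real n / (real n - 2 * real k))) = intg (1 :: 'a sphfun)"
proof -
  let ?p = "2 * real n / (real n - 2 * real k)"
  have "\<bar>u x\<bar> powr ?p = val (spow U ?p) x" if "norm x = 1" for x
    using assms(1)[OF that] sphpos_nonneg[OF U, of x] by (simp add: val_spow[OF U])
  then have "sph_integral (\<lambda>x. \<bar>u x\<bar> powr ?p) = intg (spow U ?p)"
    by (rule sph_integral_eq)
  then show ?thesis using assms(3) by (simp add: Vset_def sph_vol_eq)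
qed

lemma smooth0_pdiffs: "smooth0 f \<Longrightarrow> set is \<subseteq> Basis \<Longrightarrow> smooth0 (pdiffs is f)"
  by (induction "is") (auto intro: smooth0_pdiff)

lemma pdiffs_linear:
  assumes f: "smooth0 f" "smooth0 g" and "set is \<subseteq> Basis" "x \<noteq> (0::'a::euclidean_space)"
  shows "pdiffs is (\<lambda>x. a * f x + b * g x) x = a * pdiffs is f x + b * pdiffs is g x"
  using assms(3,4)
proof (induction "is" arbitrary: x)
  case (Cons i "is")
  have s: "smooth0 (pdiffs is f)" "smooth0 (pdiffs is g)" "i \<in> Basis"
    using smooth0_pdiffs f Cons.prems by auto
  have "pdiffs (i # is) (\<lambda>x. a * f x + b * g x) x = pdiff i (\<lambda>x. a * pdiffs is f x + b * pdiffs is g x) x"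
    unfolding pdiffs.simps by (rule pdiff_cong0) (use Cons in auto)
  also have "\<dots> = a * pdiff i (pdiffs is f) x + b * pdiff i (pdiffs is g) x"
    using s Cons.prems by (simp add: pdiff_add pdiff_cmult smooth0_mult)
  finally show ?case by simp
qed simp

text \<open>There are finitely many derivative lists of bounded length, each giving a continuous
  function on a compact sphere; the sum of their bounds serves for all.\<close>

lemma pdiffs_bounded:
  fixes f :: "'a::euclidean_space \<Rightarrow> real"
  assumes f: "smooth0 f"
  shows "\<exists>B. \<forall>\<zeta>\<in>sphere 0 1. \<forall>is. set is \<subseteq> Basis \<and> length is \<le> m \<longrightarrow> \<bar>pdiffs is f \<zeta>\<bar> \<le> B"
proof -
  define I where "I = {is :: 'a list. set is \<subseteq> Basis \<and> length is \<le> m}"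
  have I: "finite I" unfolding I_def by (rule finite_lists_length_le) simp
  have "\<exists>B. \<forall>\<zeta>\<in>sphere 0 1. \<bar>pdiffs is f \<zeta>\<bar> \<le> B" if "is \<in> I" for "is"
  proof -
    have "continuous_on (sphere 0 1) (pdiffs is f)"
      by (rule continuous_on_subset[OF smooth0_continuous[OF smooth0_pdiffs[OF f]]]) (use that in \<open>auto simp: I_def\<close>)
    then show ?thesis using continuous_on_compact_bounded[OF compact_sphere] by blast
  qed
  then obtain B where B: "\<And>is \<zeta>. is \<in> I \<Longrightarrow> \<zeta> \<in> sphere 0 1 \<Longrightarrow> \<bar>pdiffs is f \<zeta>\<bar> \<le> B is" by metis
  have "\<bar>pdiffs is f \<zeta>\<bar> \<le> (\<Sum>is\<in>I. \<bar>B is\<bar>)" if "is \<in> I" "\<zeta> \<in> sphere 0 1" for "is" \<zeta>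
  proof -
    have "\<bar>pdiffs is f \<zeta>\<bar> \<le> \<bar>B is\<bar>" using B[OF that] by linarith
    also have "\<dots> \<le> (\<Sum>is\<in>I. \<bar>B is\<bar>)" by (rule member_le_sum) (use that I in auto)
    finally show ?thesis .
  qed
  then show ?thesis unfolding I_def by blast
qed

text \<open>Derivatives depend linearly on the function, so those of the curve differ from those of
  \<open>u\<close> by at most \<open>\<bar>c t - 1\<bar> * B1 + \<bar>c t * t\<bar> * B2\<close>.
  This puts the curve into every basic neighbourhood of \<open>u\<close> for small
  \<open>t\<close>.\<close>

lemma local_minimizer_line:
  fixes U W :: "'a::euclidean_space sphfun" and c :: "real \<Rightarrow> real"
  assumes dim: "DIM('a) = Suc n" and min: "local_minimizer n k u"
    and uU: "\<And>x. norm x = 1 \<Longrightarrow> u x = val U x"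
    and c: "(c \<longlongrightarrow> 1) (at 0)"
    and V: "\<forall>\<^sub>F t in at 0. sphpos (c t *\<^sub>R (U + t *\<^sub>R W)) \<and>
      intg (spow (c t *\<^sub>R (U + t *\<^sub>R W)) (2 * real n / (real n - 2 * real k))) = intg (1 :: 'a sphfun)"
  shows "\<forall>\<^sub>F t in at 0. qform k U \<le> qform k (c t *\<^sub>R (U + t *\<^sub>R W))"
proof -
  obtain m \<epsilon> where \<epsilon>: "\<epsilon> > 0" and loc: "\<And>v. v \<in> Vset n k \<Longrightarrow>
     (\<And>\<zeta> is. \<zeta> \<in> sphere 0 1 \<Longrightarrow> set is \<subseteq> Basis \<Longrightarrow> length is \<le> m \<Longrightarrow>
           \<bar>pdiffs is (sph_ext v) \<zeta> - pdiffs is (sph_ext u) \<zeta>\<bar> < \<epsilon>) \<Longrightarrow> energy n k u \<le> energy n k v"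
    using min unfolding local_minimizer_def by blast
  obtain B1 where B1: "\<And>\<zeta> is. \<zeta> \<in> sphere 0 1 \<Longrightarrow> set is \<subseteq> Basis \<Longrightarrow> length is \<le> m \<Longrightarrow> \<bar>pdiffs is (val U) \<zeta>\<bar> \<le> B1"
    using pdiffs_bounded[OF smooth0_val[of U], of m] by blast
  obtain B2 where B2: "\<And>\<zeta> is. \<zeta> \<in> sphere 0 1 \<Longrightarrow> set is \<subseteq> Basis \<Longrightarrow> length is \<le> m \<Longrightarrow> \<bar>pdiffs is (val W) \<zeta>\<bar> \<le> B2"
    using pdiffs_bounded[OF smooth0_val[of W], of m] by blast
  have "((\<lambda>t. \<bar>c t - 1\<bar> * B1 + \<bar>c t * t\<bar> * B2) \<longlongrightarrow> \<bar>1 - 1\<bar> * B1 + \<bar>1 * 0\<bar> * B2) (at 0)"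
    by (intro tendsto_intros c)
  then have small: "\<forall>\<^sub>F t in at 0. \<bar>c t - 1\<bar> * B1 + \<bar>c t * t\<bar> * B2 < \<epsilon>"
    using \<epsilon> by (intro order_tendstoD(2)) auto
  show ?thesis
    using V small
  proof eventually_elim
    case (elim t)
    let ?V = "c t *\<^sub>R (U + t *\<^sub>R W)"
    have sV: "sph_smooth (val ?V)" by (simp add: sph_smooth_iff sph_ext_val del: val_simps)
    have "energy n k u \<le> energy n k (val ?V)"
    proof (rule loc)
      show "val ?V \<in> Vset n k" using Vset_iff[OF refl _ sV] elim(1) by blast
      fix \<zeta> :: 'a and "is" :: "'a list" assume \<zeta>: "\<zeta> \<in> sphere 0 1" and "is": "set is \<subseteq> Basis" "length is \<le> m"
      have z: "\<zeta> \<noteq> 0" using \<zeta> by auto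
      have "pdiffs is (sph_ext (val ?V)) \<zeta> = pdiffs is (\<lambda>x. c t * val U x + (c t * t) * val W x) \<zeta>"
        unfolding sph_ext_val by (rule arg_cong[where f = "\<lambda>f. pdiffs is f \<zeta>"]) (simp add: fun_eq_iff algebra_simps)
      also have "\<dots> = c t * pdiffs is (val U) \<zeta> + (c t * t) * pdiffs is (val W) \<zeta>"
        by (rule pdiffs_linear) (use "is" z in auto)
      finally have 1: "pdiffs is (sph_ext (val ?V)) \<zeta> = c t * pdiffs is (val U) \<zeta> + (c t * t) * pdiffs is (val W) \<zeta>" .
      have 2: "pdiffs is (sph_ext u) \<zeta> = pdiffs is (val U) \<zeta>"
        by (rule pdiffs_cong0[OF sph_ext_cong_sphere]) (use uU z in auto)
      have "\<bar>pdiffs is (sph_ext (val ?V)) \<zeta> - pdiffs is (sph_ext u) \<zeta>\<bar>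
          = \<bar>(c t - 1) * pdiffs is (val U) \<zeta> + (c t * t) * pdiffs is (val W) \<zeta>\<bar>"
        unfolding 1 2 by (simp add: algebra_simps)
      also have "\<dots> \<le> \<bar>c t - 1\<bar> * B1 + \<bar>c t * t\<bar> * B2"
      proof -
        have "\<bar>(c t - 1) * pdiffs is (val U) \<zeta>\<bar> \<le> \<bar>c t - 1\<bar> * B1"
          unfolding abs_mult by (intro mult_left_mono B1 \<zeta> "is") auto
        moreover have "\<bar>(c t * t) * pdiffs is (val W) \<zeta>\<bar> \<le> \<bar>c t * t\<bar> * B2"
          unfolding abs_mult[of "c t * t"] by (intro mult_left_mono B2 \<zeta> "is") auto
        ultimately show ?thesis by linarith
      qed
      also have "\<dots> < \<epsilon>" by (rule elim(2))
      finally show "\<bar>pdiffs is (sph_ext (val ?V)) \<zeta> - pdiffs is (sph_ext u) \<zeta>\<bar> < \<epsilon>" .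
    qed
    then show ?case using energy_eq[OF dim uU] energy_eq[OF dim refl, of k ?V] by simp
  qed
qed

lemma qform_scaleR: "qform k (c *\<^sub>R f) = c\<^sup>2 * qform k f"
  by (simp add: qform_def gj_scaleR intg_scaleR power2_eq_square)

text \<open>Both cross terms are kept as they are; together they form the linear coefficient that
  \<open>second_variation_ineq\<close> removes.\<close>

lemma qform_line: "qform k (f + t *\<^sub>R g) = qform k f + t * (intg (f * gj k g) + intg (g * gj k f)) + t\<^sup>2 * qform k g"
  by (simp add: qform_def gj_add gj_scaleR distrib_left distrib_right intg_add intg_scaleR power2_eq_square)

text \<open>The variation is multiplicative, \<open>(1 + t f) U\<close>, rescaled to meet the volume
  constraint. The factor \<open>p - 1\<close> is what remains of \<open>p (p - 1) / 2\<close> after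
  the exponent \<open>2 / p\<close> by which the quadratic energy scales.\<close>

lemma second_variation:
  fixes U f :: "'a::euclidean_space sphfun"
  assumes dim: "DIM('a) = Suc n" and nk: "2 * k < n" and min: "local_minimizer n k u"
    and uU: "\<And>x. norm x = 1 \<Longrightarrow> u x = val U x" and U: "sphpos U"
  defines "p \<equiv> 2 * real n / (real n - 2 * real k)"
  assumes fU: "intg (f * spow U p) = 0"
  shows "qform k U * (p - 1) * intg (f * f * spow U p) / intg (1 :: 'a sphfun) \<le> qform k (f * U)"
proof -
  define \<omega> where "\<omega> = intg (1 :: 'a sphfun)"
  have \<omega>: "\<omega> > 0" unfolding \<omega>_def by (rule intg_pos) simp
  have p: "p > 0" using nk by (simp add: p_def)
  have "u \<in> Vset n k" "sph_smooth u" using min by (auto simp: local_minimizer_def Vset_def)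
  then have nU: "intg (spow U p) = \<omega>" using Vset_iff[OF uU U] unfolding p_def \<omega>_def by blast
  obtain B where B0: "B > 0" and B: "\<And>x. \<bar>val f x\<bar> \<le> B" using val_bounded[of f] by blast
  define N where "N t = intg (spow (1 + t *\<^sub>R f) p * spow U p) / \<omega>" for t
  have "((\<lambda>t. (intg (spow (1 + t *\<^sub>R f) p * spow U p) - \<omega>) / t\<^sup>2 / \<omega>)
      \<longlongrightarrow> p * (p - 1) / 2 * intg (f * f * spow U p) / \<omega>) (at 0)"
    using second_order_expansion[OF fU, of p] \<omega> unfolding nU by (intro tendsto_intros) auto
  moreover have "(intg (spow (1 + t *\<^sub>R f) p * spow U p) - \<omega>) / t\<^sup>2 / \<omega> = (N t - 1) / t\<^sup>2" for t
    using \<omega> by (simp add: N_def diff_divide_distrib)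
  ultimately have lim: "((\<lambda>t. (N t - 1) / t\<^sup>2) \<longlongrightarrow> p * (p - 1) / 2 * intg (f * f * spow U p) / \<omega>) (at 0)" by simp
  have N1: "(N \<longlongrightarrow> 1) (at 0)" by (rule powr_second_order(2)[OF lim])
  \<comment> \<open>The constraint is homogeneous of degree \<open>p\<close>, so this factor returns
    the curve to the constraint set.\<close>
  define c where "c t = N t powr (- 1 / p)" for t
  have c1: "(c \<longlongrightarrow> 1 powr (- 1 / p)) (at 0)" unfolding c_def by (intro tendsto_intros N1) auto
  have Npos: "\<forall>\<^sub>F t in at 0. N t > 0" using N1 by (intro order_tendstoD(1)) auto
  have "\<forall>\<^sub>F t in nhds (0::real). t \<in> ball 0 (1 / (2 * B))" by (rule eventually_nhds_in_open) (use B0 in auto)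
  then have near: "\<forall>\<^sub>F t in at (0::real). t \<in> ball 0 (1 / (2 * B))"
    by (simp add: eventually_at_filter eventually_mono)
  have V: "\<forall>\<^sub>F t in at 0. sphpos (c t *\<^sub>R (U + t *\<^sub>R (f * U))) \<and> intg (spow (c t *\<^sub>R (U + t *\<^sub>R (f * U))) p) = \<omega>"
    using Npos near
  proof eventually_elim
    case (elim t)
    have pos: "sphpos (1 + t *\<^sub>R f)" by (rule sphpos_line(2)[OF B B0]) (use elim in simp)
    have ct: "c t > 0" using elim by (simp add: c_def)
    have eq: "U + t *\<^sub>R (f * U) = (1 + t *\<^sub>R f) * U" by (simp add: distrib_right)
    have pos': "sphpos ((1 + t *\<^sub>R f) * U)" using pos U unfolding sphpos_def val_simps(4) by simp
    have "intg (spow (c t *\<^sub>R (U + t *\<^sub>R (f * U))) p) = c t powr p * (N t * \<omega>)"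
      unfolding eq spow_scaleR[OF ct pos'] spow_mult_base[OF pos U] intg_scaleR using \<omega> by (simp add: N_def)
    also have "c t powr p = 1 / N t"
      unfolding c_def powr_powr using elim p by (simp add: powr_minus_divide)
    finally show ?case using elim pos' ct by (simp add: eq sphpos_scaleR)
  qed
  have "\<forall>\<^sub>F t in at 0. qform k U \<le> qform k (c t *\<^sub>R (U + t *\<^sub>R (f * U)))"
    by (rule local_minimizer_line[OF dim min uU]) (use c1 V in \<open>simp_all add: p_def \<omega>_def\<close>)
  \<comment> \<open>Multiplying by \<open>N t powr (2 / p)\<close> cancels the squared normalising
    factor and leaves an exact quadratic polynomial in \<open>t\<close> on the right.\<close>
  then have "\<forall>\<^sub>F t in at 0. qform k U * N t powr (2 / p) \<le> qform k U +
      t * (intg (U * gj k (f * U)) + intg (f * U * gj k U)) + t\<^sup>2 * qform k (f * U)"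
    using Npos
  proof eventually_elim
    case (elim t)
    have "(c t)\<^sup>2 = N t powr (- 2 / p)"
      using elim by (simp add: c_def power2_eq_square powr_add[symmetric])
    then have 1: "(c t)\<^sup>2 * N t powr (2 / p) = 1"
      using elim by (simp add: powr_add[symmetric])
    have "qform k U * N t powr (2 / p) \<le> (c t)\<^sup>2 * qform k (U + t *\<^sub>R (f * U)) * N t powr (2 / p)"
      using elim(1) unfolding qform_scaleR by (intro mult_right_mono) auto
    also have "\<dots> = ((c t)\<^sup>2 * N t powr (2 / p)) * qform k (U + t *\<^sub>R (f * U))" by (simp only: mult_ac)
    finally have "qform k U * N t powr (2 / p) \<le> qform k (U + t *\<^sub>R (f * U))" unfolding 1 by simp
    then show ?case unfolding qform_line .
  qed
  from second_variation_ineq[OF lim this]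
  have "qform k U * (2 / p * (p * (p - 1) / 2 * intg (f * f * spow U p) / \<omega>)) \<le> qform k (f * U)" .
  then show ?thesis using p by (simp add: \<omega>_def mult.assoc)
qed


section \<open>Classification of the local minimizers\<close>

lemma spow_shift:
  assumes "sphpos \<tau>" "s + t = r"
  shows "spow \<tau> s * (spow \<tau> t * f) = spow \<tau> r * f"
  using spow_mult[OF assms(1), of s t] assms(2) by (simp add: mult.assoc[symmetric])

text \<open>Conjugation turns the energy of \<open>U\<close> into a part with one extra
  \<open>conf_lapl\<close> plus exactly the right-hand side of the hypothesis. The first part is
  thus not positive, while \<open>conf_gj_ge\<close> bounds it below by a positive multiple of the
  Dirichlet form of \<open>f\<close>.\<close>

lemma conformally_constant:
  fixes U :: "'a::euclidean_space sphfun"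
  assumes dim: "DIM('a) = Suc n" and n: "2 * Suc K < n" and U: "sphpos U"
    and ab: "a\<^sup>2 - b \<bullet> b = 1" and pos: "sphpos (aff a b)"
  defines "w \<equiv> spow (aff a b) (- 1) * U"
  assumes le: "qform (Suc K) U \<le> gjms_const TYPE('a) (Suc K) * qform K w"
  shows "\<exists>c>0. U = c *\<^sub>R spow (aff a b) (real (Suc K) - real n / 2)"
proof -
  define \<tau> where "\<tau> = aff a b"
  have pos: "sphpos \<tau>" using pos by (simp add: \<tau>_def)
  have sd: "sdim TYPE('a) = real n" by (simp add: sdim_def dim)
  \<comment> \<open>The exponent removes the conformal weight for order \<open>2 * Suc K\<close>.
    Then \<tau> to the power -1 times \<open>U\<close> carries precisely the weight for order
    \<open>2 * K\<close>, so one \<open>f\<close> serves both energies.\<close>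
  define f where "f = spow \<tau> (real n / 2 - real (Suc K)) * U"
  have Uf: "U = spow \<tau> (real K + 1 - real n / 2) * f"
    using spow_shift[OF pos, of "real K + 1 - real n / 2" "real n / 2 - real (Suc K)" 0 U]
    by (simp add: f_def spow_0[OF pos])
  have wf: "w = spow \<tau> (real K - real n / 2) * f"
    using spow_shift[OF pos, of "real K - real n / 2" "real n / 2 - real (Suc K)" "- 1" U]
    by (simp add: f_def w_def \<tau>_def)
  have U\<tau>: "U = w * \<tau>"
    using spow_shift[OF pos, of 1 "- 1" 0 U] by (simp add: w_def \<tau>_def[symmetric] spow_0[OF pos] spow_1[OF pos] mult.commute)
  have inner: "intg (w * gj K (spow \<tau> (real K - real n / 2) * h)) = conf_inner \<tau> f (conf_gj \<tau> K h)" for h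
  proof -
    have "gj K (spow \<tau> (real K - real n / 2) * h) = spow \<tau> (- real K - real n / 2) * conf_gj \<tau> K h"
      using gj_spow_aff[OF ab, folded \<tau>_def, OF pos, of K h] by (simp add: sd)
    moreover have "w * (spow \<tau> (- real K - real n / 2) * conf_gj \<tau> K h)
        = spow \<tau> (real K - real n / 2) * (spow \<tau> (- real K - real n / 2) * (f * conf_gj \<tau> K h))"
      unfolding wf by (simp only: mult_ac)
    moreover have "\<dots> = spow \<tau> (- real n) * (f * conf_gj \<tau> K h)" by (rule spow_shift[OF pos]) simp
    ultimately show ?thesis by (simp add: conf_inner_def sd)
  qed
  have qw: "qform K w = conf_inner \<tau> f (conf_gj \<tau> K f)"
    unfolding qform_def by (subst (2) wf) (rule inner)
  \<comment> \<open>One factor \<tau> is moved from the test function to the operator, the position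
    in which \<open>aff_gj_aff\<close> applies.\<close>
  have "qform (Suc K) U = intg (w * (\<tau> * gj (Suc K) U))"
    unfolding qform_def by (subst U\<tau>) (simp only: mult.assoc)
  also have "\<tau> * gj (Suc K) U = gj K (spow \<tau> (real K - real n / 2) * (conf_lapl \<tau> f + gjms_const TYPE('a) (Suc K) *\<^sub>R f))"
    using aff_gj_aff[OF ab, folded \<tau>_def, OF pos, of K f] unfolding sd Uf[symmetric] .
  finally have "qform (Suc K) U = conf_inner \<tau> f (conf_gj \<tau> K (conf_lapl \<tau> f)) + gjms_const TYPE('a) (Suc K) * qform K w"
    unfolding inner qw by (simp add: conf_gj_add conf_gj_scaleR conf_inner_add conf_inner_scaleR)
  with le have "conf_inner \<tau> f (conf_gj \<tau> K (conf_lapl \<tau> f)) \<le> 0" by simp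
  moreover have c: "gjms_const TYPE('a) j > 0" if "1 \<le> j" "j \<le> K" for j
    using that n by (simp add: gjms_const_def sd)
  have "(\<Prod>j=1..K. gjms_const TYPE('a) j) * conf_inner \<tau> f (conf_lapl \<tau> f) \<le> conf_inner \<tau> f (conf_gj \<tau> K (conf_lapl \<tau> f))"
    using conf_gj_ge[OF pos c, of K f 1] by simp
  moreover have "(\<Prod>j=1..K. gjms_const TYPE('a) j) > 0" using c by (intro prod_pos) auto
  ultimately have "conf_inner \<tau> f (conf_lapl \<tau> f) \<le> 0"
    by (smt (verit) mult_pos_pos)
  then have "intg (spow \<tau> (2 - real n) * grad2 f f) = 0"
    using conf_lapl_nonneg[OF pos, of f] by (simp add: conf_inner_lapl[OF pos] sd)
  then have 0: "spow \<tau> (2 - real n) * grad2 f f = 0"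
    by (rule intg_eq_0D[rotated]) (simp add: val_spow[OF pos] grad2_nonneg)
  have "grad2 f f = 0"
    using spow_shift[OF pos, of "real n - 2" "2 - real n" 0 "grad2 f f"] by (simp add: 0 spow_0[OF pos])
  then obtain c where c: "f = c *\<^sub>R 1" using grad2_eq_0_imp_const[of f] dim n by auto
  have Uc: "U = c *\<^sub>R spow \<tau> (real K + 1 - real n / 2)" by (subst Uf) (simp add: c)
  have "c > 0"
  proof -
    obtain x :: 'a where x: "x \<noteq> 0" using nonzero_Basis SOME_Basis by metis
    have "val U x > 0" using U x by (simp add: sphpos_def)
    then have "0 < c * val \<tau> x powr (real K + 1 - real n / 2)"
      unfolding Uc by (simp add: val_spow[OF pos])
    then show ?thesis by (simp add: zero_less_mult_iff)
  qed
  then show ?thesis using Uc by (intro exI[of _ c]) (simp add: \<tau>_def add.commute)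
qed

text \<open>Each boosted component divided by \<tau> is an admissible direction thanks to balancing.
  Their squares add up to 1, which collapses the left sides, and the boost and coordinate identities
  evaluate the sum of the right sides.\<close>

lemma balanced_second_variation:
  fixes U :: "'a::euclidean_space sphfun"
  assumes dim: "DIM('a) = Suc n" and nk: "2 * Suc K < n" and min: "local_minimizer n (Suc K) u"
    and uU: "\<And>x. norm x = 1 \<Longrightarrow> u x = val U x" and U: "sphpos U"
    and \<xi>: "norm \<xi> < 1" and \<gamma>: "\<gamma> > 0" "\<gamma>\<^sup>2 * (1 - \<xi> \<bullet> \<xi>) = 1"
  defines "p \<equiv> 2 * real n / (real n - 2 * real (Suc K))"
  assumes bal: "\<And>b. intg ((coord b + (\<xi> \<bullet> b) *\<^sub>R 1) * (spow (aff 1 \<xi>) (- 1) * spow U p)) = 0"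
  defines "w \<equiv> spow (aff \<gamma> (\<gamma> *\<^sub>R \<xi>)) (- 1) * U"
  shows "(p - 1) * qform (Suc K) U \<le> qform (Suc K) U + real (Suc K) * (real n + 2 * real K) * qform K w"
proof -
  define \<tau> where "\<tau> = aff \<gamma> (\<gamma> *\<^sub>R \<xi>)"
  define \<omega> where "\<omega> = intg (1 :: 'a sphfun)"
  have \<omega>: "\<omega> > 0" unfolding \<omega>_def by (rule intg_pos) simp
  have sd: "sdim TYPE('a) = real n" by (simp add: sdim_def dim)
  have p1: "sphpos (aff 1 \<xi>)" by (rule sphpos_aff[OF \<xi>])
  have \<tau>1: "\<tau> = \<gamma> *\<^sub>R aff 1 \<xi>" by (simp add: \<tau>_def aff_def coord_scaleR scaleR_add_right)
  have pos: "sphpos \<tau>" unfolding \<tau>1 by (rule sphpos_scaleR[OF \<gamma>(1) p1])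
  have \<tau>w: "\<tau> * w = U"
    using spow_shift[OF pos, of 1 "- 1" 0 U] by (simp add: w_def \<tau>_def[symmetric] spow_0[OF pos] spow_1[OF pos])
  define y where "y i = coord i + (\<gamma>\<^sup>2 / (\<gamma> + 1) * (\<xi> \<bullet> i)) *\<^sub>R coord \<xi> + (\<gamma> * (\<xi> \<bullet> i)) *\<^sub>R 1" for i
  define F where "F i = y i * spow \<tau> (- 1)" for i
  have FU: "F i * U = y i * w" for i by (simp add: F_def w_def \<tau>_def mult.assoc)
  have F0: "intg (F i * spow U p) = 0" for i
  proof -
    \<comment> \<open>The spatial part of row \<open>i\<close> of the boost. Its product with \<xi>
      is exactly the constant term of \<open>y i\<close>, so the balance condition applies with this
      \<open>b\<close>.\<close>
    define b where "b = i + (\<gamma>\<^sup>2 / (\<gamma> + 1) * (\<xi> \<bullet> i)) *\<^sub>R \<xi>"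
    have "\<gamma>\<^sup>2 * (\<xi> \<bullet> \<xi>) = \<gamma>\<^sup>2 - 1" using \<gamma>(2) by (simp add: right_diff_distrib)
    then have "\<gamma>\<^sup>2 * (\<xi> \<bullet> \<xi>) = (\<gamma> + 1) * (\<gamma> - 1)" by (simp add: algebra_simps power2_eq_square)
    then have "\<gamma>\<^sup>2 / (\<gamma> + 1) * (\<xi> \<bullet> \<xi>) = (\<gamma> + 1) * (\<gamma> - 1) / (\<gamma> + 1)"
      by (simp only: times_divide_eq_left)
    then have "\<gamma>\<^sup>2 / (\<gamma> + 1) * (\<xi> \<bullet> \<xi>) = \<gamma> - 1" using \<gamma>(1) by simp
    moreover have "\<xi> \<bullet> b = (\<xi> \<bullet> i) * (1 + \<gamma>\<^sup>2 / (\<gamma> + 1) * (\<xi> \<bullet> \<xi>))"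
      unfolding b_def inner_add_right inner_scaleR_right distrib_left by (simp only: mult_ac mult_1_right)
    ultimately have "\<xi> \<bullet> b = \<gamma> * (\<xi> \<bullet> i)" by simp
    then have "y i = coord b + (\<xi> \<bullet> b) *\<^sub>R 1" by (simp add: y_def b_def coord_add coord_scaleR)
    then have "F i * spow U p = \<gamma> powr (- 1) *\<^sub>R ((coord b + (\<xi> \<bullet> b) *\<^sub>R 1) * (spow (aff 1 \<xi>) (- 1) * spow U p))"
      unfolding F_def \<tau>1 spow_scaleR[OF \<gamma>(1) p1] by (simp add: mult.assoc)
    then show ?thesis by (simp only: intg_scaleR bal)
  qed
  have FF: "(\<Sum>i\<in>Basis. F i * F i) = 1"
  proof -
    \<comment> \<open>With the identity as operator, \<open>sum_boost\<close> says that the boosted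
      vector still lies on the light cone.\<close>
    have "(\<Sum>i\<in>Basis. y i * (y i * 1)) = \<tau> * (\<tau> * 1) + (\<Sum>i\<in>Basis. coord i * (coord i * 1)) - (1::'a sphfun)"
      unfolding y_def \<tau>_def by (rule sum_boost[where L = "\<lambda>f. f", OF _ _ \<gamma>]) auto
    then have yy: "(\<Sum>i\<in>Basis. y i * y i) = \<tau> * \<tau>" by (simp add: sum_coord_sq)
    have "(\<Sum>i\<in>Basis. F i * F i) = (\<Sum>i\<in>Basis. y i * y i) * (spow \<tau> (- 1) * spow \<tau> (- 1))"
      unfolding sum_distrib_right by (rule sum.cong) (simp_all add: F_def mult_ac)
    also have "\<dots> = (spow \<tau> (- 1) * spow \<tau> 1) * (spow \<tau> (- 1) * spow \<tau> 1)"
      unfolding yy spow_1[OF pos] by (simp only: mult_ac)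
    also have "\<dots> = 1" unfolding spow_mult[OF pos] by (simp add: spow_0[OF pos])
    finally show ?thesis .
  qed
  have "u \<in> Vset n (Suc K)" "sph_smooth u" using min by (auto simp: local_minimizer_def Vset_def)
  then have nU: "intg (spow U p) = \<omega>" using Vset_iff[OF uU U] unfolding p_def \<omega>_def by blast
  have sv: "qform (Suc K) U * (p - 1) * intg (F i * F i * spow U p) / \<omega> \<le> qform (Suc K) (y i * w)" for i
    using second_variation[OF dim nk min uU U F0[unfolded p_def]] unfolding p_def \<omega>_def FU .
  have "(p - 1) * qform (Suc K) U = qform (Suc K) U * (p - 1) * intg ((\<Sum>i\<in>Basis. F i * F i) * spow U p) / \<omega>"
    unfolding FF using \<omega> by (simp add: nU)
  also have "\<dots> = (\<Sum>i\<in>Basis. qform (Suc K) U * (p - 1) * intg (F i * F i * spow U p) / \<omega>)"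
    by (simp add: sum_distrib_right intg_sum sum_distrib_left sum_divide_distrib)
  also have "\<dots> \<le> (\<Sum>i\<in>Basis. qform (Suc K) (y i * w))" by (rule sum_mono) (rule sv)
  also have "\<dots> = intg (w * (\<Sum>i\<in>Basis. y i * gj (Suc K) (y i * w)))"
    unfolding qform_def sum_distrib_left intg_sum by (rule sum.cong) (simp_all only: mult_ac)
  also have "(\<Sum>i\<in>Basis. y i * gj (Suc K) (y i * w))
      = \<tau> * gj (Suc K) (\<tau> * w) + (\<Sum>i\<in>Basis. coord i * gj (Suc K) (coord i * w)) - gj (Suc K) w"
    unfolding y_def \<tau>_def by (rule sum_boost[OF gj_add gj_scaleR \<gamma>])
  also have "\<dots> = \<tau> * gj (Suc K) U + (real (Suc K) * (real n + 2 * real K)) *\<^sub>R gj K w"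
    unfolding sum_coord_gj_coord \<tau>w sd by simp
  also have "w * (\<tau> * gj (Suc K) U + (real (Suc K) * (real n + 2 * real K)) *\<^sub>R gj K w)
      = (\<tau> * w) * gj (Suc K) U + (real (Suc K) * (real n + 2 * real K)) *\<^sub>R (w * gj K w)"
    by (simp add: distrib_left mult_ac)
  also have "intg \<dots> = qform (Suc K) U + real (Suc K) * (real n + 2 * real K) * qform K w"
    unfolding \<tau>w qform_def by (simp only: intg_add intg_scaleR)
  finally show ?thesis .
qed

theorem theorem1p1:
  fixes n k :: nat and u :: "'a::euclidean_space \<Rightarrow> real"
  assumes "DIM('a) = Suc n" and "0 < k" and "2 * k < n"
    and "u \<in> Vset n k"
    and "\<forall>\<zeta> \<in> sphere 0 1. u \<zeta> > 0"
    and "local_minimizer n k u"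
  shows "\<exists>\<xi>::'a. norm \<xi> < 1 \<and> (\<forall>\<zeta> \<in> sphere 0 1.
           u \<zeta> = ((1 + \<xi> \<bullet> \<zeta>) / sqrt (1 - (norm \<xi>)\<^sup>2))
                   powr (- (real n - 2 * real k) / 2))"
proof -
  obtain K where k: "k = Suc K" using assms(2) gr0_conv_Suc by blast
  note dim = assms(1) and nk = assms(3)[unfolded k] and min = assms(6)[unfolded k]
  have sd: "sdim TYPE('a) = real n" by (simp add: sdim_def dim)
  have su: "sph_smooth u" using assms(4) by (simp add: Vset_def)
  obtain U where ext: "\<And>x. x \<noteq> 0 \<Longrightarrow> sph_ext u x = val U x" using ex_sphfun[OF su] by blast
  have uU: "u x = val U x" if "norm x = 1" for x
  proof -
    have "x \<noteq> 0" using that by auto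
    then show ?thesis using ext[of x] that by (simp add: sph_ext_def)
  qed
  have U: "sphpos U"
    unfolding sphpos_def
  proof (intro allI impI)
    fix x :: 'a assume "x \<noteq> 0"
    then have "sgn x \<in> sphere 0 1" by (simp add: norm_sgn)
    with assms(5) have "0 < u (sgn x)" by blast
    moreover have "norm (sgn x) = 1" using \<open>x \<noteq> 0\<close> by (simp add: norm_sgn)
    ultimately show "0 < val U x" using uU[of "sgn x"] val_sgn[of U x] by simp
  qed
  define p where "p = 2 * real n / (real n - 2 * real (Suc K))"
  define \<omega> where "\<omega> = intg (1 :: 'a sphfun)"
  have \<omega>: "\<omega> > 0" unfolding \<omega>_def by (rule intg_pos) simp
  have nU: "intg (spow U p) = \<omega>"
    using assms(4) Vset_iff[OF uU U su] unfolding k p_def \<omega>_def by blast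
  obtain \<xi> where \<xi>: "norm \<xi> < 1"
    and bal: "\<And>b. intg ((coord b + (\<xi> \<bullet> b) *\<^sub>R 1) * (spow (aff 1 \<xi>) (- 1) * spow U p)) = 0"
    using balance[OF _ sphpos_spow[OF U]] dim nk by auto
  \<comment> \<open>The Lorentz factor of the velocity \<xi>; it normalises the affine function to
    \<open>a\<^sup>2 - b \<bullet> b = 1\<close>.\<close>
  define \<gamma> where "\<gamma> = 1 / sqrt (1 - (norm \<xi>)\<^sup>2)"
  have s: "1 - (norm \<xi>)\<^sup>2 > 0" using \<xi> by (simp add: power_less_one_iff)
  have \<gamma>: "\<gamma> > 0" "\<gamma>\<^sup>2 * (1 - \<xi> \<bullet> \<xi>) = 1"
    using s by (simp_all add: \<gamma>_def power_divide power2_norm_eq_inner)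
  define \<tau> where "\<tau> = aff \<gamma> (\<gamma> *\<^sub>R \<xi>)"
  have ab: "\<gamma>\<^sup>2 - (\<gamma> *\<^sub>R \<xi>) \<bullet> (\<gamma> *\<^sub>R \<xi>) = 1"
    using \<gamma>(2) by (simp add: algebra_simps power2_eq_square)
  have pos: "sphpos \<tau>" unfolding \<tau>_def by (rule sphpos_aff) (use \<xi> \<gamma>(1) in simp)
  let ?E = "qform (Suc K) U" and ?I = "qform K (spow \<tau> (- 1) * U)"
  have "(p - 1) * ?E \<le> ?E + real (Suc K) * (real n + 2 * real K) * ?I"
    using balanced_second_variation[OF dim nk min uU U \<xi> \<gamma> bal[unfolded p_def]] unfolding p_def \<tau>_def .
  then have le: "(p - 2) * ?E \<le> real (Suc K) * (real n + 2 * real K) * ?I" by (simp add: algebra_simps)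
  define d where "d = real n - 2 * real (Suc K)"
  have d: "d > 0" using nk unfolding d_def by linarith
  have p: "p = 2 * real n / d" by (simp add: p_def d_def)
  \<comment> \<open>This value of \<open>p - 2\<close> converts the factor
    \<open>real (Suc K) * (real n + 2 * real K)\<close> of the second variation into four times
    \<open>real (Suc K)\<close> times the constant \<open>gjms_const\<close> at
    \<open>Suc K\<close>.\<close>
  have pd: "(p - 2) * d = 4 * real (Suc K)"
    using d by (simp add: p left_diff_distrib) (simp add: d_def)
  have "4 * real (Suc K) * ?E = ((p - 2) * ?E) * d" unfolding pd[symmetric] by (simp only: mult_ac)
  also have "\<dots> \<le> (real (Suc K) * (real n + 2 * real K) * ?I) * d"
    using le d by (intro mult_right_mono) auto
  also have "\<dots> = 4 * real (Suc K) * (gjms_const TYPE('a) (Suc K) * ?I)"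
    by (simp add: gjms_const_def sd d_def) (simp add: algebra_simps)
  finally have "4 * real (Suc K) * ?E \<le> 4 * real (Suc K) * (gjms_const TYPE('a) (Suc K) * ?I)" .
  then have "?E \<le> gjms_const TYPE('a) (Suc K) * ?I" by (rule mult_left_le_imp_le) simp
  then obtain c where c: "c > 0" "U = c *\<^sub>R spow \<tau> (real (Suc K) - real n / 2)"
    using conformally_constant[OF dim nk U ab] pos unfolding \<tau>_def by blast
  \<comment> \<open>The power \<open>p\<close> of the conformal weight is the volume density, so the
    constraint compares \<open>c powr p\<close> times the conformal volume with the round volume,
    and these volumes agree.\<close>
  have pe: "(real (Suc K) - real n / 2) * p = - real n"
    using d by (simp add: p) (simp add: d_def field_simps)
  have "spow U p = c powr p *\<^sub>R spow \<tau> (- real n)"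
    unfolding c(2) spow_scaleR[OF c(1) sphpos_spow[OF pos]] spow_spow[OF pos] pe ..
  moreover have "intg (spow \<tau> (- real n)) = \<omega>"
    using intg_spow_aff[OF ab \<gamma>(1)] nk unfolding sd \<tau>_def \<omega>_def by simp
  ultimately have "c powr p * \<omega> = \<omega>" using nU by (simp add: intg_scaleR)
  then have "c powr p = 1" using \<omega> by simp
  moreover have "p > 0" using d nk by (simp add: p)
  ultimately have c1: "c = 1"
    using c(1) by (metis less_irrefl ln_one ln_powr mult_eq_0_iff ln_eq_zero_iff)
  show ?thesis
  proof (intro exI[of _ \<xi>] conjI \<xi> ballI)
    fix \<zeta> :: 'a assume \<zeta>: "\<zeta> \<in> sphere 0 1"
    then have z: "norm \<zeta> = 1" "\<zeta> \<noteq> 0" by auto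
    have "u \<zeta> = val \<tau> \<zeta> powr (real (Suc K) - real n / 2)"
      using uU[OF z(1)] by (subst (asm) c(2)) (simp add: c1 val_spow[OF pos])
    also have "val \<tau> \<zeta> = (1 + \<xi> \<bullet> \<zeta>) / sqrt (1 - (norm \<xi>)\<^sup>2)"
      using z by (simp add: \<tau>_def val_aff \<gamma>_def inner_commute add_divide_distrib)
    also have "real (Suc K) - real n / 2 = - (real n - 2 * real k) / 2" by (simp add: k field_simps)
    finally show "u \<zeta> = ((1 + \<xi> \<bullet> \<zeta>) / sqrt (1 - (norm \<xi>)\<^sup>2)) powr (- (real n - 2 * real k) / 2)" .
  qed
qed

end
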